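(* Let $(A,\circ)$ be a finite-dimensional Novikov algebra over $\mathbf{k}$ and $(B=\oplus_{i\in\mathbb{Z}}B_i,\diamond,(\cdot,\cdot))$ a quadratic $\mathbb{Z}$-graded right Novikov algebra. Let $L=A\otimes B$ be the induced Lie algebra. (1) Suppose that $r=\sum_\alpha x_\alpha\otimes y_\alpha\in A\otimes A$ is a skewsymmetric solution of the Novikov Yang-Baxter equation (NYBE) in $A$. Then for a basis $\{e_p\}_{p\in\Pi}$ of $B$ consisting of homogeneous elements and its homogeneous dual basis $\{f_p\}_{p\in\Pi}$ associated with $(\cdot,\cdot)$, the tensor element $$r_L:=\sum_{p\in\Pi}\sum_\alpha(x_\alpha\otimes e_p)\otimes(y_\alpha\otimes f_p)\in L\,\widehat{\otimes}\,L$$ is a skewsymmetric completed solution of the classical Yang-Baxter equation (CYBE) in $L$. (2) Suppose $B=\mathbf{k}[t,t^{-1}]$ with $B_i=\mathbf{k}t^{i+1}$, $t^i\diamond t^j=it^{i+j-1}$ and $(t^i,t^j)=\delta_{i+j+1,0}$, and let $r=\sum_\alpha x_\alpha\otimes y_\alpha\in A\otimes A$. Then $r_L:=\sum_{i\in\mathbb{Z}}\sum_\alpha x_\alpha t^i\otimes y_\alpha t^{-i-1}\in L\,\widehat{\otimes}\,L$ (where $at^i:=a\otimes t^i$) is a skewsymmetric completed solution of the CYBE in $L$ if and only if $r$ is a skewsymmetric solution of the NYBE in $A$.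
   Context: $\mathbf{k}$ is a field of characteristic zero. A Novikov algebra $(A,\circ)$: $(a\circ b)\circ c-a\circ(b\circ c)=(b\circ a)\circ c-b\circ(a\circ c)$ and $(a\circ b)\circ c=(a\circ c)\circ b$. A right Novikov algebra $(B,\diamond)$: $(a\diamond b)\diamond c-a\diamond(b\diamond c)=(a\diamond c)\diamond b-a\diamond(c\diamond b)$ and $a\diamond(b\diamond c)=b\diamond(a\diamond c)$. $\mathbb{Z}$-graded: $B=\oplus_{i\in\mathbb{Z}}B_i$, each $B_i$ finite-dimensional, $B_i\diamond B_j\subset B_{i+j}$. Quadratic $\mathbb{Z}$-graded: with a symmetric nondegenerate bilinear form that is graded (there is $m\in\mathbb{Z}$ with $(B_i,B_j)=0$ whenever $i+j+m\neq0$) and satisfies $(a\diamond b,c)=-(a,b\diamond c+c\diamond b)$. The dual basis satisfies $(e_p,f_q)=\delta_{p,q}$. The induced Lie algebra is $L=A\otimes B$ with $[a_1\otimes b_1,a_2\otimes b_2]=a_1\circ a_2\otimes b_1\diamond b_2-a_2\circ a_1\otimes b_2\diamond b_1$, graded by $L_i=A\otimes B_i$. NYBE in $A$ for $r=\sum_\alpha x_\alpha\otimes y_\alpha$: $\sum_{\alpha,\beta}\big(x_\alpha\otimes x_\beta\otimes y_\alpha\circ y_\beta+x_\alpha\otimes(y_\alpha\circ x_\beta+x_\beta\circ y_\alpha)\otimes y_\beta+x_\alpha\circ x_\beta\otimes y_\beta\otimes y_\alpha\big)=0$. Skewsymmetric means $\tau r=-r$ ($\tau$ the flip). For a $\mathbb{Z}$-graded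 Lie algebra $L$, $L\,\widehat{\otimes}\,L:=\prod_{i,j\in\mathbb{Z}}L_i\otimes L_j$ and $L\,\widehat{\otimes}\,L\,\widehat{\otimes}\,L:=\prod_{i,j,k}L_i\otimes L_j\otimes L_k$; elements of the former are formal sums $r=\sum_{i,j,\alpha}a_{i\alpha}\otimes b_{j\alpha}$, $a_{i\alpha}\in L_i$, $b_{j\alpha}\in L_j$, finitely many $\alpha$ per $(i,j)$; $\widehat{\tau}$ is the termwise flip and $r$ is skewsymmetric if $\widehat{\tau}r=-r$. A skewsymmetric $r$ is a completed solution of the CYBE in $L$ if $[r_{12},r_{13}]+[r_{12},r_{23}]+[r_{13},r_{23}]=0$ in $L\,\widehat{\otimes}\,L\,\widehat{\otimes}\,L$, where $[r_{12},r_{13}]=\sum[a_{i\alpha},a_{k\beta}]\otimes b_{j\alpha}\otimes b_{l\beta}$, $[r_{12},r_{23}]=\sum a_{i\alpha}\otimes[b_{j\alpha},a_{k\beta}]\otimes b_{l\beta}$, $[r_{13},r_{23}]=\sum a_{i\alpha}\otimes a_{k\beta}\otimes[b_{j\alpha},b_{l\beta}]$ (sums over $i,j,k,l,\alpha,\beta$). These sums make sense when $r=\sum_{i,\alpha}c_{i,\alpha}\otimes d_{-i-s,\alpha}$ for a fixed $s\in\mathbb{Z}$ (with $c_{i,\alpha}\in L_i$, $d_{-i-s,\alpha}\in L_{-i-s}$), which is the case for $r_L$. *)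

theory Defs
  imports "Jordan_Normal_Form.VS_Connect" "HOL-Library.Poly_Mapping"
begin

text \<open>
  Vector spaces are carrier-based (\<^locale>\<open>vectorspace\<close>) over the type-class field
  \<^term>\<open>class_ring\<close>.  The \<^const>\<open>mult\<close> field of the module record holds the (nonassociative,
  nonunital) product of an algebra; it is \<^const>\<open>undefined\<close> for plain vector spaces, and the
  \<^const>\<open>one\<close> field is never used.
\<close>

notation mult (infixl "\<star>\<index>" 70)


subsection \<open>Novikov algebras\<close>

locale nonassoc_algebra = vectorspace "class_ring :: 'k ring" A
  for A :: "('k::field, 'a) module" +
  assumes prod_closed: "\<lbrakk>a \<in> carrier A; b \<in> carrier A\<rbrakk> \<Longrightarrow> a \<star>\<^bsub>A\<^esub> b \<in> carrier A"
    and prod_add_left: "\<lbrakk>a \<in> carrier A; b \<in> carrier A; c \<in> carrier A\<rbrakk>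
      \<Longrightarrow> (a \<oplus>\<^bsub>A\<^esub> b) \<star>\<^bsub>A\<^esub> c = a \<star>\<^bsub>A\<^esub> c \<oplus>\<^bsub>A\<^esub> b \<star>\<^bsub>A\<^esub> c"
    and prod_add_right: "\<lbrakk>a \<in> carrier A; b \<in> carrier A; c \<in> carrier A\<rbrakk>
      \<Longrightarrow> a \<star>\<^bsub>A\<^esub> (b \<oplus>\<^bsub>A\<^esub> c) = a \<star>\<^bsub>A\<^esub> b \<oplus>\<^bsub>A\<^esub> a \<star>\<^bsub>A\<^esub> c"
    and prod_smult_left: "\<lbrakk>a \<in> carrier A; b \<in> carrier A\<rbrakk>
      \<Longrightarrow> (s \<odot>\<^bsub>A\<^esub> a) \<star>\<^bsub>A\<^esub> b = s \<odot>\<^bsub>A\<^esub> (a \<star>\<^bsub>A\<^esub> b)"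
    and prod_smult_right: "\<lbrakk>a \<in> carrier A; b \<in> carrier A\<rbrakk>
      \<Longrightarrow> a \<star>\<^bsub>A\<^esub> (s \<odot>\<^bsub>A\<^esub> b) = s \<odot>\<^bsub>A\<^esub> (a \<star>\<^bsub>A\<^esub> b)"

locale novikov_algebra = nonassoc_algebra A
  for A :: "('k::field, 'a) module" +
  assumes left_symmetric: "\<lbrakk>a \<in> carrier A; b \<in> carrier A; c \<in> carrier A\<rbrakk>
      \<Longrightarrow> (a \<star>\<^bsub>A\<^esub> b) \<star>\<^bsub>A\<^esub> c \<ominus>\<^bsub>A\<^esub> a \<star>\<^bsub>A\<^esub> (b \<star>\<^bsub>A\<^esub> c)
        = (b \<star>\<^bsub>A\<^esub> a) \<star>\<^bsub>A\<^esub> c \<ominus>\<^bsub>A\<^esub> b \<star>\<^bsub>A\<^esub> (a \<star>\<^bsub>A\<^esub> c)"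
    and right_commutative: "\<lbrakk>a \<in> carrier A; b \<in> carrier A; c \<in> carrier A\<rbrakk>
      \<Longrightarrow> (a \<star>\<^bsub>A\<^esub> b) \<star>\<^bsub>A\<^esub> c = (a \<star>\<^bsub>A\<^esub> c) \<star>\<^bsub>A\<^esub> b"

locale right_novikov_algebra = nonassoc_algebra B
  for B :: "('k::field, 'b) module" +
  assumes right_symmetric: "\<lbrakk>a \<in> carrier B; b \<in> carrier B; c \<in> carrier B\<rbrakk>
      \<Longrightarrow> (a \<star>\<^bsub>B\<^esub> b) \<star>\<^bsub>B\<^esub> c \<ominus>\<^bsub>B\<^esub> a \<star>\<^bsub>B\<^esub> (b \<star>\<^bsub>B\<^esub> c)
        = (a \<star>\<^bsub>B\<^esub> c) \<star>\<^bsub>B\<^esub> b \<ominus>\<^bsub>B\<^esub> a \<star>\<^bsub>B\<^esub> (c \<star>\<^bsub>B\<^esub> b)"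
    and left_commutative: "\<lbrakk>a \<in> carrier B; b \<in> carrier B; c \<in> carrier B\<rbrakk>
      \<Longrightarrow> a \<star>\<^bsub>B\<^esub> (b \<star>\<^bsub>B\<^esub> c) = b \<star>\<^bsub>B\<^esub> (a \<star>\<^bsub>B\<^esub> c)"

locale graded_right_novikov_algebra = right_novikov_algebra B
  for B :: "('k::field, 'b) module" and G :: "int \<Rightarrow> 'b set" +
  assumes G_subspace: "subspace class_ring (G i) B"
    and G_fin_dim: "vectorspace.fin_dim class_ring (B\<lparr>carrier := G i\<rparr>)"
    and G_direct_sum: "b \<in> carrier B
      \<Longrightarrow> \<exists>!c. (\<forall>i. c i \<in> G i) \<and> finite {i. c i \<noteq> \<zero>\<^bsub>B\<^esub>} \<and> b = (\<Oplus>\<^bsub>B\<^esub>i\<in>{i. c i \<noteq> \<zero>\<^bsub>B\<^esub>}. c i)"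
    and G_prod: "\<lbrakk>a \<in> G i; b \<in> G j\<rbrakk> \<Longrightarrow> a \<star>\<^bsub>B\<^esub> b \<in> G (i + j)"

locale quadratic_graded_right_novikov_algebra = graded_right_novikov_algebra B G
  for B :: "('k::field, 'b) module" and G :: "int \<Rightarrow> 'b set" +
  fixes \<omega> :: "'b \<Rightarrow> 'b \<Rightarrow> 'k"
  assumes form_add_left: "\<lbrakk>a \<in> carrier B; b \<in> carrier B; c \<in> carrier B\<rbrakk>
      \<Longrightarrow> \<omega> (a \<oplus>\<^bsub>B\<^esub> b) c = \<omega> a c + \<omega> b c"
    and form_smult_left: "\<lbrakk>a \<in> carrier B; b \<in> carrier B\<rbrakk> \<Longrightarrow> \<omega> (s \<odot>\<^bsub>B\<^esub> a) b = s * \<omega> a b"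
    and form_sym: "\<lbrakk>a \<in> carrier B; b \<in> carrier B\<rbrakk> \<Longrightarrow> \<omega> a b = \<omega> b a"
    and form_nondegenerate: "\<lbrakk>a \<in> carrier B; \<And>b. b \<in> carrier B \<Longrightarrow> \<omega> a b = 0\<rbrakk> \<Longrightarrow> a = \<zero>\<^bsub>B\<^esub>"
    and form_graded: "\<exists>m. \<forall>i j. i + j + m \<noteq> 0 \<longrightarrow> (\<forall>a\<in>G i. \<forall>b\<in>G j. \<omega> a b = 0)"
    and form_invariant: "\<lbrakk>a \<in> carrier B; b \<in> carrier B; c \<in> carrier B\<rbrakk>
      \<Longrightarrow> \<omega> (a \<star>\<^bsub>B\<^esub> b) c = - \<omega> a (b \<star>\<^bsub>B\<^esub> c \<oplus>\<^bsub>B\<^esub> c \<star>\<^bsub>B\<^esub> b)"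

definition homogeneous_basis ::
  "('k::field, 'b) module \<Rightarrow> (int \<Rightarrow> 'b set) \<Rightarrow> 'p set \<Rightarrow> ('p \<Rightarrow> 'b) \<Rightarrow> bool" where
  "homogeneous_basis B G P e \<longleftrightarrow>
     inj_on e P \<and> vectorspace.basis class_ring B (e ` P) \<and> (\<forall>p\<in>P. \<exists>i. e p \<in> G i)"


subsection \<open>Tensor products\<close>

abbreviation scal :: "'k::field \<Rightarrow> ('p \<Rightarrow>\<^sub>0 'k) \<Rightarrow> ('p \<Rightarrow>\<^sub>0 'k)" where
  "scal s u \<equiv> Poly_Mapping.map ((*) s) u"

text \<open>
  \<open>V \<boxtimes> W\<close> is the quotient of the free vector space on \<open>V \<times> W\<close> by the subspace
  \<open>tensor_rel V W\<close> generated by the bilinearity relations; its elements are cosets.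
\<close>

inductive_set tensor_rel ::
  "('k::field, 'v) module \<Rightarrow> ('k, 'w) module \<Rightarrow> ('v \<times> 'w \<Rightarrow>\<^sub>0 'k) set"
  for V :: "('k::field, 'v) module" and W :: "('k, 'w) module" where
  zero: "0 \<in> tensor_rel V W"
| add: "\<lbrakk>u \<in> tensor_rel V W; u' \<in> tensor_rel V W\<rbrakk> \<Longrightarrow> u + u' \<in> tensor_rel V W"
| scal: "u \<in> tensor_rel V W \<Longrightarrow> scal s u \<in> tensor_rel V W"
| add_left: "\<lbrakk>v \<in> carrier V; v' \<in> carrier V; w \<in> carrier W\<rbrakk> \<Longrightarrow>
    Poly_Mapping.single (v \<oplus>\<^bsub>V\<^esub> v', w) 1 - Poly_Mapping.single (v, w) 1
      - Poly_Mapping.single (v', w) 1 \<in> tensor_rel V W"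
| add_right: "\<lbrakk>v \<in> carrier V; w \<in> carrier W; w' \<in> carrier W\<rbrakk> \<Longrightarrow>
    Poly_Mapping.single (v, w \<oplus>\<^bsub>W\<^esub> w') 1 - Poly_Mapping.single (v, w) 1
      - Poly_Mapping.single (v, w') 1 \<in> tensor_rel V W"
| smult_left: "\<lbrakk>v \<in> carrier V; w \<in> carrier W\<rbrakk> \<Longrightarrow>
    Poly_Mapping.single (s \<odot>\<^bsub>V\<^esub> v, w) 1 - Poly_Mapping.single (v, w) s \<in> tensor_rel V W"
| smult_right: "\<lbrakk>v \<in> carrier V; w \<in> carrier W\<rbrakk> \<Longrightarrow>
    Poly_Mapping.single (v, s \<odot>\<^bsub>W\<^esub> w) 1 - Poly_Mapping.single (v, w) s \<in> tensor_rel V W"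

definition tensor_class ::
  "('k::field, 'v) module \<Rightarrow> ('k, 'w) module \<Rightarrow> ('v \<times> 'w \<Rightarrow>\<^sub>0 'k) \<Rightarrow> ('v \<times> 'w \<Rightarrow>\<^sub>0 'k) set" where
  "tensor_class V W u = {u + n | n. n \<in> tensor_rel V W}"

definition tensor_space ::
  "('k::field, 'v) module \<Rightarrow> ('k, 'w) module \<Rightarrow> ('k, ('v \<times> 'w \<Rightarrow>\<^sub>0 'k) set) module"
  (infixl "\<boxtimes>" 70) where
  "V \<boxtimes> W =
     \<lparr>carrier = {tensor_class V W u | u. Poly_Mapping.keys u \<subseteq> carrier V \<times> carrier W},
      mult = undefined,
      one = undefined,
      zero = tensor_class V W 0,
      add = (\<lambda>X Y. {x + y | x y. x \<in> X \<and> y \<in> Y}),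
      smult = (\<lambda>s X. {scal s x + n | x n. x \<in> X \<and> n \<in> tensor_rel V W})\<rparr>"

definition tens ::
  "('k::field, 'v) module \<Rightarrow> ('k, 'w) module \<Rightarrow> 'v \<Rightarrow> 'w \<Rightarrow> ('v \<times> 'w \<Rightarrow>\<^sub>0 'k) set" where
  "tens V W v w = tensor_class V W (Poly_Mapping.single (v, w) 1)"

abbreviation tens3 where
  "tens3 V W U v w u \<equiv> tens (V \<boxtimes> W) U (tens V W v w) u"

definition flip :: "('v \<times> 'w \<Rightarrow>\<^sub>0 'k::field) set \<Rightarrow> ('w \<times> 'v \<Rightarrow>\<^sub>0 'k) set" where
  "flip X = Poly_Mapping.map_key prod.swap ` X"

text \<open>
  Bilinear extension of \<open>g\<close> to two tensor-product elements \<open>X = \<Sum> x\<^sub>p p\<close> and \<open>Y = \<Sum> y\<^sub>q q\<close>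
  (\<open>p\<close>, \<open>q\<close> simple tensors, given as pairs), with values in \<open>Z\<close>.  The chosen representatives are
  immaterial whenever \<open>g\<close> is linear in each of its four arguments, which is the case in all uses.
\<close>

definition bilinear_ext ::
  "('k::field, 'z) module \<Rightarrow> ('v \<times> 'w \<Rightarrow> 'v' \<times> 'w' \<Rightarrow> 'z) \<Rightarrow>
   ('v \<times> 'w \<Rightarrow>\<^sub>0 'k) set \<Rightarrow> ('v' \<times> 'w' \<Rightarrow>\<^sub>0 'k) set \<Rightarrow> 'z" where
  "bilinear_ext Z g X Y =
     (let u = (SOME u. u \<in> X); v = (SOME v. v \<in> Y) in
      \<Oplus>\<^bsub>Z\<^esub>p\<in>Poly_Mapping.keys u. \<Oplus>\<^bsub>Z\<^esub>q\<in>Poly_Mapping.keys v.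
        (Poly_Mapping.lookup u p * Poly_Mapping.lookup v q) \<odot>\<^bsub>Z\<^esub> g p q)"


subsection \<open>The Novikov Yang-Baxter equation\<close>

definition NYBE_lhs ::
  "('k::field, 'a) module \<Rightarrow> ('a \<times> 'a \<Rightarrow>\<^sub>0 'k) set \<Rightarrow> (('a \<times> 'a \<Rightarrow>\<^sub>0 'k) set \<times> 'a \<Rightarrow>\<^sub>0 'k) set" where
  "NYBE_lhs A r = bilinear_ext (A \<boxtimes> A \<boxtimes> A)
     (\<lambda>(x, y) (x', y').
        tens3 A A A x x' (y \<star>\<^bsub>A\<^esub> y')
        \<oplus>\<^bsub>A \<boxtimes> A \<boxtimes> A\<^esub> tens3 A A A x (y \<star>\<^bsub>A\<^esub> x' \<oplus>\<^bsub>A\<^esub> x' \<star>\<^bsub>A\<^esub> y) y'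
        \<oplus>\<^bsub>A \<boxtimes> A \<boxtimes> A\<^esub> tens3 A A A (x \<star>\<^bsub>A\<^esub> x') y' y) r r"

definition skew_NYBE_solution :: "('k::field, 'a) module \<Rightarrow> ('a \<times> 'a \<Rightarrow>\<^sub>0 'k) set \<Rightarrow> bool" where
  "skew_NYBE_solution A r \<longleftrightarrow>
     r \<in> carrier (A \<boxtimes> A) \<and> flip r = \<ominus>\<^bsub>A \<boxtimes> A\<^esub> r \<and> NYBE_lhs A r = \<zero>\<^bsub>A \<boxtimes> A \<boxtimes> A\<^esub>"


subsection \<open>The induced Lie algebra\<close>

definition induced_lie ::
  "('k::field, 'a) module \<Rightarrow> ('k, 'b) module \<Rightarrow> ('k, ('a \<times> 'b \<Rightarrow>\<^sub>0 'k) set) module" where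
  "induced_lie A B = (A \<boxtimes> B)\<lparr>mult := bilinear_ext (A \<boxtimes> B)
     (\<lambda>(a\<^sub>1, b\<^sub>1) (a\<^sub>2, b\<^sub>2).
        tens A B (a\<^sub>1 \<star>\<^bsub>A\<^esub> a\<^sub>2) (b\<^sub>1 \<star>\<^bsub>B\<^esub> b\<^sub>2) \<ominus>\<^bsub>A \<boxtimes> B\<^esub> tens A B (a\<^sub>2 \<star>\<^bsub>A\<^esub> a\<^sub>1) (b\<^sub>2 \<star>\<^bsub>B\<^esub> b\<^sub>1))\<rparr>"

text \<open>\<open>L\<^sub>i = A \<otimes> B\<^sub>i\<close>, as a subspace of \<open>L = A \<otimes> B\<close>.\<close>

definition induced_grading ::
  "('k::field, 'a) module \<Rightarrow> ('k, 'b) module \<Rightarrow> (int \<Rightarrow> 'b set) \<Rightarrow> int \<Rightarrow> ('a \<times> 'b \<Rightarrow>\<^sub>0 'k) set set" where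
  "induced_grading A B G i = {tensor_class A B u | u. Poly_Mapping.keys u \<subseteq> carrier A \<times> G i}"


subsection \<open>Completed solutions of the classical Yang-Baxter equation\<close>

text \<open>
  Below, \<open>L\<close> is a Lie algebra (bracket \<open>x \<star>\<^bsub>L\<^esub> y\<close>) with grading \<open>D\<close>.  An element of a completed
  tensor product is the family of its homogeneous components.
\<close>

abbreviation homog :: "('k, 'l) module \<Rightarrow> (int \<Rightarrow> 'l set) \<Rightarrow> int \<Rightarrow> ('k, 'l) module" where
  "homog L D i \<equiv> L\<lparr>carrier := D i\<rparr>"

abbreviation homog2 ::
  "('k::field, 'l) module \<Rightarrow> (int \<Rightarrow> 'l set) \<Rightarrow> int \<Rightarrow> int \<Rightarrow> ('k, ('l \<times> 'l \<Rightarrow>\<^sub>0 'k) set) module" where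
  "homog2 L D i j \<equiv> homog L D i \<boxtimes> homog L D j"

abbreviation homog3 ::
  "('k::field, 'l) module \<Rightarrow> (int \<Rightarrow> 'l set) \<Rightarrow> int \<Rightarrow> int \<Rightarrow> int \<Rightarrow>
   ('k, (('l \<times> 'l \<Rightarrow>\<^sub>0 'k) set \<times> 'l \<Rightarrow>\<^sub>0 'k) set) module" where
  "homog3 L D i j k \<equiv> homog L D i \<boxtimes> homog L D j \<boxtimes> homog L D k"

definition completed_tensor ::
  "('k::field, 'l) module \<Rightarrow> (int \<Rightarrow> 'l set) \<Rightarrow> (int \<Rightarrow> int \<Rightarrow> ('l \<times> 'l \<Rightarrow>\<^sub>0 'k) set) set" where
  "completed_tensor L D = {r. \<forall>i j. r i j \<in> carrier (homog2 L D i j)}"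

definition completed_skew ::
  "('k::field, 'l) module \<Rightarrow> (int \<Rightarrow> 'l set) \<Rightarrow> (int \<Rightarrow> int \<Rightarrow> ('l \<times> 'l \<Rightarrow>\<^sub>0 'k) set) \<Rightarrow> bool" where
  "completed_skew L D r \<longleftrightarrow> (\<forall>i j. flip (r j i) = \<ominus>\<^bsub>homog2 L D i j\<^esub> r i j)"

text \<open>
  Components of \<open>[r\<^sub>1\<^sub>2, r\<^sub>1\<^sub>3]\<close>, \<open>[r\<^sub>1\<^sub>2, r\<^sub>2\<^sub>3]\<close>, \<open>[r\<^sub>1\<^sub>3, r\<^sub>2\<^sub>3]\<close>.  The component of degree \<open>n\<close> in the
  slot carrying the bracket collects all pairs of degrees \<open>i\<close>, \<open>n - i\<close>; only finitely many of them
  contribute when \<open>r\<close> is supported on an antidiagonal (\<open>antidiagonal\<close> below).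
\<close>

definition bracket_12_13 ::
  "('k::field, 'l) module \<Rightarrow> (int \<Rightarrow> 'l set) \<Rightarrow> (int \<Rightarrow> int \<Rightarrow> ('l \<times> 'l \<Rightarrow>\<^sub>0 'k) set) \<Rightarrow>
   int \<Rightarrow> int \<Rightarrow> int \<Rightarrow> (('l \<times> 'l \<Rightarrow>\<^sub>0 'k) set \<times> 'l \<Rightarrow>\<^sub>0 'k) set" where
  "bracket_12_13 L D r n j l =
     (\<Oplus>\<^bsub>homog3 L D n j l\<^esub>i\<in>{i. r i j \<noteq> \<zero>\<^bsub>homog2 L D i j\<^esub> \<and> r (n - i) l \<noteq> \<zero>\<^bsub>homog2 L D (n - i) l\<^esub>}.
        bilinear_ext (homog3 L D n j l)
          (\<lambda>(a, b) (a', b'). tens3 (homog L D n) (homog L D j) (homog L D l) (a \<star>\<^bsub>L\<^esub> a') b b')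
          (r i j) (r (n - i) l))"

definition bracket_12_23 ::
  "('k::field, 'l) module \<Rightarrow> (int \<Rightarrow> 'l set) \<Rightarrow> (int \<Rightarrow> int \<Rightarrow> ('l \<times> 'l \<Rightarrow>\<^sub>0 'k) set) \<Rightarrow>
   int \<Rightarrow> int \<Rightarrow> int \<Rightarrow> (('l \<times> 'l \<Rightarrow>\<^sub>0 'k) set \<times> 'l \<Rightarrow>\<^sub>0 'k) set" where
  "bracket_12_23 L D r i n l =
     (\<Oplus>\<^bsub>homog3 L D i n l\<^esub>j\<in>{j. r i j \<noteq> \<zero>\<^bsub>homog2 L D i j\<^esub> \<and> r (n - j) l \<noteq> \<zero>\<^bsub>homog2 L D (n - j) l\<^esub>}.
        bilinear_ext (homog3 L D i n l)
          (\<lambda>(a, b) (a', b'). tens3 (homog L D i) (homog L D n) (homog L D l) a (b \<star>\<^bsub>L\<^esub> a') b')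
          (r i j) (r (n - j) l))"

definition bracket_13_23 ::
  "('k::field, 'l) module \<Rightarrow> (int \<Rightarrow> 'l set) \<Rightarrow> (int \<Rightarrow> int \<Rightarrow> ('l \<times> 'l \<Rightarrow>\<^sub>0 'k) set) \<Rightarrow>
   int \<Rightarrow> int \<Rightarrow> int \<Rightarrow> (('l \<times> 'l \<Rightarrow>\<^sub>0 'k) set \<times> 'l \<Rightarrow>\<^sub>0 'k) set" where
  "bracket_13_23 L D r i k n =
     (\<Oplus>\<^bsub>homog3 L D i k n\<^esub>j\<in>{j. r i j \<noteq> \<zero>\<^bsub>homog2 L D i j\<^esub> \<and> r k (n - j) \<noteq> \<zero>\<^bsub>homog2 L D k (n - j)\<^esub>}.
        bilinear_ext (homog3 L D i k n)
          (\<lambda>(a, b) (a', b'). tens3 (homog L D i) (homog L D k) (homog L D n) a a' (b \<star>\<^bsub>L\<^esub> b'))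
          (r i j) (r k (n - j)))"

definition antidiagonal ::
  "('k::field, 'l) module \<Rightarrow> (int \<Rightarrow> 'l set) \<Rightarrow> (int \<Rightarrow> int \<Rightarrow> ('l \<times> 'l \<Rightarrow>\<^sub>0 'k) set) \<Rightarrow> bool" where
  "antidiagonal L D r \<longleftrightarrow> (\<exists>s. \<forall>i j. i + j + s \<noteq> 0 \<longrightarrow> r i j = \<zero>\<^bsub>homog2 L D i j\<^esub>)"

definition skew_completed_CYBE_solution ::
  "('k::field, 'l) module \<Rightarrow> (int \<Rightarrow> 'l set) \<Rightarrow> (int \<Rightarrow> int \<Rightarrow> ('l \<times> 'l \<Rightarrow>\<^sub>0 'k) set) \<Rightarrow> bool" where
  "skew_completed_CYBE_solution L D r \<longleftrightarrow>
     r \<in> completed_tensor L D \<and> antidiagonal L D r \<and> completed_skew L D r \<and>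
     (\<forall>i j k. bracket_12_13 L D r i j k \<oplus>\<^bsub>homog3 L D i j k\<^esub> bracket_12_23 L D r i j k
        \<oplus>\<^bsub>homog3 L D i j k\<^esub> bracket_13_23 L D r i j k = \<zero>\<^bsub>homog3 L D i j k\<^esub>)"


subsection \<open>The lift of a tensor to the induced Lie algebra\<close>

text \<open>
  The \<open>(i, j)\<close> component of \<open>\<Sum>\<^sub>p \<Sum>\<^sub>\<alpha> (x\<^sub>\<alpha> \<otimes> e\<^sub>p) \<otimes> (y\<^sub>\<alpha> \<otimes> f\<^sub>p)\<close> for homogeneous nonzero \<open>e\<^sub>p\<close>, \<open>f\<^sub>p\<close>:
  it collects the \<open>p\<close> with \<open>e\<^sub>p\<close> of degree \<open>i\<close> and \<open>f\<^sub>p\<close> of degree \<open>j\<close>.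
\<close>

definition lie_lift ::
  "('k::field, 'a) module \<Rightarrow> ('k, 'b) module \<Rightarrow> (int \<Rightarrow> 'b set) \<Rightarrow>
   'i set \<Rightarrow> ('i \<Rightarrow> 'a) \<Rightarrow> ('i \<Rightarrow> 'a) \<Rightarrow> 'p set \<Rightarrow> ('p \<Rightarrow> 'b) \<Rightarrow> ('p \<Rightarrow> 'b) \<Rightarrow>
   int \<Rightarrow> int \<Rightarrow> (('a \<times> 'b \<Rightarrow>\<^sub>0 'k) set \<times> ('a \<times> 'b \<Rightarrow>\<^sub>0 'k) set \<Rightarrow>\<^sub>0 'k) set" where
  "lie_lift A B G I x y P e f i j =
     (let L = induced_lie A B; D = induced_grading A B G in
      \<Oplus>\<^bsub>homog2 L D i j\<^esub>p\<in>{p \<in> P. e p \<in> G i \<and> f p \<in> G j}. \<Oplus>\<^bsub>homog2 L D i j\<^esub>\<alpha>\<in>I.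
        tens (homog L D i) (homog L D j) (tens A B (x \<alpha>) (e p)) (tens A B (y \<alpha>) (f p)))"


subsection \<open>Laurent polynomials\<close>

text \<open>\<open>t\<^sup>i \<diamondop> t\<^sup>j = i t\<^sup>i\<^sup>+\<^sup>j\<^sup>-\<^sup>1\<close>, \<open>B\<^sub>i = k t\<^sup>i\<^sup>+\<^sup>1\<close> and \<open>(t\<^sup>i, t\<^sup>j) = \<delta>\<^sub>i\<^sub>+\<^sub>j\<^sub>+\<^sub>1\<^sub>,\<^sub>0\<close>, where \<open>t\<^sup>i\<close> is \<open>laurent_t i\<close>.\<close>

abbreviation laurent_t :: "int \<Rightarrow> (int \<Rightarrow>\<^sub>0 'k::field)" where
  "laurent_t i \<equiv> Poly_Mapping.single i 1"

definition laurent :: "('k::field, int \<Rightarrow>\<^sub>0 'k) module" where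
  "laurent =
     \<lparr>carrier = UNIV,
      mult = (\<lambda>u v. \<Sum>i\<in>Poly_Mapping.keys u. \<Sum>j\<in>Poly_Mapping.keys v.
        Poly_Mapping.single (i + j - 1) (of_int i * Poly_Mapping.lookup u i * Poly_Mapping.lookup v j)),
      one = undefined,
      zero = 0,
      add = (+),
      smult = scal\<rparr>"

definition laurent_grading :: "int \<Rightarrow> (int \<Rightarrow>\<^sub>0 'k::field) set" where
  "laurent_grading i = range (\<lambda>s. scal s (laurent_t (i + 1)))"

definition laurent_form :: "(int \<Rightarrow>\<^sub>0 'k::field) \<Rightarrow> (int \<Rightarrow>\<^sub>0 'k) \<Rightarrow> 'k" where
  "laurent_form u v = (\<Sum>i\<in>Poly_Mapping.keys u. \<Sum>j\<in>Poly_Mapping.keys v.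
     Poly_Mapping.lookup u i * Poly_Mapping.lookup v j * (if i + j + 1 = 0 then 1 else 0))"

text \<open>
  The Laurent polynomials form a quadratic graded right Novikov algebra for \<^const>\<open>laurent_form\<close>,
  and \<open>t\<^sup>-\<^sup>i\<^sup>-\<^sup>1\<close> is dual to \<open>t\<^sup>i\<close>.  The proof uses \<open>u \<diamondop> v = t\<^sup>-\<^sup>1 \<theta>(u) v\<close> with the Euler
  derivation \<open>\<theta> = t d/dt\<close>.
\<close>

definition euler_op :: "(int \<Rightarrow>\<^sub>0 'k::field) \<Rightarrow> (int \<Rightarrow>\<^sub>0 'k)" where
  "euler_op u = Poly_Mapping.mapp (\<lambda>i s. of_int i * s) u"

lemma lookup_scal: "Poly_Mapping.lookup (scal s u) i = s * Poly_Mapping.lookup u i"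
  by (simp add: Poly_Mapping.map.rep_eq when_def)

lemma scal_eq_mult: "scal s u = Poly_Mapping.single 0 s * (u :: int \<Rightarrow>\<^sub>0 'k::field)"
  by (rule poly_mapping_eqI) (simp add: mult_map_scale_conv_mult[symmetric])

lemma lookup_euler_op: "Poly_Mapping.lookup (euler_op u) i = of_int i * Poly_Mapping.lookup u i"
  by (simp add: euler_op_def lookup_mapp when_def in_keys_iff)

lemma euler_op_add: "euler_op (u + v) = euler_op u + euler_op v"
  by (rule poly_mapping_eqI) (simp add: lookup_euler_op lookup_add algebra_simps)

lemma euler_op_single: "euler_op (Poly_Mapping.single i s) = Poly_Mapping.single i (of_int i * s)"
  by (rule poly_mapping_eqI) (simp add: lookup_euler_op lookup_single when_def)

lemma euler_op_0: "euler_op 0 = 0"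
  by (rule poly_mapping_eqI) (simp add: lookup_euler_op)

lemma euler_op_sum: "euler_op (sum g S) = (\<Sum>i\<in>S. euler_op (g i))"
  by (induction S rule: infinite_finite_induct) (auto simp: euler_op_0 euler_op_add)

lemma monom_sum: "(\<Sum>i\<in>Poly_Mapping.keys u. Poly_Mapping.single i (Poly_Mapping.lookup u i)) = u"
  by (rule poly_mapping_eqI) (auto simp: lookup_sum lookup_single when_def in_keys_iff sum.delta)

lemma euler_op_keys: "euler_op u = (\<Sum>i\<in>Poly_Mapping.keys u. Poly_Mapping.single i (of_int i * Poly_Mapping.lookup u i))"
  by (subst (1) monom_sum[of u, symmetric]) (simp only: euler_op_sum euler_op_single)

lemma monom_prod: "(\<Sum>i\<in>S. Poly_Mapping.single i (a i)) * (\<Sum>j\<in>T. Poly_Mapping.single j (b j :: 'k::field))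
  = (\<Sum>i\<in>S. \<Sum>j\<in>T. Poly_Mapping.single (i + j :: int) (a i * b j))"
  by (simp only: sum_product mult_single)

lemmas prod_keys = monom_prod[where S = "Poly_Mapping.keys u" and T = "Poly_Mapping.keys v"
   and a = "Poly_Mapping.lookup u" and b = "Poly_Mapping.lookup v" for u v, unfolded monom_sum]
lemmas prod_keys1 = monom_prod[where S = "Poly_Mapping.keys u" and T = "Poly_Mapping.keys v"
   and a = "\<lambda>i. of_int i * Poly_Mapping.lookup u i" and b = "Poly_Mapping.lookup v" for u v, 
   unfolded monom_sum, folded euler_op_keys]
lemmas prod_keys2 = monom_prod[where S = "Poly_Mapping.keys u" and T = "Poly_Mapping.keys v"
   and a = "Poly_Mapping.lookup u" and b = "\<lambda>i. of_int i * Poly_Mapping.lookup v i" for u v, 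
   unfolded monom_sum, folded euler_op_keys]

lemma euler_op_mult: "euler_op (u * v) = euler_op u * v + u * euler_op v"
  unfolding prod_keys[of u v] prod_keys1[of u v] prod_keys2[of u v] euler_op_sum euler_op_single
  by (simp add: sum.distrib[symmetric] single_add[symmetric] algebra_simps)

lemma laurent_mult: "u \<star>\<^bsub>laurent\<^esub> v = laurent_t (-1) * euler_op u * v"
  unfolding mult.assoc prod_keys1
  by (simp add: laurent_def sum_distrib_left mult_single algebra_simps)

lemma laurent_form_eq: "laurent_form u v = Poly_Mapping.lookup (u * v) (-1)"
  unfolding prod_keys laurent_form_def
  by (auto simp: lookup_sum lookup_single when_def intro!: sum.cong)

lemma laurent_sel: "carrier laurent = UNIV" "zero laurent = 0" "add laurent = (+)" "smult laurent = scal"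
  by (simp_all add: laurent_def)

lemma laurent_vs: "vectorspace class_ring (laurent :: ('k::field, int \<Rightarrow>\<^sub>0 'k) module)"
proof -
  have "abelian_group (laurent :: ('k::field, int \<Rightarrow>\<^sub>0 'k) module)"
    by (rule abelian_groupI) (auto simp: laurent_sel algebra_simps intro: exI[of _ "- x" for x] left_minus)
  moreover have f: "field (class_ring :: 'k ring)"
    by (rule class_field)
  moreover have "cring (class_ring :: 'k ring)"
    using f by (simp add: field_def domain_def)
  moreover have "module_axioms (class_ring :: 'k ring) laurent"
    by (rule module_axioms.intro)
      (auto simp: laurent_sel scal_eq_mult algebra_simps single_add
        mult_single[where k = 0 and l = 0, simplified, symmetric])
  ultimately show ?thesis
    by (auto simp: vectorspace_def intro: Module.module.intro)
qed

interpretation laurent: vectorspace class_ring "laurent :: ('k::field, int \<Rightarrow>\<^sub>0 'k) module"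
  by (rule laurent_vs)

lemma laurent_minus: "a \<ominus>\<^bsub>laurent\<^esub> b = a - b"
proof -
  have "\<ominus>\<^bsub>laurent\<^esub> b = - b"
    using laurent.minus_equality[of "- b" b] by (simp add: laurent_sel)
  then show ?thesis by (simp add: a_minus_def laurent_sel)
qed

lemma laurent_right_novikov: "right_novikov_algebra (laurent :: ('k::field, int \<Rightarrow>\<^sub>0 'k) module)"
proof
  fix a b c :: "int \<Rightarrow>\<^sub>0 'k" and s :: 'k
  have ths: "euler_op (Poly_Mapping.single 0 s * a) = Poly_Mapping.single 0 s * euler_op a" for s :: 'k and a
    by (simp add: euler_op_mult euler_op_single)
  have ths': "euler_op (a * Poly_Mapping.single 0 s) = euler_op a * Poly_Mapping.single 0 s" for s :: 'k and a
    by (simp add: euler_op_mult euler_op_single)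
  show "a \<star>\<^bsub>laurent\<^esub> b \<in> carrier laurent"
    by (simp add: laurent_sel)
  show "(a \<oplus>\<^bsub>laurent\<^esub> b) \<star>\<^bsub>laurent\<^esub> c = a \<star>\<^bsub>laurent\<^esub> c \<oplus>\<^bsub>laurent\<^esub> b \<star>\<^bsub>laurent\<^esub> c"
    "a \<star>\<^bsub>laurent\<^esub> (b \<oplus>\<^bsub>laurent\<^esub> c) = a \<star>\<^bsub>laurent\<^esub> b \<oplus>\<^bsub>laurent\<^esub> a \<star>\<^bsub>laurent\<^esub> c"
    "(s \<odot>\<^bsub>laurent\<^esub> a) \<star>\<^bsub>laurent\<^esub> b = s \<odot>\<^bsub>laurent\<^esub> (a \<star>\<^bsub>laurent\<^esub> b)"
    "a \<star>\<^bsub>laurent\<^esub> (s \<odot>\<^bsub>laurent\<^esub> b) = s \<odot>\<^bsub>laurent\<^esub> (a \<star>\<^bsub>laurent\<^esub> b)"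
    by (simp_all add: laurent_mult laurent_sel euler_op_add algebra_simps ths ths' scal_eq_mult)
  have thtm: "euler_op (laurent_t (-1)) = - (laurent_t (-1) :: int \<Rightarrow>\<^sub>0 'k)"
    by (simp add: euler_op_single single_uminus)
  show "(a \<star>\<^bsub>laurent\<^esub> b) \<star>\<^bsub>laurent\<^esub> c \<ominus>\<^bsub>laurent\<^esub> a \<star>\<^bsub>laurent\<^esub> (b \<star>\<^bsub>laurent\<^esub> c)
      = (a \<star>\<^bsub>laurent\<^esub> c) \<star>\<^bsub>laurent\<^esub> b \<ominus>\<^bsub>laurent\<^esub> a \<star>\<^bsub>laurent\<^esub> (c \<star>\<^bsub>laurent\<^esub> b)"
    "a \<star>\<^bsub>laurent\<^esub> (b \<star>\<^bsub>laurent\<^esub> c) = b \<star>\<^bsub>laurent\<^esub> (a \<star>\<^bsub>laurent\<^esub> c)"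
    by (simp_all add: laurent_mult laurent_minus euler_op_mult thtm algebra_simps)
qed

lemma laurent_grading_iff: "u \<in> laurent_grading i \<longleftrightarrow> (\<exists>s. u = Poly_Mapping.single (i + 1) s)"
  by (auto simp: laurent_grading_def scal_eq_mult mult_single)

lemma laurent_finsum: "finite S \<Longrightarrow> finsum laurent g S = sum g S"
  by (induction S rule: finite_induct) (auto simp: laurent_sel laurent.finsum_insert)

lemma laurent_graded: "graded_right_novikov_algebra (laurent :: ('k::field, int \<Rightarrow>\<^sub>0 'k) module) laurent_grading"
proof (intro graded_right_novikov_algebra.intro laurent_right_novikov graded_right_novikov_algebra_axioms.intro)
  let ?B = "laurent :: ('k::field, int \<Rightarrow>\<^sub>0 'k) module"
  fix i j :: int
  show sub: "subspace class_ring (laurent_grading i) ?B"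
  proof (intro subspace.intro laurent_vs submodule.intro)
    show "module class_ring ?B" by (rule laurent.module_axioms)
    fix v w :: "int \<Rightarrow>\<^sub>0 'k" assume "v \<in> laurent_grading i" "w \<in> laurent_grading i"
    then show "v \<oplus>\<^bsub>laurent\<^esub> w \<in> laurent_grading i"
      unfolding laurent_grading_iff laurent_sel using single_add by metis
  next
    show "\<zero>\<^bsub>laurent\<^esub> \<in> laurent_grading i"
      unfolding laurent_grading_iff laurent_sel using single_zero by metis
  qed (auto simp: laurent_sel laurent_grading_iff scal_eq_mult mult_single)
  interpret W: vectorspace class_ring "laurent\<lparr>carrier := laurent_grading i\<rparr> :: ('k, int \<Rightarrow>\<^sub>0 'k) module"
    using laurent.subspace_is_vs[OF sub] .
  show "vectorspace.fin_dim class_ring (laurent\<lparr>carrier := laurent_grading i\<rparr> :: ('k, int \<Rightarrow>\<^sub>0 'k) module)"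
    unfolding W.fin_dim_def
  proof (intro exI conjI)
    have t: "laurent_t (i+1) \<in> laurent_grading i" by (auto simp: laurent_grading_iff)
    show "{laurent_t (i+1)} \<subseteq> carrier (laurent\<lparr>carrier := laurent_grading i\<rparr>)" using t by simp
    have "u \<in> W.span {laurent_t (i+1)}" if u_in: "u \<in> laurent_grading i" for u :: "int \<Rightarrow>\<^sub>0 'k"
    proof -
      obtain s where u: "u = Poly_Mapping.single (i+1) s" using u_in by (auto simp: laurent_grading_iff)
      have "W.lincomb (\<lambda>_. s) {laurent_t (i+1)} = u"
        unfolding W.lincomb_def using t u u_in
        by (subst W.finsum_insert) (auto simp: laurent_sel scal_eq_mult mult_single laurent_grading_iff)
      then show ?thesis unfolding W.span_def by (auto intro!: exI[of _ "\<lambda>_. s"] exI[of _ "{laurent_t (i+1)}"])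
    qed
    then show "W.gen_set {laurent_t (i+1)}" using W.span_is_subset2[of "{laurent_t (i+1)}"] t by auto
  qed simp
  fix a b :: "int \<Rightarrow>\<^sub>0 'k" assume "a \<in> laurent_grading i" "b \<in> laurent_grading j"
  then obtain s s' where "a = Poly_Mapping.single (i+1) s" "b = Poly_Mapping.single (j+1) s'"
    by (auto simp: laurent_grading_iff)
  then show "a \<star>\<^bsub>?B\<^esub> b \<in> laurent_grading (i + j)"
    by (auto simp: laurent_grading_iff laurent_mult euler_op_single mult_single algebra_simps)
next
  fix b :: "int \<Rightarrow>\<^sub>0 'k"
  let ?P = "\<lambda>c. (\<forall>i. c i \<in> laurent_grading i) \<and> finite {i. c i \<noteq> \<zero>\<^bsub>laurent\<^esub>} \<and>
      b = (\<Oplus>\<^bsub>laurent\<^esub>i\<in>{i. c i \<noteq> \<zero>\<^bsub>laurent\<^esub>}. c i)"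
  define c where "c = (\<lambda>i. Poly_Mapping.single (i + 1) (Poly_Mapping.lookup b (i + 1)))"
  have z: "Poly_Mapping.single i s = 0 \<longleftrightarrow> s = 0" for i :: int and s :: 'k
    by (metis lookup_single_eq lookup_zero single_zero)
  have K: "{i. c i \<noteq> 0} = (\<lambda>i. i - 1) ` Poly_Mapping.keys b"
    by (auto simp: c_def z in_keys_iff image_iff intro!: bexI[of _ "x + 1" for x])
  have "b = sum c {i. c i \<noteq> 0}"
    unfolding K by (subst sum.reindex) (auto simp: c_def monom_sum inj_on_def)
  moreover have "finite {i. c i \<noteq> 0}" unfolding K by simp
  ultimately have 1: "?P c" by (auto simp: laurent_sel laurent_finsum laurent_grading_iff c_def)
  have 2: "c' = c" if P: "?P c'" for c'
  proof
    fix i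
    obtain s where s: "\<And>i. c' i = Poly_Mapping.single (i + 1) (s i)"
      using P unfolding laurent_grading_iff by metis
    have fin: "finite {i. c' i \<noteq> 0}" and b: "b = sum c' {i. c' i \<noteq> 0}"
      using P by (auto simp: laurent_sel laurent_finsum)
    have "Poly_Mapping.lookup b (i + 1) = (\<Sum>j\<in>{i. c' i \<noteq> 0}. if j = i then s i else 0)"
      unfolding b lookup_sum by (rule sum.cong) (auto simp: s lookup_single when_def)
    also have "\<dots> = s i" using fin by (auto simp: s z)
    finally show "c' i = c i" by (simp add: c_def s)
  qed
  show "\<exists>!c. ?P c" using 1 2 by blast
qed

lemma laurent_quadratic:
  "quadratic_graded_right_novikov_algebra (laurent :: ('k::field, int \<Rightarrow>\<^sub>0 'k) module) laurent_grading laurent_form"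
proof (intro quadratic_graded_right_novikov_algebra.intro laurent_graded
    quadratic_graded_right_novikov_algebra_axioms.intro)
  fix a b c :: "int \<Rightarrow>\<^sub>0 'k" and s :: 'k
  show "laurent_form (a \<oplus>\<^bsub>laurent\<^esub> b) c = laurent_form a c + laurent_form b c"
    by (simp add: laurent_form_eq laurent_sel algebra_simps lookup_add)
  show "laurent_form (s \<odot>\<^bsub>laurent\<^esub> a) b = s * laurent_form a b"
    by (simp add: laurent_form_eq laurent_sel scal_eq_mult mult.assoc flip: lookup_scal)
  show "laurent_form a b = laurent_form b a"
    by (simp add: laurent_form_eq mult.commute)
  show "a = \<zero>\<^bsub>laurent\<^esub>" if "\<And>b. b \<in> carrier laurent \<Longrightarrow> laurent_form a b = 0"
  proof (rule poly_mapping_eqI)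
    fix i
    have "0 = laurent_form a (laurent_t (- 1 - i))" using that by (simp add: laurent_sel)
    also have "\<dots> = (\<Sum>j\<in>Poly_Mapping.keys a. if j = i then Poly_Mapping.lookup a i else 0)"
      unfolding laurent_form_def by (rule sum.cong) (auto simp: lookup_single)
    also have "\<dots> = Poly_Mapping.lookup a i" by (simp add: sum.delta in_keys_iff)
    finally show "Poly_Mapping.lookup a i = Poly_Mapping.lookup \<zero>\<^bsub>laurent\<^esub> i" by (simp add: laurent_sel)
  qed
  have sh: "Poly_Mapping.lookup (laurent_t (-1) * u) (-1) = Poly_Mapping.lookup u 0" for u :: "int \<Rightarrow>\<^sub>0 'k"
    by (subst (1) monom_sum[of u, symmetric])
       (auto simp: sum_distrib_left mult_single lookup_sum lookup_single when_def in_keys_iff)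
  have "Poly_Mapping.lookup (euler_op (a * b * c)) 0 = 0" by (simp add: lookup_euler_op)
  then have "Poly_Mapping.lookup (euler_op a * b * c) 0 = - Poly_Mapping.lookup (a * (euler_op b * c + euler_op c * b)) 0"
    by (simp add: euler_op_mult algebra_simps lookup_add add_eq_0_iff)
  moreover have "a \<star>\<^bsub>laurent\<^esub> b * c = laurent_t (-1) * (euler_op a * b * c)"
    "a * (b \<star>\<^bsub>laurent\<^esub> c \<oplus>\<^bsub>laurent\<^esub> c \<star>\<^bsub>laurent\<^esub> b) = laurent_t (-1) * (a * (euler_op b * c + euler_op c * b))"
    by (simp_all add: laurent_mult laurent_sel algebra_simps)
  ultimately show "laurent_form (a \<star>\<^bsub>laurent\<^esub> b) c
      = - laurent_form a (b \<star>\<^bsub>laurent\<^esub> c \<oplus>\<^bsub>laurent\<^esub> c \<star>\<^bsub>laurent\<^esub> b)"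
    by (simp only: laurent_form_eq sh)
next
  show "\<exists>m. \<forall>i j. i + j + m \<noteq> 0 \<longrightarrow>
      (\<forall>a\<in>laurent_grading i. \<forall>b\<in>laurent_grading j. laurent_form a b = (0 :: 'k))"
    by (intro exI[of _ 3]) (auto simp: laurent_grading_iff laurent_form_eq mult_single lookup_single when_def)
qed

lemma laurent_dual:
  "laurent_form (laurent_t i) (laurent_t (- j - 1)) = (if i = j then 1 else 0 :: 'k::field)"
  by (simp add: laurent_form_eq mult_single lookup_single when_def)

end

theory Submission
  imports Defs
begin

text \<open>
  The proof turns both equations into identities between scalars.  An element of a tensor product
  \<open>V \<otimes> W\<close> vanishes as soon as all forms \<open>\<phi> \<otimes> \<psi>\<close> vanish on it, where \<open>\<phi>\<close> and \<open>\<psi>\<close> run through families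
  of linear forms that separate the points of \<open>V\<close> and of \<open>W\<close> (\<open>separating_tensor\<close>).  Since \<open>A\<close> is finite
  dimensional, its points are separated by all its linear forms; the points of \<open>B\<close> are separated by the
  forms \<open>(\<cdot>, b)\<close>, because the form on \<open>B\<close> is nondegenerate.  Hence the forms \<open>\<phi> \<otimes> (\<cdot>, b)\<close> separate the
  points of \<open>L\<close>; on \<open>L\<^sub>i\<close> it suffices to take \<open>b\<close> in degree \<open>- i - m\<close>, where \<open>m\<close> is the shift in the
  gradedness of the form.

  Apply three such forms, with \<open>\<phi>\<^sub>1, b\<^sub>1\<close>, \<open>\<phi>\<^sub>2, b\<^sub>2\<close>, \<open>\<phi>\<^sub>3, b\<^sub>3\<close>, to a component of the classical Yang--Baxter
  equation for the lift of \<open>r\<close>.  Duality, \<open>\<Sum>\<^sub>p (f\<^sub>p, b) e\<^sub>p = b\<close>, removes both sums over the bases, and what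
  remains is a combination of the numbers \<open>(b\<^sub>i \<diamondop> b\<^sub>j, b\<^sub>k)\<close> with coefficients built from \<open>r\<close> and the
  \<open>\<phi>\<^sub>i\<close>.  Invariance of the form says precisely that \<open>(b\<^sub>i \<diamondop> b\<^sub>j, b\<^sub>k)\<close>, for \<open>{i, j, k} = {1, 2, 3}\<close>, is
  symmetric in \<open>j\<close> and \<open>k\<close>, hence a number \<open>u\<^sub>i\<close>, and that \<open>u\<^sub>1 + u\<^sub>2 + u\<^sub>3 = 0\<close>.  After elimination
  of \<open>u\<^sub>3\<close> the coefficient of \<open>u\<^sub>1\<close> is the
  value of \<open>\<phi>\<^sub>1 \<otimes> \<phi>\<^sub>2 \<otimes> \<phi>\<^sub>3\<close> on the left-hand side of the Novikov Yang--Baxter equation, and, by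
  skewsymmetry of \<open>r\<close>, the coefficient of \<open>u\<^sub>2\<close> is minus the value of \<open>\<phi>\<^sub>2 \<otimes> \<phi>\<^sub>1 \<otimes> \<phi>\<^sub>3\<close> on it (\<open>cybe_form\<close>).
  So a skewsymmetric solution of the Novikov equation lifts to a solution of the classical one.  For
  Laurent polynomials the choice \<open>b\<^sub>1 = t\<close>, \<open>b\<^sub>2 = 1\<close>, \<open>b\<^sub>3 = t\<^sup>-\<^sup>1\<close> gives \<open>u\<^sub>1 = 1\<close> and \<open>u\<^sub>2 = 0\<close>, which
  recovers the Novikov equation from the classical one; skewsymmetry of \<open>r\<close> is recovered in the same way
  from a pair of Laurent monomials with \<open>(b, b') = 1\<close>.

  Bilinear extensions are computed from arbitrarily chosen representatives of cosets.  Linear forms of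
  their values do not depend on the choice, because multilinear functions vanish on the bilinearity
  relations (\<open>tensor_eval_class\<close>, \<open>pair_eval_bilinear_ext\<close>).
\<close>

section \<open>Linear forms on vector spaces\<close>

abbreviation vspace :: "('k::field, 'v) module \<Rightarrow> bool" where
  "vspace V \<equiv> vectorspace class_ring V"

definition linear_form :: "('k::field, 'v) module \<Rightarrow> ('v \<Rightarrow> 'k) \<Rightarrow> bool" where
  "linear_form V \<phi> \<longleftrightarrow>
     (\<forall>v\<in>carrier V. \<forall>w\<in>carrier V. \<phi> (v \<oplus>\<^bsub>V\<^esub> w) = \<phi> v + \<phi> w) \<and>
     (\<forall>s. \<forall>v\<in>carrier V. \<phi> (s \<odot>\<^bsub>V\<^esub> v) = s * \<phi> v)"

lemma linear_formI:
  assumes "\<And>v w. \<lbrakk>v \<in> carrier V; w \<in> carrier V\<rbrakk> \<Longrightarrow> \<phi> (v \<oplus>\<^bsub>V\<^esub> w) = \<phi> v + \<phi> w"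
    and "\<And>s v. v \<in> carrier V \<Longrightarrow> \<phi> (s \<odot>\<^bsub>V\<^esub> v) = s * \<phi> v"
  shows "linear_form V \<phi>"
  using assms by (auto simp: linear_form_def)

lemma linear_form_add:
  "\<lbrakk>linear_form V \<phi>; v \<in> carrier V; w \<in> carrier V\<rbrakk> \<Longrightarrow> \<phi> (v \<oplus>\<^bsub>V\<^esub> w) = \<phi> v + \<phi> w"
  by (auto simp: linear_form_def)

lemma linear_form_smult:
  "\<lbrakk>linear_form V \<phi>; v \<in> carrier V\<rbrakk> \<Longrightarrow> \<phi> (s \<odot>\<^bsub>V\<^esub> v) = s * \<phi> v"
  by (auto simp: linear_form_def)

lemma linear_form_subset:
  "\<lbrakk>linear_form V \<phi>; S \<subseteq> carrier V\<rbrakk> \<Longrightarrow> linear_form (V\<lparr>carrier := S\<rparr>) \<phi>"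
  by (simp add: linear_form_def subset_iff)

lemma linear_form_scale: "linear_form V \<phi> \<Longrightarrow> linear_form V (\<lambda>v. c * \<phi> v)"
  by (auto simp: linear_form_def algebra_simps)

lemma linear_form_scale_right: "linear_form V \<phi> \<Longrightarrow> linear_form V (\<lambda>v. \<phi> v * c)"
  by (auto simp: linear_form_def algebra_simps)

lemma linear_form_plus:
  "\<lbrakk>linear_form V \<phi>; linear_form V \<psi>\<rbrakk> \<Longrightarrow> linear_form V (\<lambda>v. \<phi> v + \<psi> v)"
  by (auto simp: linear_form_def algebra_simps)

lemma linear_form_minus:
  "\<lbrakk>linear_form V \<phi>; linear_form V \<psi>\<rbrakk> \<Longrightarrow> linear_form V (\<lambda>v. \<phi> v - \<psi> v)"
  by (auto simp: linear_form_def algebra_simps)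

lemma linear_form_zero_fun: "linear_form V (\<lambda>v. 0)"
  by (auto simp: linear_form_def)

lemma linear_form_sum:
  "(\<And>i. i \<in> S \<Longrightarrow> linear_form V (\<phi> i)) \<Longrightarrow> linear_form V (\<lambda>v. \<Sum>i\<in>S. \<phi> i v)"
  by (induction S rule: infinite_finite_induct)
    (auto intro: linear_form_plus linear_form_zero_fun)

context
  fixes V :: "('k::field, 'v) module"
  assumes V: "vspace V"
begin

interpretation V: vectorspace "class_ring :: 'k ring" V by (rule V)

lemma vspace_closed:
  shows vspace_add_closed: "\<lbrakk>v \<in> carrier V; w \<in> carrier V\<rbrakk> \<Longrightarrow> v \<oplus>\<^bsub>V\<^esub> w \<in> carrier V"
    and vspace_smult_closed: "v \<in> carrier V \<Longrightarrow> s \<odot>\<^bsub>V\<^esub> v \<in> carrier V"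
    and vspace_minus_closed: "\<lbrakk>v \<in> carrier V; w \<in> carrier V\<rbrakk> \<Longrightarrow> v \<ominus>\<^bsub>V\<^esub> w \<in> carrier V"
    and vspace_uminus_closed: "v \<in> carrier V \<Longrightarrow> \<ominus>\<^bsub>V\<^esub> v \<in> carrier V"
    and vspace_zero_closed: "\<zero>\<^bsub>V\<^esub> \<in> carrier V"
    and vspace_finsum_closed: "g \<in> S \<rightarrow> carrier V \<Longrightarrow> finsum V g S \<in> carrier V"
  by (auto intro: V.finsum_closed)

lemma vspace_smult_zero: "v \<in> carrier V \<Longrightarrow> 0 \<odot>\<^bsub>V\<^esub> v = \<zero>\<^bsub>V\<^esub>"
  using V.smult_l_null[of v] by simp

lemma vspace_uminus: "v \<in> carrier V \<Longrightarrow> \<ominus>\<^bsub>V\<^esub> v = (-1) \<odot>\<^bsub>V\<^esub> v"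
proof -
  assume v: "v \<in> carrier V"
  have "(-1) \<odot>\<^bsub>V\<^esub> v \<oplus>\<^bsub>V\<^esub> v = (-1) \<odot>\<^bsub>V\<^esub> v \<oplus>\<^bsub>V\<^esub> 1 \<odot>\<^bsub>V\<^esub> v"
    using v V.smult_one[of v] by simp
  also have "\<dots> = 0 \<odot>\<^bsub>V\<^esub> v"
    using v V.smult_l_distr[of "-1" 1 v] by simp
  finally show ?thesis
    using v vspace_smult_zero V.minus_equality[of "(-1) \<odot>\<^bsub>V\<^esub> v" v] vspace_smult_closed by simp
qed

lemma linear_form_zero: "linear_form V \<phi> \<Longrightarrow> \<phi> \<zero>\<^bsub>V\<^esub> = 0"
  using linear_form_smult[of V \<phi> "\<zero>\<^bsub>V\<^esub>" 0] vspace_smult_zero[of "\<zero>\<^bsub>V\<^esub>"] by simp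

lemma linear_form_uminus:
  "\<lbrakk>linear_form V \<phi>; v \<in> carrier V\<rbrakk> \<Longrightarrow> \<phi> (\<ominus>\<^bsub>V\<^esub> v) = - \<phi> v"
  by (simp add: vspace_uminus linear_form_smult)

lemma linear_form_diff:
  "\<lbrakk>linear_form V \<phi>; v \<in> carrier V; w \<in> carrier V\<rbrakk> \<Longrightarrow> \<phi> (v \<ominus>\<^bsub>V\<^esub> w) = \<phi> v - \<phi> w"
  by (simp add: a_minus_def linear_form_add linear_form_uminus)

lemma linear_form_finsum:
  "\<lbrakk>linear_form V \<phi>; g \<in> S \<rightarrow> carrier V\<rbrakk> \<Longrightarrow> \<phi> (finsum V g S) = (\<Sum>i\<in>S. \<phi> (g i))"
proof (induction S rule: infinite_finite_induct)
  case (insert i S)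
  then show ?case
    by (subst V.finsum_insert) (auto simp: linear_form_add Pi_def intro!: linear_form_add)
qed (auto simp: linear_form_zero V.finsum_infinite)

end

lemma linear_form_cong:
  assumes V: "vspace V" and \<phi>: "linear_form V \<phi>" and eq: "\<And>v. v \<in> carrier V \<Longrightarrow> \<psi> v = \<phi> v"
  shows "linear_form V \<psi>"
  using \<phi> by (intro linear_formI)
    (simp_all add: eq vspace_add_closed[OF V] vspace_smult_closed[OF V] linear_form_add linear_form_smult)

lemma vspace_finsum_subspace:
  fixes V :: "('k::field, 'v) module"
  assumes V: "vspace V" and S: "vspace (V\<lparr>carrier := S\<rparr>)" "S \<subseteq> carrier V"
    and g: "g \<in> J \<rightarrow> S"
  shows "finsum V g J \<in> S"
  using g
proof (induction J rule: infinite_finite_induct)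
  interpret V: vectorspace "class_ring :: 'k ring" V by (rule V)
  note cl = vspace_add_closed[OF S(1)] vspace_zero_closed[OF S(1)]
  {
    case (infinite J)
    then show ?case using cl(2) by (simp add: V.finsum_infinite)
  next
    case empty
    then show ?case using cl(2) by simp
  next
    case (insert j J)
    then have "finsum V g (insert j J) = g j \<oplus>\<^bsub>V\<^esub> finsum V g J"
      using S(2) by (intro V.finsum_insert) auto
    then show ?case using insert cl(1)[of "g j" "finsum V g J"] by simp
  }
qed

lemma vspace_diff_subspace:
  assumes V: "vspace V" and S: "vspace (V\<lparr>carrier := S\<rparr>)" "S \<subseteq> carrier V"
    and vw: "v \<in> S" "w \<in> S"
  shows "v \<ominus>\<^bsub>V\<^esub> w \<in> S"
proof -
  have "v \<ominus>\<^bsub>V\<^esub> w = v \<oplus>\<^bsub>V\<^esub> (-1) \<odot>\<^bsub>V\<^esub> w"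
    using vspace_uminus[OF V, of w] vw S(2) by (auto simp: a_minus_def)
  then show ?thesis
    using vspace_add_closed[OF S(1), of v "(-1) \<odot>\<^bsub>V\<^esub> w"] vspace_smult_closed[OF S(1), of w "-1"] vw by simp
qed

section \<open>Tensor products and bilinear forms\<close>

definition bilinear_form ::
  "('k::field, 'v) module \<Rightarrow> ('k, 'w) module \<Rightarrow> ('v \<times> 'w \<Rightarrow> 'k) \<Rightarrow> bool" where
  "bilinear_form V W h \<longleftrightarrow>
     (\<forall>w\<in>carrier W. linear_form V (\<lambda>v. h (v, w))) \<and>
     (\<forall>v\<in>carrier V. linear_form W (\<lambda>w. h (v, w)))"

definition free_eval :: "('p \<Rightarrow> 'k::field) \<Rightarrow> ('p \<Rightarrow>\<^sub>0 'k) \<Rightarrow> 'k" where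
  "free_eval h u = (\<Sum>p\<in>Poly_Mapping.keys u. Poly_Mapping.lookup u p * h p)"

text \<open>
  The value at a coset of the linear extension of \<open>h\<close>.  As for bilinear extensions, the representative
  is chosen arbitrarily; it is immaterial if \<open>h\<close> is bilinear (\<open>tensor_eval_class\<close> below).
\<close>

definition tensor_eval :: "('v \<times> 'w \<Rightarrow> 'k::field) \<Rightarrow> ('v \<times> 'w \<Rightarrow>\<^sub>0 'k) set \<Rightarrow> 'k" where
  "tensor_eval h X = free_eval h (SOME u. u \<in> X)"

lemma free_eval_superset:
  assumes "finite S" "Poly_Mapping.keys u \<subseteq> S"
  shows "free_eval h u = (\<Sum>p\<in>S. Poly_Mapping.lookup u p * h p)"
  unfolding free_eval_def using assms by (intro sum.mono_neutral_left) (auto simp: in_keys_iff)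

lemma free_eval_add: "free_eval h (u + v) = free_eval h u + free_eval h v"
proof -
  let ?S = "Poly_Mapping.keys u \<union> Poly_Mapping.keys v"
  have "Poly_Mapping.keys (u + v) \<subseteq> ?S" by (rule Poly_Mapping.keys_add)
  then show ?thesis
    using free_eval_superset[of ?S u h] free_eval_superset[of ?S v h] free_eval_superset[of ?S "u + v" h]
    by (simp add: lookup_add algebra_simps sum.distrib)
qed

lemma keys_scal: "Poly_Mapping.keys (scal s u) \<subseteq> Poly_Mapping.keys u"
  by (auto simp: in_keys_iff lookup_scal)

lemma free_eval_scal: "free_eval h (scal s u) = s * free_eval h u"
  using free_eval_superset[of "Poly_Mapping.keys u" "scal s u" h] keys_scal[of s u]
  by (simp add: free_eval_def lookup_scal sum_distrib_left algebra_simps)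

lemma free_eval_single: "free_eval h (Poly_Mapping.single p s) = s * h p"
  using free_eval_superset[of "{p}" "Poly_Mapping.single p s" h] by (simp add: lookup_single)

lemma free_eval_0: "free_eval h 0 = 0"
  by (simp add: free_eval_def)

lemma free_eval_diff: "free_eval h (u - v) = free_eval h u - free_eval h v"
  using free_eval_add[of h "u - v" v] by simp

lemma free_eval_tensor_rel:
  assumes h: "bilinear_form V W h" and u: "u \<in> tensor_rel V W"
  shows "free_eval h u = 0"
  using u
  by induction
    (use h in \<open>auto simp: free_eval_0 free_eval_add free_eval_diff free_eval_scal free_eval_single
      bilinear_form_def linear_form_def\<close>)

lemma scal_add: "scal s (u + v) = scal s u + scal s v"
  by (rule poly_mapping_eqI) (simp add: lookup_scal lookup_add algebra_simps)

lemma scal_add_left: "scal (s + t) u = scal s u + scal t u"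
  by (rule poly_mapping_eqI) (simp add: lookup_scal lookup_add algebra_simps)

lemma scal_scal: "scal s (scal t u) = scal (s * t) u"
  by (rule poly_mapping_eqI) (simp add: lookup_scal)

lemma scal_one: "scal 1 u = u"
  by (rule poly_mapping_eqI) (simp add: lookup_scal)

lemma scal_minus_one: "scal (-1) u = - u"
  by (rule poly_mapping_eqI) (simp add: lookup_scal)

lemma tensor_rel_uminus: "u \<in> tensor_rel V W \<Longrightarrow> - u \<in> tensor_rel V W"
  using tensor_rel.scal[of u V W "-1"] by (simp add: scal_minus_one)

lemma tensor_rel_diff:
  "\<lbrakk>u \<in> tensor_rel V W; v \<in> tensor_rel V W\<rbrakk> \<Longrightarrow> u - v \<in> tensor_rel V W"
  using tensor_rel.add[of u V W "- v"] by (simp add: tensor_rel_uminus)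

lemma tensor_rel_sum:
  "(\<And>i. i \<in> S \<Longrightarrow> g i \<in> tensor_rel V W) \<Longrightarrow> sum g S \<in> tensor_rel V W"
  by (induction S rule: infinite_finite_induct) (auto intro: tensor_rel.zero tensor_rel.add)

lemma mem_tensor_class: "v \<in> tensor_class V W u \<longleftrightarrow> v - u \<in> tensor_rel V W"
  by (auto simp: tensor_class_def intro: exI[of _ "v - u"])

lemma tensor_class_eq: "tensor_class V W u = tensor_class V W v \<longleftrightarrow> u - v \<in> tensor_rel V W"
proof
  assume "tensor_class V W u = tensor_class V W v"
  moreover have "u \<in> tensor_class V W u" by (simp add: mem_tensor_class tensor_rel.zero)
  ultimately show "u - v \<in> tensor_rel V W" by (simp add: mem_tensor_class)
next
  assume uv: "u - v \<in> tensor_rel V W"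
  have "w - u \<in> tensor_rel V W \<longleftrightarrow> w - v \<in> tensor_rel V W" for w
    using uv tensor_rel.add[of "w - u" V W "u - v"] tensor_rel_diff[of "w - v" V W "u - v"] by auto
  then show "tensor_class V W u = tensor_class V W v" by (auto simp: mem_tensor_class)
qed

lemma tensor_space_sel:
  "carrier (V \<boxtimes> W) = {tensor_class V W u | u. Poly_Mapping.keys u \<subseteq> carrier V \<times> carrier W}"
  "\<zero>\<^bsub>V \<boxtimes> W\<^esub> = tensor_class V W 0"
  by (simp_all add: tensor_space_def)

lemma tensor_class_add:
  "tensor_class V W u \<oplus>\<^bsub>V \<boxtimes> W\<^esub> tensor_class V W v = tensor_class V W (u + v)"
proof -
  have "\<exists>a b. w = a + b \<and> a - u \<in> tensor_rel V W \<and> b - v \<in> tensor_rel V W"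
    if "w - (u + v) \<in> tensor_rel V W" for w
    using that by (intro exI[of _ "w - v"] exI[of _ v]) (simp add: tensor_rel.zero algebra_simps)
  moreover have "a + b - (u + v) \<in> tensor_rel V W"
    if "a - u \<in> tensor_rel V W" "b - v \<in> tensor_rel V W" for a b
    using tensor_rel.add[OF that] by (simp add: algebra_simps)
  ultimately show ?thesis
    by (auto simp: tensor_space_def mem_tensor_class set_eq_iff)
qed

lemma tensor_class_smult:
  "s \<odot>\<^bsub>V \<boxtimes> W\<^esub> tensor_class V W u = tensor_class V W (scal s u)"
proof -
  have "\<exists>x n. w = scal s x + n \<and> x - u \<in> tensor_rel V W \<and> n \<in> tensor_rel V W"
    if "w - scal s u \<in> tensor_rel V W" for w
    using that by (intro exI[of _ u] exI[of _ "w - scal s u"]) (simp add: tensor_rel.zero)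
  moreover have "scal s x + n - scal s u \<in> tensor_rel V W"
    if "x - u \<in> tensor_rel V W" "n \<in> tensor_rel V W" for x n
  proof -
    have "scal s x = scal s (x - u) + scal s u"
      using scal_add[of s "x - u" u] by simp
    then have "scal s (x - u) + n = scal s x + n - scal s u" by simp
    then show ?thesis using tensor_rel.add[OF tensor_rel.scal[OF that(1), of s] that(2)] by (simp only:)
  qed
  ultimately show ?thesis
    by (auto simp: tensor_space_def mem_tensor_class set_eq_iff)
qed

text \<open>
  Stated for an arbitrary set \<open>K\<close> of simple tensors and any module with the operations of \<open>V \<boxtimes> W\<close>, so that
  it covers the tensor product, the induced Lie algebra and each of its homogeneous components.
\<close>

lemma vspace_tensor_classes:
  fixes V :: "('k::field, 'v) module" and W :: "('k, 'w) module" and M :: "('k, ('v \<times> 'w \<Rightarrow>\<^sub>0 'k) set) module"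
  assumes c: "carrier M = {tensor_class V W u | u. Poly_Mapping.keys u \<subseteq> K}"
    and s: "add M = add (V \<boxtimes> W)" "zero M = zero (V \<boxtimes> W)" "smult M = smult (V \<boxtimes> W)"
  shows "vspace M"
proof -
  have k: "Poly_Mapping.keys (u + v) \<subseteq> K" if "Poly_Mapping.keys u \<subseteq> K" "Poly_Mapping.keys v \<subseteq> K"
    for u v :: "'v \<times> 'w \<Rightarrow>\<^sub>0 'k"
    using that Poly_Mapping.keys_add[of u v] by blast
  have k': "Poly_Mapping.keys (scal s u) \<subseteq> K" if "Poly_Mapping.keys u \<subseteq> K" for s and u :: "'v \<times> 'w \<Rightarrow>\<^sub>0 'k"
    using keys_scal[of s u] that by (rule order.trans)
  have mem: "tensor_class V W u \<in> carrier M" if "Poly_Mapping.keys u \<subseteq> K" for u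
    using that unfolding c by blast
  have add: "X \<oplus>\<^bsub>M\<^esub> Y \<in> carrier M" if XY: "X \<in> carrier M" "Y \<in> carrier M" for X Y
  proof -
    obtain u v where "X = tensor_class V W u" "Poly_Mapping.keys u \<subseteq> K"
      "Y = tensor_class V W v" "Poly_Mapping.keys v \<subseteq> K"
      using XY by (auto simp: c)
    then show ?thesis using mem[OF k, of u v] by (simp add: s tensor_class_add)
  qed
  have smult: "a \<odot>\<^bsub>M\<^esub> X \<in> carrier M" if X: "X \<in> carrier M" for a X
  proof -
    obtain u where "X = tensor_class V W u" "Poly_Mapping.keys u \<subseteq> K"
      using X by (auto simp: c)
    then show ?thesis using mem[OF k', of u a] by (simp add: s tensor_class_smult)
  qed
  have "abelian_group M"
  proof (rule abelian_groupI)
    show "\<zero>\<^bsub>M\<^esub> \<in> carrier M" using mem[of 0] by (simp add: s tensor_space_sel)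
    fix X assume "X \<in> carrier M"
    then obtain u where u: "X = tensor_class V W u" "Poly_Mapping.keys u \<subseteq> K" by (auto simp: c)
    have "tensor_class V W (- u) \<oplus>\<^bsub>M\<^esub> X = \<zero>\<^bsub>M\<^esub>"
      by (simp add: u s tensor_class_add tensor_space_sel)
    moreover have "tensor_class V W (- u) \<in> carrier M"
      using mem[OF k'[OF u(2), of "-1"]] unfolding scal_minus_one .
    ultimately show "\<exists>Y\<in>carrier M. Y \<oplus>\<^bsub>M\<^esub> X = \<zero>\<^bsub>M\<^esub>" by blast
  qed (use add in \<open>auto simp: c s tensor_class_add tensor_space_sel algebra_simps\<close>)
  moreover have f: "field (class_ring :: 'k ring)"
    by (rule class_field)
  moreover have "cring (class_ring :: 'k ring)"
    using f by (simp add: field_def domain_def)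
  moreover have "module_axioms (class_ring :: 'k ring) M"
    by (rule module_axioms.intro)
      (use smult in \<open>auto simp: c s tensor_class_add tensor_class_smult scal_add scal_add_left scal_scal scal_one\<close>)
  ultimately show ?thesis
    by (auto simp: vectorspace_def intro: Module.module.intro)
qed

lemma vspace_tensor: "vspace (V \<boxtimes> W)"
  by (rule vspace_tensor_classes[OF tensor_space_sel(1)]) simp_all

lemma tens_closed: "\<lbrakk>v \<in> carrier V; w \<in> carrier W\<rbrakk> \<Longrightarrow> tens V W v w \<in> carrier (V \<boxtimes> W)"
  by (auto simp: tens_def tensor_space_sel intro!: exI[of _ "Poly_Mapping.single (v, w) 1"])

lemma tensor_eval_class:
  assumes h: "bilinear_form V W h" and X: "X = tensor_class V W u"
  shows "tensor_eval h X = free_eval h u"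
proof -
  have "u \<in> X" by (simp add: X mem_tensor_class tensor_rel.zero)
  then have "(SOME u. u \<in> X) \<in> X" by (rule someI)
  then have "free_eval h ((SOME u. u \<in> X) - u) = 0"
    by (intro free_eval_tensor_rel[OF h]) (simp add: X mem_tensor_class)
  then show ?thesis by (simp add: tensor_eval_def free_eval_diff)
qed

lemma tensor_eval_tens: "bilinear_form V W h \<Longrightarrow> tensor_eval h (tens V W v w) = h (v, w)"
  by (simp add: tensor_eval_class[where u = "Poly_Mapping.single (v, w) 1"] tens_def free_eval_single)

lemma linear_form_tensor_eval: "bilinear_form V W h \<Longrightarrow> linear_form (V \<boxtimes> W) (tensor_eval h)"
  by (rule linear_formI)
    (auto simp: tensor_space_sel tensor_class_add tensor_class_smult tensor_eval_class
      free_eval_add free_eval_scal)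

text \<open>
  The bilinearity relations only involve vectors of \<open>V\<close> and \<open>W\<close>, so every representative of an element of
  the tensor product, in particular an arbitrarily chosen one, is supported on \<open>V \<times> W\<close>.
\<close>

lemma tensor_rel_keys:
  assumes "vspace V" "vspace W" "u \<in> tensor_rel V W"
  shows "Poly_Mapping.keys u \<subseteq> carrier V \<times> carrier W"
  using assms(3)
proof induction
  case (add u u')
  then show ?case using Poly_Mapping.keys_add[of u u'] by blast
next
  case (scal u s)
  then show ?case using keys_scal[of s u] by blast
qed (use assms(1,2) in \<open>auto dest!: subsetD[OF keys_diff]
   simp: vspace_add_closed vspace_smult_closed split: if_splits\<close>)

lemma tensor_representative:
  assumes "vspace V" "vspace W" "X \<in> carrier (V \<boxtimes> W)"
  shows "X = tensor_class V W (SOME u. u \<in> X)"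
    and "Poly_Mapping.keys (SOME u. u \<in> X) \<subseteq> carrier V \<times> carrier W"
proof -
  obtain u where u: "X = tensor_class V W u" "Poly_Mapping.keys u \<subseteq> carrier V \<times> carrier W"
    using assms by (auto simp: tensor_space_sel)
  have "u \<in> X" by (simp add: u mem_tensor_class tensor_rel.zero)
  then have "(SOME u. u \<in> X) \<in> X" by (rule someI)
  then have rel: "(SOME u. u \<in> X) - u \<in> tensor_rel V W" by (simp add: u mem_tensor_class)
  then show "X = tensor_class V W (SOME u. u \<in> X)"
    using u tensor_class_eq by metis
  have "Poly_Mapping.keys (((SOME u. u \<in> X) - u) + u) \<subseteq> carrier V \<times> carrier W"
    by (rule order.trans[OF Poly_Mapping.keys_add]) (use tensor_rel_keys[OF assms(1,2) rel] u(2) in simp)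
  then show "Poly_Mapping.keys (SOME u. u \<in> X) \<subseteq> carrier V \<times> carrier W" by simp
qed

lemma linear_form_tensor_eval_param:
  assumes "vspace V" "vspace W" "X \<in> carrier (V \<boxtimes> W)"
    and "\<And>v w. \<lbrakk>v \<in> carrier V; w \<in> carrier W\<rbrakk> \<Longrightarrow> linear_form Z (\<lambda>z. h z (v, w))"
  shows "linear_form Z (\<lambda>z. tensor_eval (h z) X)"
  unfolding tensor_eval_def free_eval_def
  using tensor_representative(2)[OF assms(1-3)]
  by (intro linear_form_sum linear_form_scale) (auto intro!: assms(4))

lemma bilinear_ext_closed:
  assumes "vspace V" "vspace W" "vspace V'" "vspace W'" "vspace Z"
    and "X \<in> carrier (V \<boxtimes> W)" "Y \<in> carrier (V' \<boxtimes> W')"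
    and "\<And>v w v' w'. \<lbrakk>v \<in> carrier V; w \<in> carrier W; v' \<in> carrier V'; w' \<in> carrier W'\<rbrakk> \<Longrightarrow>
      g (v, w) (v', w') \<in> carrier Z"
  shows bilinear_ext_in: "bilinear_ext Z g X Y \<in> carrier Z"
    and linear_form_bilinear_ext: "linear_form Z F \<Longrightarrow>
      F (bilinear_ext Z g X Y) = tensor_eval (\<lambda>p. tensor_eval (\<lambda>q. F (g p q)) Y) X"
proof -
  note r = tensor_representative(2)[OF assms(1,2,6)] tensor_representative(2)[OF assms(3,4,7)]
  show "bilinear_ext Z g X Y \<in> carrier Z"
    unfolding bilinear_ext_def Let_def using r
    by (intro vspace_finsum_closed[OF assms(5)] funcsetI vspace_smult_closed[OF assms(5)])
      (auto intro!: assms(8))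
  assume F: "linear_form Z F"
  have "g p q \<in> carrier Z" if "p \<in> Poly_Mapping.keys (SOME u. u \<in> X)" "q \<in> Poly_Mapping.keys (SOME u. u \<in> Y)"
    for p q
    using that r by (cases p; cases q) (auto intro!: assms(8))
  then show "F (bilinear_ext Z g X Y) = tensor_eval (\<lambda>p. tensor_eval (\<lambda>q. F (g p q)) Y) X"
    unfolding bilinear_ext_def Let_def tensor_eval_def free_eval_def
    by (simp add: linear_form_finsum[OF assms(5) F] vspace_finsum_closed[OF assms(5)]
      vspace_smult_closed[OF assms(5)] linear_form_smult[OF F] Pi_def sum_distrib_left mult.assoc)
qed

text \<open>
  What a linear form makes of a bilinear extension: the extension of \<open>H\<close>, linear in each of four
  arguments, to a pair of tensors.
\<close>

definition pair_eval ::
  "('v \<times> 'w \<Rightarrow> 'v' \<times> 'w' \<Rightarrow> 'k::field) \<Rightarrow> ('v \<times> 'w \<Rightarrow>\<^sub>0 'k) set \<Rightarrow> ('v' \<times> 'w' \<Rightarrow>\<^sub>0 'k) set \<Rightarrow> 'k" where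
  "pair_eval H X Y = tensor_eval (\<lambda>p. tensor_eval (H p) Y) X"

definition quadrilinear ::
  "('k::field, 'v) module \<Rightarrow> ('k, 'w) module \<Rightarrow> ('k, 'v') module \<Rightarrow> ('k, 'w') module \<Rightarrow>
   ('v \<times> 'w \<Rightarrow> 'v' \<times> 'w' \<Rightarrow> 'k) \<Rightarrow> bool" where
  "quadrilinear V W V' W' H \<longleftrightarrow>
     (\<forall>p\<in>carrier V \<times> carrier W. bilinear_form V' W' (H p)) \<and>
     (\<forall>q\<in>carrier V' \<times> carrier W'. bilinear_form V W (\<lambda>p. H p q))"

lemma pair_eval_bilinear_ext:
  assumes vs: "vspace V" "vspace W" "vspace V'" "vspace W'" "vspace Z"
    and X: "X \<in> carrier (V \<boxtimes> W)" and Y: "Y \<in> carrier (V' \<boxtimes> W')"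
    and g: "\<And>v w v' w'. \<lbrakk>v \<in> carrier V; w \<in> carrier W; v' \<in> carrier V'; w' \<in> carrier W'\<rbrakk> \<Longrightarrow>
      g (v, w) (v', w') \<in> carrier Z \<and> F (g (v, w) (v', w')) = H (v, w) (v', w')"
    and F: "linear_form Z F"
  shows "F (bilinear_ext Z g X Y) = pair_eval H X Y"
proof -
  have "F (bilinear_ext Z g X Y) = pair_eval (\<lambda>p q. F (g p q)) X Y"
    unfolding pair_eval_def using g by (intro linear_form_bilinear_ext[OF vs X Y _ F]) blast
  also have "\<dots> = pair_eval H X Y"
    unfolding pair_eval_def tensor_eval_def free_eval_def
    using tensor_representative(2)[OF vs(1,2) X] tensor_representative(2)[OF vs(3,4) Y] g
    by (intro sum.cong refl arg_cong2[where f = "(*)"]) (auto simp: subset_iff)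
  finally show ?thesis .
qed

context
  fixes V :: "('k::field, 'v) module" and W :: "('k, 'w) module"
    and V' :: "('k, 'v') module" and W' :: "('k, 'w') module" and H
  assumes vs: "vspace V" "vspace W" "vspace V'" "vspace W'"
    and H: "quadrilinear V W V' W' H"
begin

lemma bilinear_form_pair_eval:
  assumes "Y \<in> carrier (V' \<boxtimes> W')"
  shows "bilinear_form V W (\<lambda>p. tensor_eval (H p) Y)"
  unfolding bilinear_form_def using H
  by (auto intro!: linear_form_tensor_eval_param[OF vs(3,4) assms] simp: quadrilinear_def bilinear_form_def)

lemma linear_form_pair_eval_left:
  "Y \<in> carrier (V' \<boxtimes> W') \<Longrightarrow> linear_form (V \<boxtimes> W) (\<lambda>X. pair_eval H X Y)"
  unfolding pair_eval_def using linear_form_tensor_eval[OF bilinear_form_pair_eval] by simp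

lemma linear_form_pair_eval_right:
  "X \<in> carrier (V \<boxtimes> W) \<Longrightarrow> linear_form (V' \<boxtimes> W') (\<lambda>Y. pair_eval H X Y)"
  unfolding pair_eval_def using H
  by (intro linear_form_tensor_eval_param[OF vs(1,2)] linear_form_tensor_eval) (auto simp: quadrilinear_def)

lemma pair_eval_class:
  assumes X: "X = tensor_class V W u" "Poly_Mapping.keys u \<subseteq> carrier V \<times> carrier W"
    and Y: "Y = tensor_class V' W' v" "Poly_Mapping.keys v \<subseteq> carrier V' \<times> carrier W'"
  shows "pair_eval H X Y = free_eval (\<lambda>p. free_eval (H p) v) u"
proof -
  have "Y \<in> carrier (V' \<boxtimes> W')" using Y by (auto simp: tensor_space_sel)
  then have "pair_eval H X Y = free_eval (\<lambda>p. tensor_eval (H p) Y) u"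
    unfolding pair_eval_def by (intro tensor_eval_class[OF bilinear_form_pair_eval X(1)])
  also have "\<dots> = free_eval (\<lambda>p. free_eval (H p) v) u"
    unfolding free_eval_def[of _ u] using X(2) H
    by (intro sum.cong refl arg_cong2[where f = "(*)"] tensor_eval_class[OF _ Y(1)]) (auto simp: quadrilinear_def)
  finally show ?thesis .
qed

lemma pair_eval_tens:
  assumes "v \<in> carrier V" "w \<in> carrier W" "v' \<in> carrier V'" "w' \<in> carrier W'"
  shows "pair_eval H (tens V W v w) (tens V' W' v' w') = H (v, w) (v', w')"
  using assms by (subst pair_eval_class[OF tens_def _ tens_def]) (auto simp: free_eval_single)

end

section \<open>Separating families of linear forms\<close>

definition separating :: "('k::field, 'v) module \<Rightarrow> ('v \<Rightarrow> 'k) set \<Rightarrow> bool" where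
  "separating V \<Phi> \<longleftrightarrow>
     (\<forall>\<phi>\<in>\<Phi>. linear_form V \<phi>) \<and> (\<forall>v\<in>carrier V. (\<forall>\<phi>\<in>\<Phi>. \<phi> v = 0) \<longrightarrow> v = \<zero>\<^bsub>V\<^esub>)"

lemma separating_linear_form: "\<lbrakk>separating V \<Phi>; \<phi> \<in> \<Phi>\<rbrakk> \<Longrightarrow> linear_form V \<phi>"
  by (simp add: separating_def)

lemma separating_eqI:
  fixes V :: "('k::field, 'v) module"
  assumes V: "vspace V" and \<Phi>: "separating V \<Phi>" and vw: "v \<in> carrier V" "w \<in> carrier V"
    and eq: "\<And>\<phi>. \<phi> \<in> \<Phi> \<Longrightarrow> \<phi> v = \<phi> w"
  shows "v = w"
proof -
  interpret V: vectorspace "class_ring :: 'k ring" V by (rule V)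
  have "\<phi> (v \<ominus>\<^bsub>V\<^esub> w) = 0" if "\<phi> \<in> \<Phi>" for \<phi>
    using linear_form_diff[OF V separating_linear_form[OF \<Phi> that] vw] eq[OF that] by simp
  then have 0: "v \<ominus>\<^bsub>V\<^esub> w = \<zero>\<^bsub>V\<^esub>"
    using \<Phi> vspace_minus_closed[OF V vw] by (auto simp: separating_def)
  have "v = (v \<ominus>\<^bsub>V\<^esub> w) \<oplus>\<^bsub>V\<^esub> w"
    using vw by (simp add: a_minus_def V.a_assoc V.l_neg)
  then show ?thesis using 0 vw by simp
qed

lemma eq_zero_iff_forms:
  assumes V: "vspace V" and \<Phi>: "separating V \<Phi>" and X: "X \<in> carrier V"
  shows "X = \<zero>\<^bsub>V\<^esub> \<longleftrightarrow> (\<forall>\<phi>\<in>\<Phi>. \<phi> X = 0)"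
  using \<Phi> X linear_form_zero[OF V] by (auto simp: separating_def)

lemma tensor_rel_zero_left:
  assumes V: "vspace V" and w: "w \<in> carrier W"
  shows "Poly_Mapping.single (\<zero>\<^bsub>V\<^esub>, w) 1 \<in> tensor_rel V W"
  using tensor_rel.smult_left[of "\<zero>\<^bsub>V\<^esub>" V w W 0] w
  by (simp add: vspace_smult_zero[OF V] vspace_zero_closed[OF V])

lemma tensor_rel_zero_right:
  assumes W: "vspace W" and v: "v \<in> carrier V"
  shows "Poly_Mapping.single (v, \<zero>\<^bsub>W\<^esub>) 1 \<in> tensor_rel V W"
  using tensor_rel.smult_right[of v V "\<zero>\<^bsub>W\<^esub>" W 0] v
  by (simp add: vspace_smult_zero[OF W] vspace_zero_closed[OF W])

lemma tensor_rel_lincomb_right: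
  fixes W :: "('k::field, 'w) module"
  assumes W: "vspace W" and v: "v \<in> carrier V"
  shows "finite J \<Longrightarrow> w \<in> J \<rightarrow> carrier W \<Longrightarrow>
    Poly_Mapping.single (v, \<Oplus>\<^bsub>W\<^esub>j\<in>J. c j \<odot>\<^bsub>W\<^esub> w j) 1 - (\<Sum>j\<in>J. Poly_Mapping.single (v, w j) (c j))
      \<in> tensor_rel V W"
proof (induction J rule: finite_induct)
  case empty
  interpret W: vectorspace "class_ring :: 'k ring" W by (rule W)
  show ?case using tensor_rel_zero_right[OF W v] by simp
next
  case (insert i J)
  interpret W: vectorspace "class_ring :: 'k ring" W by (rule W)
  let ?S = "\<Oplus>\<^bsub>W\<^esub>j\<in>J. c j \<odot>\<^bsub>W\<^esub> w j"
  have w: "w i \<in> carrier W" "c i \<odot>\<^bsub>W\<^esub> w i \<in> carrier W" "?S \<in> carrier W"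
    using insert.prems by (auto intro!: vspace_smult_closed[OF W] vspace_finsum_closed[OF W])
  have "(\<Oplus>\<^bsub>W\<^esub>j\<in>insert i J. c j \<odot>\<^bsub>W\<^esub> w j) = c i \<odot>\<^bsub>W\<^esub> w i \<oplus>\<^bsub>W\<^esub> ?S"
    using insert w(2) by (intro W.finsum_insert) (auto intro!: vspace_smult_closed[OF W])
  moreover note tensor_rel.add[OF tensor_rel.add[OF tensor_rel.add_right[OF v w(2,3)]
      tensor_rel.smult_right[OF v w(1), of "c i"]] insert.IH]
  ultimately show ?case using insert by (simp add: algebra_simps)
qed

text \<open>
  A tensor \<open>\<Sum>\<^sub>j v\<^sub>j \<otimes> w\<^sub>j\<close> killed by all \<open>\<phi> \<otimes> \<psi>\<close> is zero, by induction on the number of terms.  If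
  \<open>\<phi> v\<^sub>i \<noteq> 0\<close> for some \<open>\<phi>\<close>, then the hypothesis for this \<open>\<phi>\<close> and all \<open>\<psi>\<close> expresses \<open>w\<^sub>i\<close> as a linear
  combination of the other \<open>w\<^sub>j\<close>; substituting it removes the \<open>i\<close>-th term.
\<close>

lemma tensor_rel_if_forms_vanish:
  fixes V :: "('k::field, 'v) module" and W :: "('k, 'w) module"
  assumes V: "vspace V" and W: "vspace W" and \<Phi>: "separating V \<Phi>" and \<Psi>: "separating W \<Psi>"
  shows "\<lbrakk>finite J; v \<in> J \<rightarrow> carrier V; w \<in> J \<rightarrow> carrier W;
      \<And>\<phi> \<psi>. \<lbrakk>\<phi> \<in> \<Phi>; \<psi> \<in> \<Psi>\<rbrakk> \<Longrightarrow> (\<Sum>j\<in>J. \<phi> (v j) * \<psi> (w j)) = 0\<rbrakk> \<Longrightarrow>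
    (\<Sum>j\<in>J. Poly_Mapping.single (v j, w j) 1) \<in> tensor_rel V W"
proof (induction J arbitrary: v rule: finite_induct)
  case empty
  show ?case by (simp add: tensor_rel.zero)
next
  case (insert i J)
  have vi: "v i \<in> carrier V" "w i \<in> carrier W" and v: "v \<in> J \<rightarrow> carrier V" and w: "w \<in> J \<rightarrow> carrier W"
    using insert.prems by auto
  have eq: "\<phi> (v i) * \<psi> (w i) + (\<Sum>j\<in>J. \<phi> (v j) * \<psi> (w j)) = 0" if "\<phi> \<in> \<Phi>" "\<psi> \<in> \<Psi>" for \<phi> \<psi>
    using insert.prems(3)[OF that] insert.hyps by simp
  show ?case
  proof (cases "v i = \<zero>\<^bsub>V\<^esub>")
    case True
    have "(\<Sum>j\<in>J. \<phi> (v j) * \<psi> (w j)) = 0" if "\<phi> \<in> \<Phi>" "\<psi> \<in> \<Psi>" for \<phi> \<psi>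
      using eq[OF that] True linear_form_zero[OF V separating_linear_form[OF \<Phi> that(1)]] by simp
    then have "(\<Sum>j\<in>J. Poly_Mapping.single (v j, w j) 1) \<in> tensor_rel V W"
      by (intro insert.IH v w)
    then show ?thesis
      using insert.hyps tensor_rel.add[OF tensor_rel_zero_left[OF V vi(2)]] True by simp
  next
    case False
    then obtain \<phi> where \<phi>: "\<phi> \<in> \<Phi>" "\<phi> (v i) \<noteq> 0"
      using \<Phi> vi(1) by (auto simp: separating_def)
    define c where "c j = - (\<phi> (v j) / \<phi> (v i))" for j
    have wi: "w i = (\<Oplus>\<^bsub>W\<^esub>j\<in>J. c j \<odot>\<^bsub>W\<^esub> w j)"
    proof (rule separating_eqI[OF W \<Psi> vi(2)])
      show "(\<Oplus>\<^bsub>W\<^esub>j\<in>J. c j \<odot>\<^bsub>W\<^esub> w j) \<in> carrier W"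
        using w by (intro vspace_finsum_closed[OF W]) (auto intro!: vspace_smult_closed[OF W])
      fix \<psi> assume \<psi>: "\<psi> \<in> \<Psi>"
      note l = separating_linear_form[OF \<Psi> \<psi>]
      have "\<psi> (\<Oplus>\<^bsub>W\<^esub>j\<in>J. c j \<odot>\<^bsub>W\<^esub> w j) = (\<Sum>j\<in>J. c j * \<psi> (w j))"
        using w by (subst linear_form_finsum[OF W l])
          (auto intro!: vspace_smult_closed[OF W] sum.cong linear_form_smult[OF l])
      also have "\<dots> = - (\<Sum>j\<in>J. \<phi> (v j) * \<psi> (w j)) / \<phi> (v i)"
        by (simp add: c_def sum_negf sum_divide_distrib)
      also have "\<dots> = \<psi> (w i)"
        using eq[OF \<phi>(1) \<psi>] \<phi>(2) by (simp add: field_simps add_eq_0_iff)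
      finally show "\<psi> (w i) = \<psi> (\<Oplus>\<^bsub>W\<^esub>j\<in>J. c j \<odot>\<^bsub>W\<^esub> w j)" by simp
    qed
    \<comment> \<open>Moving the coefficients of \<open>w\<^sub>i\<close> to the left factors.\<close>
    define v' where "v' j = v j \<oplus>\<^bsub>V\<^esub> c j \<odot>\<^bsub>V\<^esub> v i" for j
    have v': "v' \<in> J \<rightarrow> carrier V"
      using v vi by (auto simp: v'_def intro!: vspace_add_closed[OF V] vspace_smult_closed[OF V])
    have r1: "(\<Sum>j\<in>J. Poly_Mapping.single (v' j, w j) 1) \<in> tensor_rel V W"
    proof (rule insert.IH[OF v' w])
      fix \<phi>' \<psi> assume f: "\<phi>' \<in> \<Phi>" "\<psi> \<in> \<Psi>"
      note l = separating_linear_form[OF \<Phi> f(1)] separating_linear_form[OF \<Psi> f(2)]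
      have "\<psi> (w i) = (\<Sum>j\<in>J. c j * \<psi> (w j))"
        using w by (subst wi, subst linear_form_finsum[OF W l(2)])
          (auto intro!: vspace_smult_closed[OF W] sum.cong linear_form_smult[OF l(2)])
      moreover have "\<phi>' (v' j) = \<phi>' (v j) + c j * \<phi>' (v i)" if "j \<in> J" for j
        using that v vi by (auto simp: v'_def linear_form_add[OF l(1)] linear_form_smult[OF l(1)]
            vspace_smult_closed[OF V] Pi_def)
      then have "(\<Sum>j\<in>J. \<phi>' (v' j) * \<psi> (w j))
          = (\<Sum>j\<in>J. \<phi>' (v j) * \<psi> (w j)) + \<phi>' (v i) * (\<Sum>j\<in>J. c j * \<psi> (w j))"
        by (simp add: algebra_simps sum.distrib sum_distrib_left)
      ultimately show "(\<Sum>j\<in>J. \<phi>' (v' j) * \<psi> (w j)) = 0"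
        using eq[OF f] by (simp add: algebra_simps)
    qed
    have r2: "(\<Sum>j\<in>J. Poly_Mapping.single (v' j, w j) 1 - Poly_Mapping.single (v j, w j) 1
        - Poly_Mapping.single (v i, w j) (c j)) \<in> tensor_rel V W"
    proof (rule tensor_rel_sum)
      fix j assume "j \<in> J"
      then have j: "v j \<in> carrier V" "w j \<in> carrier W" using v w by auto
      show "Poly_Mapping.single (v' j, w j) 1 - Poly_Mapping.single (v j, w j) 1
        - Poly_Mapping.single (v i, w j) (c j) \<in> tensor_rel V W"
        using tensor_rel.add[OF tensor_rel.add_left[OF j(1) vspace_smult_closed[OF V vi(1), of "c j"] j(2)]
          tensor_rel.smult_left[OF vi(1) j(2), of "c j"]]
        by (simp add: v'_def)
    qed
    have r3: "Poly_Mapping.single (v i, w i) 1 - (\<Sum>j\<in>J. Poly_Mapping.single (v i, w j) (c j))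
        \<in> tensor_rel V W"
      by (subst wi) (rule tensor_rel_lincomb_right[OF W vi(1) insert.hyps(1) w])
    have "(Poly_Mapping.single (v i, w i) 1 - (\<Sum>j\<in>J. Poly_Mapping.single (v i, w j) (c j)))
      + ((\<Sum>j\<in>J. Poly_Mapping.single (v' j, w j) 1) -
        (\<Sum>j\<in>J. Poly_Mapping.single (v' j, w j) 1 - Poly_Mapping.single (v j, w j) 1
        - Poly_Mapping.single (v i, w j) (c j))) \<in> tensor_rel V W"
      by (rule tensor_rel.add[OF r3 tensor_rel_diff[OF r1 r2]])
    then show ?thesis using insert.hyps by (simp add: sum_subtractf sum.distrib algebra_simps)
  qed
qed

definition tensor_form ::
  "('v \<Rightarrow> 'k::field) \<Rightarrow> ('w \<Rightarrow> 'k) \<Rightarrow> ('v \<times> 'w \<Rightarrow>\<^sub>0 'k) set \<Rightarrow> 'k" where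
  "tensor_form \<phi> \<psi> = tensor_eval (\<lambda>(v, w). \<phi> v * \<psi> w)"

lemma bilinear_form_product:
  "\<lbrakk>linear_form V \<phi>; linear_form W \<psi>\<rbrakk> \<Longrightarrow> bilinear_form V W (\<lambda>(v, w). \<phi> v * \<psi> w)"
  by (auto simp: bilinear_form_def intro!: linear_form_scale linear_form_scale_right)

lemma linear_form_tensor_form:
  "\<lbrakk>linear_form V \<phi>; linear_form W \<psi>\<rbrakk> \<Longrightarrow> linear_form (V \<boxtimes> W) (tensor_form \<phi> \<psi>)"
  unfolding tensor_form_def by (intro linear_form_tensor_eval bilinear_form_product)

lemma tensor_form_tens:
  "\<lbrakk>linear_form V \<phi>; linear_form W \<psi>\<rbrakk> \<Longrightarrow> tensor_form \<phi> \<psi> (tens V W v w) = \<phi> v * \<psi> w"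
  unfolding tensor_form_def using tensor_eval_tens[OF bilinear_form_product] by simp

lemma separating_tensor:
  fixes V :: "('k::field, 'v) module" and W :: "('k, 'w) module"
  assumes V: "vspace V" and W: "vspace W" and \<Phi>: "separating V \<Phi>" and \<Psi>: "separating W \<Psi>"
  shows "separating (V \<boxtimes> W) {tensor_form \<phi> \<psi> | \<phi> \<psi>. \<phi> \<in> \<Phi> \<and> \<psi> \<in> \<Psi>}"
  unfolding separating_def
proof (intro conjI ballI impI)
  fix \<chi> assume "\<chi> \<in> {tensor_form \<phi> \<psi> | \<phi> \<psi>. \<phi> \<in> \<Phi> \<and> \<psi> \<in> \<Psi>}"
  then show "linear_form (V \<boxtimes> W) \<chi>"
    using linear_form_tensor_form separating_linear_form[OF \<Phi>] separating_linear_form[OF \<Psi>] by blast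
next
  fix X assume X: "X \<in> carrier (V \<boxtimes> W)"
    and van: "\<forall>\<chi>\<in>{tensor_form \<phi> \<psi> | \<phi> \<psi>. \<phi> \<in> \<Phi> \<and> \<psi> \<in> \<Psi>}. \<chi> X = 0"
  obtain u where u: "X = tensor_class V W u" "Poly_Mapping.keys u \<subseteq> carrier V \<times> carrier W"
    using X by (auto simp: tensor_space_sel)
  let ?K = "Poly_Mapping.keys u" and ?l = "Poly_Mapping.lookup u"
  have "(\<Sum>p\<in>?K. Poly_Mapping.single (?l p \<odot>\<^bsub>V\<^esub> fst p, snd p) 1) \<in> tensor_rel V W"
  proof (rule tensor_rel_if_forms_vanish[OF V W \<Phi> \<Psi>])
    fix \<phi> \<psi> assume f: "\<phi> \<in> \<Phi>" "\<psi> \<in> \<Psi>"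
    note l = separating_linear_form[OF \<Phi> f(1)] separating_linear_form[OF \<Psi> f(2)]
    have "0 = tensor_form \<phi> \<psi> X" using van f by auto
    also have "\<dots> = free_eval (\<lambda>(v, w). \<phi> v * \<psi> w) u"
      unfolding tensor_form_def by (rule tensor_eval_class[OF bilinear_form_product[OF l] u(1)])
    also have "\<dots> = (\<Sum>p\<in>?K. \<phi> (?l p \<odot>\<^bsub>V\<^esub> fst p) * \<psi> (snd p))"
      unfolding free_eval_def using u(2)
      by (intro sum.cong) (auto simp: linear_form_smult[OF l(1)])
    finally show "(\<Sum>p\<in>?K. \<phi> (?l p \<odot>\<^bsub>V\<^esub> fst p) * \<psi> (snd p)) = 0" by simp
  qed (use u(2) in \<open>auto intro!: vspace_smult_closed[OF V]\<close>)
  moreover have "(\<Sum>p\<in>?K. Poly_Mapping.single (?l p \<odot>\<^bsub>V\<^esub> fst p, snd p) 1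
      - Poly_Mapping.single p (?l p)) \<in> tensor_rel V W"
    using u(2) by (intro tensor_rel_sum) (auto intro!: tensor_rel.smult_left)
  ultimately have "(\<Sum>p\<in>?K. Poly_Mapping.single p (?l p)) \<in> tensor_rel V W"
    using tensor_rel_diff by (fastforce simp: sum_subtractf)
  then have "u \<in> tensor_rel V W" by (simp add: monom_sum)
  then show "X = \<zero>\<^bsub>V \<boxtimes> W\<^esub>" by (simp add: u tensor_space_sel tensor_class_eq)
qed

definition tensor_form3 where
  "tensor_form3 F\<^sub>1 F\<^sub>2 F\<^sub>3 = tensor_form (tensor_form F\<^sub>1 F\<^sub>2) F\<^sub>3"

lemma linear_form_tensor_form3:
  "\<lbrakk>linear_form U F\<^sub>1; linear_form V F\<^sub>2; linear_form W F\<^sub>3\<rbrakk> \<Longrightarrow>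
    linear_form (U \<boxtimes> V \<boxtimes> W) (tensor_form3 F\<^sub>1 F\<^sub>2 F\<^sub>3)"
  unfolding tensor_form3_def by (intro linear_form_tensor_form)

lemma tensor_form3_tens3:
  "\<lbrakk>linear_form U F\<^sub>1; linear_form V F\<^sub>2; linear_form W F\<^sub>3\<rbrakk> \<Longrightarrow>
    tensor_form3 F\<^sub>1 F\<^sub>2 F\<^sub>3 (tens3 U V W u v w) = F\<^sub>1 u * F\<^sub>2 v * F\<^sub>3 w"
  unfolding tensor_form3_def by (simp add: tensor_form_tens linear_form_tensor_form)

lemma tens3_closed:
  "\<lbrakk>u \<in> carrier U; v \<in> carrier V; w \<in> carrier W\<rbrakk> \<Longrightarrow> tens3 U V W u v w \<in> carrier (U \<boxtimes> V \<boxtimes> W)"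
  by (intro tens_closed)

lemma separating_tensor3:
  assumes "vspace U" "vspace V" "vspace W" "separating U \<Phi>" "separating V \<Psi>" "separating W \<Theta>"
  shows "separating (U \<boxtimes> V \<boxtimes> W) {tensor_form3 \<phi> \<psi> \<theta> | \<phi> \<psi> \<theta>. \<phi> \<in> \<Phi> \<and> \<psi> \<in> \<Psi> \<and> \<theta> \<in> \<Theta>}"
proof -
  have "{tensor_form \<chi> \<theta> | \<chi> \<theta>. \<chi> \<in> {tensor_form \<phi> \<psi> | \<phi> \<psi>. \<phi> \<in> \<Phi> \<and> \<psi> \<in> \<Psi>} \<and> \<theta> \<in> \<Theta>}
    = {tensor_form3 \<phi> \<psi> \<theta> | \<phi> \<psi> \<theta>. \<phi> \<in> \<Phi> \<and> \<psi> \<in> \<Psi> \<and> \<theta> \<in> \<Theta>}"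
    unfolding tensor_form3_def by blast
  then show ?thesis
    using separating_tensor[OF vspace_tensor assms(3) separating_tensor[OF assms(1,2,4,5)] assms(6)] by simp
qed

text \<open>
  The coordinate functions of a basis are linear forms.
\<close>

lemma fin_dim_separating:
  fixes A :: "('k::field, 'a) module"
  assumes A: "vspace A" and fd: "vectorspace.fin_dim class_ring A"
  shows "separating A {\<phi>. linear_form A \<phi>}"
  unfolding separating_def
proof (intro conjI ballI impI)
  interpret A: vectorspace "class_ring :: 'k ring" A by (rule A)
  obtain S where S: "finite S" "A.basis S" using A.finite_basis_exists[OF fd] by blast
  then have SA: "S \<subseteq> carrier A" by (simp add: A.basis_def)
  have ex: "\<exists>!c. c \<in> S \<rightarrow>\<^sub>E UNIV \<and> A.lincomb c S = v" if "v \<in> carrier A" for v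
    using A.basis_criterion[OF S(1) SA] S(2) that by simp
  define coord where "coord v = (THE c. c \<in> S \<rightarrow>\<^sub>E UNIV \<and> A.lincomb c S = v)" for v
  have coord: "coord v \<in> S \<rightarrow>\<^sub>E UNIV" "A.lincomb (coord v) S = v" if "v \<in> carrier A" for v
    using theI'[OF ex[OF that]] by (simp_all add: coord_def)
  have coord_eq: "coord (A.lincomb c S) s = c s" if "s \<in> S" for c s
  proof -
    have "A.lincomb (restrict c S) S = A.lincomb c S"
      by (rule A.lincomb_cong) (use SA in auto)
    moreover have "A.lincomb c S \<in> carrier A" using SA by (intro A.lincomb_closed) auto
    ultimately have "coord (A.lincomb c S) = restrict c S"
      unfolding coord_def by (intro the1_equality ex) auto
    then show ?thesis using that by simp
  qed
  have lin: "linear_form A (\<lambda>v. coord v s)" if s: "s \<in> S" for s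
  proof (rule linear_formI)
    fix v w assume vw: "v \<in> carrier A" "w \<in> carrier A"
    have "v \<oplus>\<^bsub>A\<^esub> w = A.lincomb (\<lambda>x. coord v x + coord w x) S"
      using A.lincomb_sum[OF S(1) SA, of "coord v" "coord w"] coord(2)[OF vw(1)] coord(2)[OF vw(2)] by simp
    then show "coord (v \<oplus>\<^bsub>A\<^esub> w) s = coord v s + coord w s" using coord_eq[OF s] by simp
  next
    fix t v assume v: "v \<in> carrier A"
    have "t \<odot>\<^bsub>A\<^esub> v = A.lincomb (\<lambda>x. t * coord v x) S"
      using A.lincomb_smult[OF SA, of "coord v" t] coord(2)[OF v] by simp
    then show "coord (t \<odot>\<^bsub>A\<^esub> v) s = t * coord v s" using coord_eq[OF s] by simp
  qed
  show "linear_form A \<phi>" if "\<phi> \<in> {\<phi>. linear_form A \<phi>}" for \<phi>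
    using that by simp
  fix v assume v: "v \<in> carrier A" and van: "\<forall>\<phi>\<in>{\<phi>. linear_form A \<phi>}. \<phi> v = 0"
  then have "coord v s = 0" if "s \<in> S" for s using lin[OF that] by auto
  then have "A.lincomb (coord v) S = A.lincomb (\<lambda>_. 0) S"
    by (intro A.lincomb_cong) (use SA in auto)
  also have "\<dots> = \<zero>\<^bsub>A\<^esub>"
    using A.lincomb_smult[OF SA, of "\<lambda>_. 0" 0] vspace_smult_zero[OF A A.lincomb_closed[OF SA]] by simp
  finally show "v = \<zero>\<^bsub>A\<^esub>" using coord(2)[OF v] by simp
qed

section \<open>The flip\<close>

abbreviation swap_keys :: "('v \<times> 'w \<Rightarrow>\<^sub>0 'k::field) \<Rightarrow> ('w \<times> 'v \<Rightarrow>\<^sub>0 'k)" where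
  "swap_keys \<equiv> Poly_Mapping.map_key prod.swap"

lemma lookup_swap_keys: "Poly_Mapping.lookup (swap_keys u) p = Poly_Mapping.lookup u (prod.swap p)"
  by (simp add: Poly_Mapping.map_key.rep_eq[OF inj_swap])

lemma swap_keys_single: "swap_keys (Poly_Mapping.single (a, b) s) = Poly_Mapping.single (b, a) s"
  by (rule poly_mapping_eqI) (auto simp: lookup_swap_keys lookup_single when_def)

lemma swap_keys_diff: "swap_keys (u - v) = swap_keys u - swap_keys v"
  by (rule poly_mapping_eqI) (simp add: lookup_swap_keys lookup_minus)

lemma swap_keys_add: "swap_keys (u + v) = swap_keys u + swap_keys v"
  by (rule poly_mapping_eqI) (simp add: lookup_swap_keys lookup_add)

lemma swap_keys_scal: "swap_keys (scal s u) = scal s (swap_keys u)"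
  by (rule poly_mapping_eqI) (simp add: lookup_swap_keys lookup_scal)

lemma swap_keys_swap_keys: "swap_keys (swap_keys u) = u"
  by (rule poly_mapping_eqI) (simp add: lookup_swap_keys)

lemma keys_swap_keys: "Poly_Mapping.keys (swap_keys u) = prod.swap ` Poly_Mapping.keys u"
  by (force simp: in_keys_iff lookup_swap_keys image_iff)

lemma tensor_rel_swap_keys: "u \<in> tensor_rel V W \<Longrightarrow> swap_keys u \<in> tensor_rel W V"
  by (induction rule: tensor_rel.induct)
    (auto simp: swap_keys_add swap_keys_diff swap_keys_scal swap_keys_single
      Poly_Mapping.map_key_zero[OF inj_swap] intro: tensor_rel.intros)

lemma flip_class: "flip (tensor_class V W u) = tensor_class W V (swap_keys u)"
proof (intro equalityI subsetI)
  fix w assume "w \<in> flip (tensor_class V W u)"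
  then obtain v where "w = swap_keys v" "v - u \<in> tensor_rel V W"
    by (auto simp: flip_def mem_tensor_class)
  then show "w \<in> tensor_class W V (swap_keys u)"
    using tensor_rel_swap_keys[of "v - u" V W] by (simp add: mem_tensor_class swap_keys_diff)
next
  fix w assume "w \<in> tensor_class W V (swap_keys u)"
  then have "swap_keys w \<in> tensor_class V W u"
    using tensor_rel_swap_keys[of "w - swap_keys u" W V]
    by (simp add: mem_tensor_class swap_keys_diff swap_keys_swap_keys)
  then show "w \<in> flip (tensor_class V W u)"
    unfolding flip_def by (rule rev_image_eqI) (simp add: swap_keys_swap_keys)
qed

lemma flip_closed: "X \<in> carrier (V \<boxtimes> W) \<Longrightarrow> flip X \<in> carrier (W \<boxtimes> V)"
  by (fastforce simp: tensor_space_sel flip_class keys_swap_keys)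

lemma tensor_form_flip:
  assumes l: "linear_form V \<phi>" "linear_form W \<psi>" and X: "X \<in> carrier (W \<boxtimes> V)"
  shows "tensor_form \<phi> \<psi> (flip X) = tensor_form \<psi> \<phi> X"
proof -
  obtain u where u: "X = tensor_class W V u" using X by (auto simp: tensor_space_sel)
  have "free_eval (\<lambda>(v, w). \<phi> v * \<psi> w) (swap_keys u) = free_eval (\<lambda>(w, v). \<psi> w * \<phi> v) u"
    unfolding free_eval_def keys_swap_keys
    by (subst sum.reindex) (auto simp: lookup_swap_keys case_prod_unfold mult.commute intro!: sum.cong)
  then show ?thesis
    unfolding tensor_form_def u flip_class
    by (simp add: tensor_eval_class[OF bilinear_form_product[OF l] refl]
      tensor_eval_class[OF bilinear_form_product[OF l(2,1)] refl])
qed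

lemma flip_eq_uminus_iff:
  assumes V: "vspace V" and W: "vspace W" and \<Phi>: "separating V \<Phi>" and \<Psi>: "separating W \<Psi>"
    and X: "X \<in> carrier (V \<boxtimes> W)" and Y: "Y \<in> carrier (W \<boxtimes> V)"
  shows "flip Y = \<ominus>\<^bsub>V \<boxtimes> W\<^esub> X \<longleftrightarrow>
    (\<forall>\<phi>\<in>\<Phi>. \<forall>\<psi>\<in>\<Psi>. tensor_form \<psi> \<phi> Y = - tensor_form \<phi> \<psi> X)"
proof -
  have val: "tensor_form \<phi> \<psi> (flip Y) = tensor_form \<psi> \<phi> Y"
    "tensor_form \<phi> \<psi> (\<ominus>\<^bsub>V \<boxtimes> W\<^esub> X) = - tensor_form \<phi> \<psi> X" if "\<phi> \<in> \<Phi>" "\<psi> \<in> \<Psi>" for \<phi> \<psi>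
    using that separating_linear_form[OF \<Phi>] separating_linear_form[OF \<Psi>] X Y
    by (auto intro!: tensor_form_flip linear_form_uminus[OF vspace_tensor] linear_form_tensor_form)
  show ?thesis
  proof
    assume "flip Y = \<ominus>\<^bsub>V \<boxtimes> W\<^esub> X"
    then show "\<forall>\<phi>\<in>\<Phi>. \<forall>\<psi>\<in>\<Psi>. tensor_form \<psi> \<phi> Y = - tensor_form \<phi> \<psi> X" using val by metis
  next
    assume "\<forall>\<phi>\<in>\<Phi>. \<forall>\<psi>\<in>\<Psi>. tensor_form \<psi> \<phi> Y = - tensor_form \<phi> \<psi> X"
    then show "flip Y = \<ominus>\<^bsub>V \<boxtimes> W\<^esub> X"
      using val flip_closed[OF Y] vspace_uminus_closed[OF vspace_tensor X]
      by (intro separating_eqI[OF vspace_tensor separating_tensor[OF V W \<Phi> \<Psi>]]) auto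
  qed
qed

section \<open>Bracket and grading of the induced Lie algebra\<close>

lemma (in nonassoc_algebra) linear_form_mult:
  assumes "linear_form A \<phi>" "c \<in> carrier A"
  shows linear_form_mult_left: "linear_form A (\<lambda>a. \<phi> (a \<star>\<^bsub>A\<^esub> c))"
    and linear_form_mult_right: "linear_form A (\<lambda>a. \<phi> (c \<star>\<^bsub>A\<^esub> a))"
  using assms by (auto intro!: linear_formI simp: linear_form_add linear_form_smult prod_closed
      prod_add_left prod_add_right prod_smult_left prod_smult_right)

lemma (in nonassoc_algebra) vspace: "vspace A"
  by (rule vectorspace_axioms)

text \<open>
  The shift \<open>m\<close> of the graded form is a parameter, so that the dual of \<open>G i\<close> is \<open>G (- i - m)\<close>.
\<close>

locale induced_lie_algebra =
  A: nonassoc_algebra A + B: quadratic_graded_right_novikov_algebra B G \<omega>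
  for A :: "('k::field, 'a) module" and B :: "('k, 'b) module" and G \<omega> +
  fixes m :: int
  assumes A_separating: "separating A {\<phi>. linear_form A \<phi>}"
    and form_degree: "\<lbrakk>i + j + m \<noteq> 0; a \<in> G i; b \<in> G j\<rbrakk> \<Longrightarrow> \<omega> a b = 0"
begin

abbreviation L where "L \<equiv> induced_lie A B"
abbreviation D where "D \<equiv> induced_grading A B G"

lemma G_carrier: "b \<in> G i \<Longrightarrow> b \<in> carrier B"
  using B.G_subspace[of i] by (auto simp: subspace_def submodule_def)

lemma linear_form_form_left: "c \<in> carrier B \<Longrightarrow> linear_form B (\<lambda>b. \<omega> b c)"
  by (intro linear_formI) (auto simp: B.form_add_left B.form_smult_left)

lemma linear_form_form_right: "c \<in> carrier B \<Longrightarrow> linear_form B (\<lambda>b. \<omega> c b)"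
  by (rule linear_form_cong[OF B.vspace linear_form_form_left[of c]]) (simp_all add: B.form_sym)

lemma B_separating: "separating B ((\<lambda>b a. \<omega> a b) ` carrier B)"
  by (auto simp: separating_def intro: linear_form_form_left B.form_nondegenerate)

text \<open>
  On elements of degree \<open>i\<close> the form only sees the component of degree \<open>- i - m\<close> of its other argument.
\<close>

lemma form_homogeneous_part:
  assumes b: "b \<in> carrier B"
  shows "\<exists>b'\<in>G (- i - m). \<forall>a\<in>G i. \<omega> a b = \<omega> a b'"
proof -
  obtain c where c: "\<And>j. c j \<in> G j" and fin: "finite {j. c j \<noteq> \<zero>\<^bsub>B\<^esub>}"
    and b_eq: "b = (\<Oplus>\<^bsub>B\<^esub>j\<in>{j. c j \<noteq> \<zero>\<^bsub>B\<^esub>}. c j)"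
    using B.G_direct_sum[OF b] by blast
  have "\<omega> a b = \<omega> a (c (- i - m))" if a: "a \<in> G i" for a
  proof -
    note lin = linear_form_form_right[OF G_carrier[OF a]]
    have "\<omega> a b = (\<Sum>j\<in>{j. c j \<noteq> \<zero>\<^bsub>B\<^esub>}. \<omega> a (c j))"
      unfolding b_eq using c G_carrier by (intro linear_form_finsum[OF B.vspace lin]) auto
    also have "\<dots> = (\<Sum>j\<in>{j. c j \<noteq> \<zero>\<^bsub>B\<^esub>}. if j = - i - m then \<omega> a (c (- i - m)) else 0)"
      using form_degree[OF _ a c] by (intro sum.cong) auto
    also have "\<dots> = \<omega> a (c (- i - m))"
      using fin linear_form_zero[OF B.vspace lin] by (auto simp: sum.delta)
    finally show ?thesis .
  qed
  then show ?thesis using c by blast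
qed

definition lie_form :: "('a \<Rightarrow> 'k) \<Rightarrow> 'b \<Rightarrow> ('a \<times> 'b \<Rightarrow>\<^sub>0 'k) set \<Rightarrow> 'k" where
  "lie_form \<phi> b = tensor_form \<phi> (\<lambda>a. \<omega> a b)"

lemma L_sel: "carrier L = carrier (A \<boxtimes> B)" "add L = add (A \<boxtimes> B)" "zero L = zero (A \<boxtimes> B)"
  "smult L = smult (A \<boxtimes> B)"
  by (simp_all add: induced_lie_def)

lemma vspace_homog: "vspace (homog L D i)"
  by (rule vspace_tensor_classes[where V = A and W = B and K = "carrier A \<times> G i"])
    (simp_all add: L_sel induced_grading_def)

lemma D_carrier: "D i \<subseteq> carrier (A \<boxtimes> B)"
  unfolding induced_grading_def tensor_space_sel using G_carrier by blast

lemma vspace_D: "vspace ((A \<boxtimes> B)\<lparr>carrier := D i\<rparr>)"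
  by (rule vspace_tensor_classes[where V = A and W = B and K = "carrier A \<times> G i"])
    (simp_all add: induced_grading_def)

lemma tens_D: "\<lbrakk>a \<in> carrier A; b \<in> G i\<rbrakk> \<Longrightarrow> tens A B a b \<in> D i"
  by (auto simp: tens_def induced_grading_def intro!: exI[of _ "Poly_Mapping.single (a, b) 1"])

lemma linear_form_lie_form:
  "\<lbrakk>linear_form A \<phi>; b \<in> carrier B\<rbrakk> \<Longrightarrow> linear_form (A \<boxtimes> B) (lie_form \<phi> b)"
  unfolding lie_form_def by (intro linear_form_tensor_form linear_form_form_left)

lemma lie_form_tens:
  "\<lbrakk>linear_form A \<phi>; c \<in> carrier B\<rbrakk> \<Longrightarrow> lie_form \<phi> c (tens A B a b) = \<phi> a * \<omega> b c"
  unfolding lie_form_def by (simp add: tensor_form_tens linear_form_form_left)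

lemma linear_form_homog:
  assumes "linear_form (A \<boxtimes> B) F" shows "linear_form (homog L D i) F"
  using linear_form_subset[OF assms D_carrier[of i]] by (simp add: linear_form_def L_sel)

lemma lie_forms_separate:
  "separating (A \<boxtimes> B) {lie_form \<phi> b | \<phi> b. linear_form A \<phi> \<and> b \<in> carrier B}"
proof -
  have "{tensor_form \<phi> \<psi> | \<phi> \<psi>. \<phi> \<in> {\<phi>. linear_form A \<phi>} \<and> \<psi> \<in> (\<lambda>b a. \<omega> a b) ` carrier B}
      = {lie_form \<phi> b | \<phi> b. linear_form A \<phi> \<and> b \<in> carrier B}"
    unfolding lie_form_def by blast
  then show ?thesis
    using separating_tensor[OF A.vspace B.vspace A_separating B_separating] by simp
qed

text \<open>
  Restricting \<open>b\<close> to a single degree is what later allows a dual basis expansion of \<open>b\<close> that uses only the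
  finitely many basis elements of one degree.
\<close>

lemma homog_separating:
  "separating (homog L D i) {lie_form \<phi> b | \<phi> b. linear_form A \<phi> \<and> b \<in> G (- i - m)}"
  unfolding separating_def
proof (intro conjI ballI impI)
  fix F assume "F \<in> {lie_form \<phi> b | \<phi> b. linear_form A \<phi> \<and> b \<in> G (- i - m)}"
  then show "linear_form (homog L D i) F"
    using linear_form_homog linear_form_lie_form G_carrier by auto
next
  fix X assume X: "X \<in> carrier (homog L D i)"
    and van: "\<forall>F\<in>{lie_form \<phi> b | \<phi> b. linear_form A \<phi> \<and> b \<in> G (- i - m)}. F X = 0"
  obtain u where u: "X = tensor_class A B u" "Poly_Mapping.keys u \<subseteq> carrier A \<times> G i"
    using X by (auto simp: induced_grading_def)
  have "lie_form \<phi> b X = 0" if \<phi>: "linear_form A \<phi>" and b: "b \<in> carrier B" for \<phi> b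
  proof -
    obtain b' where b': "b' \<in> G (- i - m)" and eq: "\<And>a. a \<in> G i \<Longrightarrow> \<omega> a b = \<omega> a b'"
      using form_homogeneous_part[OF b, of i] by blast
    have ev: "lie_form \<phi> c X = free_eval (\<lambda>(a, a'). \<phi> a * \<omega> a' c) u" if "c \<in> carrier B" for c
      unfolding lie_form_def tensor_form_def
      by (rule tensor_eval_class[OF bilinear_form_product[OF \<phi> linear_form_form_left[OF that]] u(1)])
    have "lie_form \<phi> b X = lie_form \<phi> b' X"
      unfolding ev[OF b] ev[OF G_carrier[OF b']] free_eval_def
      using u(2) eq by (intro sum.cong) auto
    then show ?thesis using van \<phi> b' by auto
  qed
  then have "\<forall>F\<in>{lie_form \<phi> b | \<phi> b. linear_form A \<phi> \<and> b \<in> carrier B}. F X = 0" by blast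
  moreover have "X \<in> carrier (A \<boxtimes> B)" using X D_carrier[of i] by auto
  ultimately have "X = \<zero>\<^bsub>A \<boxtimes> B\<^esub>" using lie_forms_separate unfolding separating_def by blast
  then show "X = \<zero>\<^bsub>homog L D i\<^esub>" by (simp add: L_sel)
qed

definition bracket_kernel :: "('a \<Rightarrow> 'k) \<Rightarrow> 'b \<Rightarrow> 'a \<times> 'b \<Rightarrow> 'a \<times> 'b \<Rightarrow> 'k" where
  "bracket_kernel \<phi> c = (\<lambda>(a\<^sub>1, b\<^sub>1) (a\<^sub>2, b\<^sub>2).
     \<phi> (a\<^sub>1 \<star>\<^bsub>A\<^esub> a\<^sub>2) * \<omega> (b\<^sub>1 \<star>\<^bsub>B\<^esub> b\<^sub>2) c - \<phi> (a\<^sub>2 \<star>\<^bsub>A\<^esub> a\<^sub>1) * \<omega> (b\<^sub>2 \<star>\<^bsub>B\<^esub> b\<^sub>1) c)"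

lemma quadrilinear_bracket_kernel:
  assumes \<phi>: "linear_form A \<phi>" and c: "c \<in> carrier B"
  shows "quadrilinear A B A B (bracket_kernel \<phi> c)"
  using A.linear_form_mult[OF \<phi>] B.linear_form_mult[OF linear_form_form_left[OF c]]
  by (auto simp: quadrilinear_def bilinear_form_def bracket_kernel_def
      intro!: linear_form_minus linear_form_scale linear_form_scale_right)

lemma lie_bracket_term_closed:
  assumes "a\<^sub>1 \<in> carrier A" "b\<^sub>1 \<in> carrier B" "a\<^sub>2 \<in> carrier A" "b\<^sub>2 \<in> carrier B"
  shows "tens A B (a\<^sub>1 \<star>\<^bsub>A\<^esub> a\<^sub>2) (b\<^sub>1 \<star>\<^bsub>B\<^esub> b\<^sub>2) \<ominus>\<^bsub>A \<boxtimes> B\<^esub> tens A B (a\<^sub>2 \<star>\<^bsub>A\<^esub> a\<^sub>1) (b\<^sub>2 \<star>\<^bsub>B\<^esub> b\<^sub>1)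
    \<in> carrier (A \<boxtimes> B)"
  using assms by (intro vspace_minus_closed[OF vspace_tensor] tens_closed A.prod_closed B.prod_closed)

lemma lie_form_bracket_term:
  assumes "linear_form A \<phi>" "c \<in> carrier B"
    "a\<^sub>1 \<in> carrier A" "b\<^sub>1 \<in> carrier B" "a\<^sub>2 \<in> carrier A" "b\<^sub>2 \<in> carrier B"
  shows "lie_form \<phi> c (tens A B (a\<^sub>1 \<star>\<^bsub>A\<^esub> a\<^sub>2) (b\<^sub>1 \<star>\<^bsub>B\<^esub> b\<^sub>2)
      \<ominus>\<^bsub>A \<boxtimes> B\<^esub> tens A B (a\<^sub>2 \<star>\<^bsub>A\<^esub> a\<^sub>1) (b\<^sub>2 \<star>\<^bsub>B\<^esub> b\<^sub>1)) = bracket_kernel \<phi> c (a\<^sub>1, b\<^sub>1) (a\<^sub>2, b\<^sub>2)"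
  using assms by (simp add: linear_form_diff[OF vspace_tensor linear_form_lie_form] lie_form_tens
      tens_closed A.prod_closed B.prod_closed bracket_kernel_def)

lemma lie_bracket_closed:
  "\<lbrakk>X \<in> carrier (A \<boxtimes> B); Y \<in> carrier (A \<boxtimes> B)\<rbrakk> \<Longrightarrow> X \<star>\<^bsub>L\<^esub> Y \<in> carrier (A \<boxtimes> B)"
  unfolding induced_lie_def using lie_bracket_term_closed
  by (auto intro!: bilinear_ext_in[OF A.vspace B.vspace A.vspace B.vspace vspace_tensor])

lemma lie_form_bracket:
  assumes \<phi>: "linear_form A \<phi>" and c: "c \<in> carrier B"
    and X: "X \<in> carrier (A \<boxtimes> B)" and Y: "Y \<in> carrier (A \<boxtimes> B)"
  shows "lie_form \<phi> c (X \<star>\<^bsub>L\<^esub> Y) = pair_eval (bracket_kernel \<phi> c) X Y"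
  unfolding induced_lie_def
  using lie_bracket_term_closed lie_form_bracket_term[OF \<phi> c]
  by (auto intro!: pair_eval_bilinear_ext[OF A.vspace B.vspace A.vspace B.vspace vspace_tensor X Y]
      linear_form_lie_form \<phi> c)

lemma lie_form_bracket_tens:
  assumes "linear_form A \<phi>" "c \<in> carrier B"
    "a\<^sub>1 \<in> carrier A" "b\<^sub>1 \<in> carrier B" "a\<^sub>2 \<in> carrier A" "b\<^sub>2 \<in> carrier B"
  shows "lie_form \<phi> c (tens A B a\<^sub>1 b\<^sub>1 \<star>\<^bsub>L\<^esub> tens A B a\<^sub>2 b\<^sub>2) =
     \<phi> (a\<^sub>1 \<star>\<^bsub>A\<^esub> a\<^sub>2) * \<omega> (b\<^sub>1 \<star>\<^bsub>B\<^esub> b\<^sub>2) c - \<phi> (a\<^sub>2 \<star>\<^bsub>A\<^esub> a\<^sub>1) * \<omega> (b\<^sub>2 \<star>\<^bsub>B\<^esub> b\<^sub>1) c"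
  using assms quadrilinear_bracket_kernel[of \<phi> c]
  by (simp add: lie_form_bracket tens_closed bracket_kernel_def
      pair_eval_tens[OF A.vspace B.vspace A.vspace B.vspace])

lemma linear_form_bracket:
  assumes \<phi>: "linear_form A \<phi>" and c: "c \<in> carrier B" and Y: "Y \<in> carrier (A \<boxtimes> B)"
  shows linear_form_bracket_left: "linear_form (A \<boxtimes> B) (\<lambda>X. lie_form \<phi> c (X \<star>\<^bsub>L\<^esub> Y))"
    and linear_form_bracket_right: "linear_form (A \<boxtimes> B) (\<lambda>X. lie_form \<phi> c (Y \<star>\<^bsub>L\<^esub> X))"
proof -
  note q = A.vspace B.vspace A.vspace B.vspace quadrilinear_bracket_kernel[OF \<phi> c]
  show "linear_form (A \<boxtimes> B) (\<lambda>X. lie_form \<phi> c (X \<star>\<^bsub>L\<^esub> Y))"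
    by (rule linear_form_cong[OF vspace_tensor linear_form_pair_eval_left[OF q Y] lie_form_bracket[OF \<phi> c _ Y]])
  show "linear_form (A \<boxtimes> B) (\<lambda>X. lie_form \<phi> c (Y \<star>\<^bsub>L\<^esub> X))"
    by (rule linear_form_cong[OF vspace_tensor linear_form_pair_eval_right[OF q Y] lie_form_bracket[OF \<phi> c Y]])
qed

text \<open>
  The bracket of \<open>X\<close> and \<open>Y\<close> is computed from representatives that may involve inhomogeneous elements of
  \<open>B\<close>.  The separating forms show that it may be computed from homogeneous representatives instead, and
  for these the claim is clear.
\<close>

lemma bracket_D:
  assumes X: "X \<in> D i" and Y: "Y \<in> D j"
  shows "X \<star>\<^bsub>L\<^esub> Y \<in> D (i + j)"
proof -
  obtain u where u: "X = tensor_class A B u" "Poly_Mapping.keys u \<subseteq> carrier A \<times> G i"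
    using X by (auto simp: induced_grading_def)
  obtain v where v: "Y = tensor_class A B v" "Poly_Mapping.keys v \<subseteq> carrier A \<times> G j"
    using Y by (auto simp: induced_grading_def)
  have u': "Poly_Mapping.keys u \<subseteq> carrier A \<times> carrier B" and v': "Poly_Mapping.keys v \<subseteq> carrier A \<times> carrier B"
    using u(2) v(2) G_carrier by auto
  have XY: "X \<in> carrier (A \<boxtimes> B)" "Y \<in> carrier (A \<boxtimes> B)" using X Y D_carrier by auto
  define g where "g = (\<lambda>(a\<^sub>1, b\<^sub>1) (a\<^sub>2, b\<^sub>2). tens A B (a\<^sub>1 \<star>\<^bsub>A\<^esub> a\<^sub>2) (b\<^sub>1 \<star>\<^bsub>B\<^esub> b\<^sub>2)
      \<ominus>\<^bsub>A \<boxtimes> B\<^esub> tens A B (a\<^sub>2 \<star>\<^bsub>A\<^esub> a\<^sub>1) (b\<^sub>2 \<star>\<^bsub>B\<^esub> b\<^sub>1))"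
  define h where "h p q = (Poly_Mapping.lookup u p * Poly_Mapping.lookup v q) \<odot>\<^bsub>A \<boxtimes> B\<^esub> g p q" for p q
  define Z where "Z = (\<Oplus>\<^bsub>A \<boxtimes> B\<^esub>p\<in>Poly_Mapping.keys u. \<Oplus>\<^bsub>A \<boxtimes> B\<^esub>q\<in>Poly_Mapping.keys v. h p q)"
  note sub = vspace_tensor[of A B] vspace_D[of "i + j"] D_carrier[of "i + j"]
  have g_D: "g p q \<in> D (i + j)" if pq: "p \<in> Poly_Mapping.keys u" "q \<in> Poly_Mapping.keys v" for p q
  proof -
    obtain a\<^sub>1 b\<^sub>1 a\<^sub>2 b\<^sub>2 where "p = (a\<^sub>1, b\<^sub>1)" "q = (a\<^sub>2, b\<^sub>2)" by (cases p; cases q)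
    moreover from this have "a\<^sub>1 \<in> carrier A" "b\<^sub>1 \<in> G i" "a\<^sub>2 \<in> carrier A" "b\<^sub>2 \<in> G j"
      using pq u(2) v(2) by auto
    ultimately show ?thesis
      using B.G_prod[of b\<^sub>1 i b\<^sub>2 j] B.G_prod[of b\<^sub>2 j b\<^sub>1 i]
      by (auto simp: g_def add.commute intro!: vspace_diff_subspace[OF sub] tens_D A.prod_closed)
  qed
  then have h_D: "h p q \<in> D (i + j)" if "p \<in> Poly_Mapping.keys u" "q \<in> Poly_Mapping.keys v" for p q
    using vspace_smult_closed[OF sub(2)] that by (simp add: h_def)
  have inner: "(\<Oplus>\<^bsub>A \<boxtimes> B\<^esub>q\<in>Poly_Mapping.keys v. h p q) \<in> D (i + j)" if "p \<in> Poly_Mapping.keys u" for p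
    using h_D[OF that] by (intro vspace_finsum_subspace[OF sub]) auto
  have Z_D: "Z \<in> D (i + j)"
    unfolding Z_def using inner by (intro vspace_finsum_subspace[OF sub]) auto
  have "X \<star>\<^bsub>L\<^esub> Y = Z"
  proof (rule separating_eqI[OF vspace_tensor lie_forms_separate lie_bracket_closed[OF XY]])
    show "Z \<in> carrier (A \<boxtimes> B)" using Z_D D_carrier by auto
    fix F assume "F \<in> {lie_form \<phi> b | \<phi> b. linear_form A \<phi> \<and> b \<in> carrier B}"
    then obtain \<phi> c where F: "F = lie_form \<phi> c" and \<phi>: "linear_form A \<phi>" and c: "c \<in> carrier B"
      by blast
    note lin = linear_form_lie_form[OF \<phi> c]
    have "F (g p q) = bracket_kernel \<phi> c p q" if "p \<in> Poly_Mapping.keys u" "q \<in> Poly_Mapping.keys v" for p q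
      using that u' v' lie_form_bracket_term[OF \<phi> c] by (cases p; cases q) (auto simp: g_def F subset_iff)
    then have Fh: "F (h p q) = Poly_Mapping.lookup u p * (Poly_Mapping.lookup v q * bracket_kernel \<phi> c p q)"
      if "p \<in> Poly_Mapping.keys u" "q \<in> Poly_Mapping.keys v" for p q
      using that g_D[OF that] D_carrier by (auto simp: h_def F linear_form_smult[OF lin] subset_iff)
    have "F (X \<star>\<^bsub>L\<^esub> Y) = free_eval (\<lambda>p. free_eval (bracket_kernel \<phi> c p) v) u"
      unfolding F lie_form_bracket[OF \<phi> c XY]
      by (rule pair_eval_class[OF A.vspace B.vspace A.vspace B.vspace
            quadrilinear_bracket_kernel[OF \<phi> c] u(1) u' v(1) v'])
    also have "\<dots> = (\<Sum>p\<in>Poly_Mapping.keys u. \<Sum>q\<in>Poly_Mapping.keys v. F (h p q))"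
      unfolding free_eval_def using Fh by (simp add: sum_distrib_left)
    also have "\<dots> = (\<Sum>p\<in>Poly_Mapping.keys u. F (\<Oplus>\<^bsub>A \<boxtimes> B\<^esub>q\<in>Poly_Mapping.keys v. h p q))"
      unfolding F using h_D subsetD[OF D_carrier[of "i + j"]]
      by (intro sum.cong refl linear_form_finsum[OF vspace_tensor lin, symmetric]) auto
    also have "\<dots> = F Z"
      unfolding F Z_def using inner subsetD[OF D_carrier[of "i + j"]]
      by (intro linear_form_finsum[OF vspace_tensor lin, symmetric]) auto
    finally show "F (X \<star>\<^bsub>L\<^esub> Y) = F Z" .
  qed
  then show ?thesis using Z_D by simp
qed

end

section \<open>Dual homogeneous families\<close>

text \<open>
  Only the values of linear forms at \<open>b\<close> are recorded, which avoids sums in \<open>V\<close>.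
\<close>

lemma linear_form_span:
  fixes V :: "('k::field, 'v) module"
  assumes V: "vspace V" and g: "g ` P \<subseteq> carrier V"
    and b: "b \<in> LinearCombinations.module.span class_ring V (g ` P)"
  shows "\<exists>Q c. finite Q \<and> Q \<subseteq> P \<and> (\<forall>K. linear_form V K \<longrightarrow> K b = (\<Sum>p\<in>Q. c p * K (g p)))"
proof -
  interpret V: vectorspace "class_ring :: 'k ring" V by (rule V)
  obtain a S where S: "finite S" "S \<subseteq> g ` P" and b_eq: "b = V.lincomb a S"
    using b by (auto simp: V.span_def)
  obtain Q where Q: "Q \<subseteq> P" "inj_on g Q" "S = g ` Q"
    using S(2) by (auto simp: subset_image_inj)
  have SV: "S \<subseteq> carrier V" using S(2) g by blast
  have "K b = (\<Sum>p\<in>Q. a (g p) * K (g p))" if K: "linear_form V K" for K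
  proof -
    have "K b = (\<Sum>v\<in>S. K (a v \<odot>\<^bsub>V\<^esub> v))"
      unfolding b_eq V.lincomb_def
      using SV by (intro linear_form_finsum[OF V K]) (auto intro!: vspace_smult_closed[OF V])
    also have "\<dots> = (\<Sum>v\<in>S. a v * K v)"
      using SV by (intro sum.cong refl linear_form_smult[OF K]) auto
    also have "\<dots> = (\<Sum>p\<in>Q. a (g p) * K (g p))"
      unfolding Q(3) by (simp add: sum.reindex[OF Q(2)])
    finally show ?thesis .
  qed
  moreover have "finite Q" using S(1) Q(2,3) finite_imageD by blast
  ultimately show ?thesis using Q(1) by (intro exI[of _ Q] exI[of _ "\<lambda>p. a (g p)"]) auto
qed

text \<open>
  Linear independence of the two spanning families follows from duality.
\<close>

locale dual_families = induced_lie_algebra A B G \<omega> m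
  for A :: "('k::field, 'a) module" and B :: "('k, 'b) module" and G \<omega> m +
  fixes P :: "'p set" and e f :: "'p \<Rightarrow> 'b"
  assumes e_homogeneous: "p \<in> P \<Longrightarrow> \<exists>i. e p \<in> G i"
    and f_homogeneous: "p \<in> P \<Longrightarrow> \<exists>i. f p \<in> G i"
    and e_spans: "LinearCombinations.module.span class_ring B (e ` P) = carrier B"
    and f_spans: "LinearCombinations.module.span class_ring B (f ` P) = carrier B"
    and dual: "\<lbrakk>p \<in> P; q \<in> P\<rbrakk> \<Longrightarrow> \<omega> (e p) (f q) = (if p = q then 1 else 0)"
begin

definition degree_pairs :: "int \<Rightarrow> int \<Rightarrow> 'p set" where
  "degree_pairs i j = {p \<in> P. e p \<in> G i \<and> f p \<in> G j}"

lemma e_carrier: "p \<in> P \<Longrightarrow> e p \<in> carrier B"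
  using e_homogeneous G_carrier by blast

lemma f_carrier: "p \<in> P \<Longrightarrow> f p \<in> carrier B"
  using f_homogeneous G_carrier by blast

lemma swap_dual_families: "dual_families A B G \<omega> m P f e"
  by unfold_locales
    (auto simp: e_homogeneous f_homogeneous e_spans f_spans B.form_sym[OF f_carrier e_carrier] dual)

lemma degree_pairs_degree: "p \<in> degree_pairs i j \<Longrightarrow> i + j + m = 0"
  using form_degree[of i j "e p" "f p"] dual[of p p] by (force simp: degree_pairs_def)

lemma dual_coefficients:
  assumes "b \<in> carrier B"
  obtains Q where "finite Q" "Q \<subseteq> P" "\<And>p. p \<in> P - Q \<Longrightarrow> \<omega> b (f p) = 0"
    "\<And>K. linear_form B K \<Longrightarrow> K b = (\<Sum>p\<in>Q. \<omega> b (f p) * K (e p))"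
proof -
  obtain Q c where Q: "finite Q" "Q \<subseteq> P"
    and c: "\<And>K. linear_form B K \<Longrightarrow> K b = (\<Sum>p\<in>Q. c p * K (e p))"
    using linear_form_span[OF B.vspace, of e P b] e_carrier e_spans assms by (auto simp: image_subset_iff)
  have coeff: "\<omega> b (f q) = (if q \<in> Q then c q else 0)" if q: "q \<in> P" for q
  proof -
    have "\<omega> b (f q) = (\<Sum>p\<in>Q. c p * \<omega> (e p) (f q))"
      by (rule c[OF linear_form_form_left[OF f_carrier[OF q]]])
    also have "\<dots> = (\<Sum>p\<in>Q. if p = q then c q else 0)"
      using Q(2) q by (intro sum.cong) (auto simp: dual)
    finally show ?thesis using Q(1) by simp
  qed
  show ?thesis
  proof (rule that[OF Q])
    fix K assume "linear_form B K"
    then show "K b = (\<Sum>p\<in>Q. \<omega> b (f p) * K (e p))"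
      using c Q(2) by (auto simp: coeff subset_iff intro!: sum.cong)
  qed (auto simp: coeff)
qed

text \<open>
  Each element of a finite set that spans \<open>G i\<close> pairs nontrivially with only finitely many \<open>f p\<close>.  Yet if
  \<open>e p \<in> G i\<close>, then some element of this set does so with \<open>f p\<close>, because \<open>e p\<close> does.
\<close>

lemma finite_degree_pairs: "finite (degree_pairs i j)"
proof -
  let ?Gi = "B\<lparr>carrier := G i\<rparr>"
  interpret Gi: vectorspace "class_ring :: 'k ring" ?Gi
    using B.subspace_is_vs[OF B.G_subspace] .
  obtain T where T: "finite T" "T \<subseteq> G i" "Gi.span T = G i"
    using B.G_fin_dim[of i] by (auto simp: Gi.fin_dim_def)
  have "\<exists>Q. finite Q \<and> (\<forall>p\<in>P - Q. \<omega> t (f p) = 0)" if "t \<in> T" for t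
    using dual_coefficients[of t] that T(2) G_carrier by (metis subsetD)
  then obtain Q where Q: "\<And>t. t \<in> T \<Longrightarrow> finite (Q t)" "\<And>t p. \<lbrakk>t \<in> T; p \<in> P - Q t\<rbrakk> \<Longrightarrow> \<omega> t (f p) = 0"
    by metis
  have "p \<in> (\<Union>t\<in>T. Q t)" if p: "p \<in> degree_pairs i j" for p
  proof (rule ccontr)
    assume no: "p \<notin> (\<Union>t\<in>T. Q t)"
    have pP: "p \<in> P" "e p \<in> G i" using p by (auto simp: degree_pairs_def)
    have lin: "linear_form ?Gi (\<lambda>b. \<omega> b (f p))"
      using G_carrier by (intro linear_form_subset linear_form_form_left f_carrier pP) auto
    obtain S c where "S \<subseteq> T" "\<omega> (e p) (f p) = (\<Sum>t\<in>S. c t * \<omega> t (f p))"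
      using linear_form_span[of ?Gi "\<lambda>t. t" T "e p"] Gi.vectorspace_axioms T pP lin by auto
    moreover have "\<omega> t (f p) = 0" if "t \<in> T" for t using Q(2)[OF that] no pP that by blast
    ultimately have "\<omega> (e p) (f p) = 0" by (auto intro!: sum.neutral)
    then show False using dual[OF pP(1) pP(1)] by simp
  qed
  moreover have "finite (\<Union>t\<in>T. Q t)" using T(1) Q(1) by blast
  ultimately show ?thesis by (meson finite_subset subsetI)
qed

text \<open>
  This is \<open>\<Sum>\<^sub>p (f\<^sub>p, b) e\<^sub>p = b\<close>, seen through a linear form.  For \<open>b\<close> of degree \<open>i\<close> only the \<open>f\<^sub>p\<close> of degree
  \<open>j = - i - m\<close> contribute, and then \<open>e\<^sub>p\<close> has degree \<open>i\<close>.
\<close>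

lemma dual_expansion:
  assumes b: "b \<in> G i" and ij: "i + j + m = 0" and K: "linear_form B K"
  shows "(\<Sum>p\<in>degree_pairs i j. \<omega> (f p) b * K (e p)) = K b"
proof -
  obtain Q where Q: "finite Q" "Q \<subseteq> P" "\<And>p. p \<in> P - Q \<Longrightarrow> \<omega> b (f p) = 0"
    "K b = (\<Sum>p\<in>Q. \<omega> b (f p) * K (e p))"
    using dual_coefficients[OF G_carrier[OF b]] K by metis
  have zero: "\<omega> b (f p) = 0" if p: "p \<in> P" "p \<notin> degree_pairs i j" for p
  proof (rule ccontr)
    assume nz: "\<omega> b (f p) \<noteq> 0"
    obtain i' j' where h: "e p \<in> G i'" "f p \<in> G j'" using p e_homogeneous f_homogeneous by blast
    then have "i + j' + m = 0" "i' + j' + m = 0"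
      using form_degree[OF _ b h(2)] form_degree[OF _ h] nz dual[OF p(1) p(1)] by auto
    then have "i' = i" "j' = j" using ij by linarith+
    then show False using p h by (auto simp: degree_pairs_def)
  qed
  have "(\<Sum>p\<in>degree_pairs i j. \<omega> (f p) b * K (e p)) = (\<Sum>p\<in>degree_pairs i j. \<omega> b (f p) * K (e p))"
    using b G_carrier f_carrier by (intro sum.cong refl) (simp add: degree_pairs_def B.form_sym)
  also have "\<dots> = (\<Sum>p\<in>Q. \<omega> b (f p) * K (e p))"
    using Q(1-3) zero by (intro sum.mono_neutral_cong finite_degree_pairs) (auto simp: degree_pairs_def)
  finally show ?thesis using Q(4) by simp
qed

lemma dual_expansion_swapped:
  assumes b: "b \<in> G j" and ij: "i + j + m = 0" and K: "linear_form B K"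
  shows "(\<Sum>p\<in>degree_pairs i j. \<omega> (e p) b * K (f p)) = K b"
proof -
  interpret swap: dual_families A B G \<omega> m P f e by (rule swap_dual_families)
  have "swap.degree_pairs j i = degree_pairs i j"
    by (auto simp: swap.degree_pairs_def degree_pairs_def)
  then show ?thesis using swap.dual_expansion[OF b _ K, of i] ij by (simp add: algebra_simps)
qed

end

section \<open>Components of the classical Yang--Baxter equation\<close>

text \<open>
  In the brackets of a tensor on an antidiagonal, at most one pair of degrees contributes to each
  component.  The index is allowed to be absent, since the pairs with a vanishing factor are excluded
  from the sum.
\<close>

lemma linear_form_finsum_unique_index:
  assumes Z: "vspace Z" and F: "linear_form Z F" and h: "\<And>i. i \<in> S \<Longrightarrow> h i \<in> carrier Z"
    and S: "S \<subseteq> {i}" and "i \<in> S \<Longrightarrow> F (h i) = c" and "i \<notin> S \<Longrightarrow> c = 0"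
  shows "F (finsum Z h S) = c"
proof -
  have "F (finsum Z h S) = (\<Sum>i\<in>S. F (h i))"
    using h by (intro linear_form_finsum[OF Z F]) auto
  also have "S = {} \<or> S = {i}" using S by blast
  then have "(\<Sum>i\<in>S. F (h i)) = c" using assms(5,6) by auto
  finally show ?thesis .
qed

context induced_lie_algebra
begin

text \<open>
  The three brackets of the classical Yang--Baxter equation, seen through linear forms on the three
  tensor factors.
\<close>

definition kernel_12_13 where
  "kernel_12_13 F\<^sub>1 F\<^sub>2 F\<^sub>3 = (\<lambda>(a, b) (a', b'). F\<^sub>1 (a \<star>\<^bsub>L\<^esub> a') * F\<^sub>2 b * F\<^sub>3 b')"

definition kernel_12_23 where
  "kernel_12_23 F\<^sub>1 F\<^sub>2 F\<^sub>3 = (\<lambda>(a, b) (a', b'). F\<^sub>1 a * F\<^sub>2 (b \<star>\<^bsub>L\<^esub> a') * F\<^sub>3 b')"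

definition kernel_13_23 where
  "kernel_13_23 F\<^sub>1 F\<^sub>2 F\<^sub>3 = (\<lambda>(a, b) (a', b'). F\<^sub>1 a * F\<^sub>2 a' * F\<^sub>3 (b \<star>\<^bsub>L\<^esub> b'))"

definition lie_forms :: "(('a \<times> 'b \<Rightarrow>\<^sub>0 'k) set \<Rightarrow> 'k) set" where
  "lie_forms = {lie_form \<phi> b | \<phi> b. linear_form A \<phi> \<and> b \<in> carrier B}"

lemma lie_forms_linear: "F \<in> lie_forms \<Longrightarrow> linear_form (homog L D i) F"
  by (auto simp: lie_forms_def intro: linear_form_homog linear_form_lie_form)

lemma lie_forms_bracket:
  assumes "F \<in> lie_forms" "Y \<in> D j"
  shows "linear_form (homog L D i) (\<lambda>X. F (X \<star>\<^bsub>L\<^esub> Y))" "linear_form (homog L D i) (\<lambda>X. F (Y \<star>\<^bsub>L\<^esub> X))"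
  using assms D_carrier[of j]
  by (auto simp: lie_forms_def intro!: linear_form_homog linear_form_bracket)

context
  fixes F\<^sub>1 F\<^sub>2 F\<^sub>3 assumes F: "F\<^sub>1 \<in> lie_forms" "F\<^sub>2 \<in> lie_forms" "F\<^sub>3 \<in> lie_forms"
begin

lemma quadrilinear_kernels:
  "quadrilinear (homog L D i) (homog L D j) (homog L D k) (homog L D l) (kernel_12_13 F\<^sub>1 F\<^sub>2 F\<^sub>3)"
  "quadrilinear (homog L D i) (homog L D j) (homog L D k) (homog L D l) (kernel_12_23 F\<^sub>1 F\<^sub>2 F\<^sub>3)"
  "quadrilinear (homog L D i) (homog L D j) (homog L D k) (homog L D l) (kernel_13_23 F\<^sub>1 F\<^sub>2 F\<^sub>3)"
  using lie_forms_linear[OF F(1)] lie_forms_linear[OF F(2)] lie_forms_linear[OF F(3)]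
    lie_forms_bracket[OF F(1)] lie_forms_bracket[OF F(2)] lie_forms_bracket[OF F(3)]
  by (auto simp: quadrilinear_def bilinear_form_def kernel_12_13_def kernel_12_23_def kernel_13_23_def
      intro!: linear_form_scale linear_form_scale_right)

context
  fixes r assumes r: "\<And>i j. r i j \<in> carrier (homog2 L D i j)"
    and antidiag: "\<And>i j. i + j + m \<noteq> 0 \<Longrightarrow> r i j = \<zero>\<^bsub>homog2 L D i j\<^esub>"
begin

lemma pair_eval_zero:
  assumes "quadrilinear (homog L D i) (homog L D j) (homog L D k) (homog L D l) H"
    and "r i j = \<zero>\<^bsub>homog2 L D i j\<^esub> \<or> r k l = \<zero>\<^bsub>homog2 L D k l\<^esub>"
  shows "pair_eval H (r i j) (r k l) = 0"
  using assms(2)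
    linear_form_zero[OF vspace_tensor linear_form_pair_eval_left[OF vspace_homog vspace_homog vspace_homog vspace_homog assms(1) r]]
    linear_form_zero[OF vspace_tensor linear_form_pair_eval_right[OF vspace_homog vspace_homog vspace_homog vspace_homog assms(1) r]]
  by auto

text \<open>
  The common pattern of the three brackets: \<open>s\<close> is the summation index, and \<open>i s\<close>, \<open>j s\<close>, \<open>k s\<close>, \<open>l s\<close> are
  the degrees of the four tensor factors involved.
\<close>

lemma form_bracket_component:
  fixes i j k l :: "int \<Rightarrow> int"
  assumes Z: "vspace Z" and \<Phi>: "linear_form Z \<Phi>"
    and H: "\<And>s. quadrilinear (homog L D (i s)) (homog L D (j s)) (homog L D (k s)) (homog L D (l s)) H"
    and g: "\<And>s a b a' b'. \<lbrakk>a \<in> D (i s); b \<in> D (j s); a' \<in> D (k s); b' \<in> D (l s)\<rbrakk> \<Longrightarrow>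
      g (a, b) (a', b') \<in> carrier Z \<and> \<Phi> (g (a, b) (a', b')) = H (a, b) (a', b')"
    and unique: "\<And>s. \<lbrakk>i s + j s + m = 0; k s + l s + m = 0\<rbrakk> \<Longrightarrow> s = t"
  defines "S \<equiv> {s. r (i s) (j s) \<noteq> \<zero>\<^bsub>homog2 L D (i s) (j s)\<^esub> \<and> r (k s) (l s) \<noteq> \<zero>\<^bsub>homog2 L D (k s) (l s)\<^esub>}"
  shows "(\<Oplus>\<^bsub>Z\<^esub>s\<in>S. bilinear_ext Z g (r (i s) (j s)) (r (k s) (l s))) \<in> carrier Z \<and>
    \<Phi> (\<Oplus>\<^bsub>Z\<^esub>s\<in>S. bilinear_ext Z g (r (i s) (j s)) (r (k s) (l s))) =
      (if i t + j t + m = 0 \<and> k t + l t + m = 0 then pair_eval H (r (i t) (j t)) (r (k t) (l t)) else 0)"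
    (is "finsum Z ?h S \<in> _ \<and> _ = ?c")
proof
  have h: "?h s \<in> carrier Z" for s
    by (rule bilinear_ext_in[where V = "homog L D (i s)" and W = "homog L D (j s)"
          and V' = "homog L D (k s)" and W' = "homog L D (l s)"])
      (use g[of _ s] in \<open>simp_all add: vspace_homog Z r\<close>)
  have \<Phi>h: "\<Phi> (?h s) = pair_eval H (r (i s) (j s)) (r (k s) (l s))" for s
    by (rule pair_eval_bilinear_ext[where V = "homog L D (i s)" and W = "homog L D (j s)"
          and V' = "homog L D (k s)" and W' = "homog L D (l s)"])
      (use g[of _ s] in \<open>simp_all add: vspace_homog Z r \<Phi>\<close>)
  have in_S: "i s + j s + m = 0 \<and> k s + l s + m = 0" if "s \<in> S" for s
    using that antidiag[of "i s" "j s"] antidiag[of "k s" "l s"] by (auto simp: S_def)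
  show "finsum Z ?h S \<in> carrier Z"
    using h by (intro vspace_finsum_closed[OF Z]) auto
  show "\<Phi> (finsum Z ?h S) = ?c"
  proof (rule linear_form_finsum_unique_index[OF Z \<Phi> h])
    show "S \<subseteq> {t}" using in_S unique by blast
    show "\<Phi> (?h t) = ?c" if "t \<in> S" using in_S[OF that] by (simp add: \<Phi>h)
    show "?c = 0" if "t \<notin> S" using that pair_eval_zero[OF H[of t]] by (auto simp: S_def)
  qed
qed

lemma form_bracket_12_13:
  "bracket_12_13 L D r n j l \<in> carrier (homog3 L D n j l) \<and>
   tensor_form3 F\<^sub>1 F\<^sub>2 F\<^sub>3 (bracket_12_13 L D r n j l) =
     (if n + j + l + 2 * m = 0 then pair_eval (kernel_12_13 F\<^sub>1 F\<^sub>2 F\<^sub>3) (r (- j - m) j) (r (- l - m) l) else 0)"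
proof -
  let ?Z = "homog3 L D n j l" and ?F = "tensor_form3 F\<^sub>1 F\<^sub>2 F\<^sub>3"
  let ?g = "\<lambda>(a, b) (a', b'). tens3 (homog L D n) (homog L D j) (homog L D l) (a \<star>\<^bsub>L\<^esub> a') b b'"
  have lin: "linear_form ?Z ?F" by (intro linear_form_tensor_form3 lie_forms_linear F)
  have g: "?g (a, b) (a', b') \<in> carrier ?Z \<and> ?F (?g (a, b) (a', b')) = kernel_12_13 F\<^sub>1 F\<^sub>2 F\<^sub>3 (a, b) (a', b')"
    if "a \<in> D ((\<lambda>s. s) s)" "b \<in> D ((\<lambda>s. j) s)" "a' \<in> D ((\<lambda>s. n - s) s)" "b' \<in> D ((\<lambda>s. l) s)" for s a b a' b'
    using that bracket_D[of a s a' "n - s"]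
    by (auto simp: kernel_12_13_def tensor_form3_tens3 lie_forms_linear F intro!: tens3_closed)
  have eq: "n - (- j - m) = - l - m" if "n + j + l + 2 * m = 0" using that by simp
  have val: "(if n + j + l + 2 * m = 0 then pair_eval (kernel_12_13 F\<^sub>1 F\<^sub>2 F\<^sub>3) (r (- j - m) j) (r (- l - m) l) else 0) =
    (if ((- j - m)) + (j) + m = 0 \<and> (n - (- j - m)) + (l) + m = 0 then
      pair_eval (kernel_12_13 F\<^sub>1 F\<^sub>2 F\<^sub>3) (r ((- j - m)) (j)) (r (n - (- j - m)) (l)) else 0)"
  proof (cases "n + j + l + 2 * m = 0")
    case True
    show ?thesis unfolding eq[OF True] using True by simp
  qed auto
  show ?thesis
    unfolding bracket_12_13_def val
    by (rule form_bracket_component[where i = "\<lambda>s. s" and j = "\<lambda>s. j" and k = "\<lambda>s. n - s" and l = "\<lambda>s. l" and t = "- j - m",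
        OF vspace_tensor lin quadrilinear_kernels(1)]) (rule g, assumption+, simp)
qed

lemma form_bracket_12_23:
  "bracket_12_23 L D r i n l \<in> carrier (homog3 L D i n l) \<and>
   tensor_form3 F\<^sub>1 F\<^sub>2 F\<^sub>3 (bracket_12_23 L D r i n l) =
     (if i + n + l + 2 * m = 0 then pair_eval (kernel_12_23 F\<^sub>1 F\<^sub>2 F\<^sub>3) (r i (- i - m)) (r (- l - m) l) else 0)"
proof -
  let ?Z = "homog3 L D i n l" and ?F = "tensor_form3 F\<^sub>1 F\<^sub>2 F\<^sub>3"
  let ?g = "\<lambda>(a, b) (a', b'). tens3 (homog L D i) (homog L D n) (homog L D l) a (b \<star>\<^bsub>L\<^esub> a') b'"
  have lin: "linear_form ?Z ?F" by (intro linear_form_tensor_form3 lie_forms_linear F)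
  have g: "?g (a, b) (a', b') \<in> carrier ?Z \<and> ?F (?g (a, b) (a', b')) = kernel_12_23 F\<^sub>1 F\<^sub>2 F\<^sub>3 (a, b) (a', b')"
    if "a \<in> D ((\<lambda>s. i) s)" "b \<in> D ((\<lambda>s. s) s)" "a' \<in> D ((\<lambda>s. n - s) s)" "b' \<in> D ((\<lambda>s. l) s)" for s a b a' b'
    using that bracket_D[of b s a' "n - s"]
    by (auto simp: kernel_12_23_def tensor_form3_tens3 lie_forms_linear F intro!: tens3_closed)
  have eq: "n - (- i - m) = - l - m" if "i + n + l + 2 * m = 0" using that by simp
  have val: "(if i + n + l + 2 * m = 0 then pair_eval (kernel_12_23 F\<^sub>1 F\<^sub>2 F\<^sub>3) (r i (- i - m)) (r (- l - m) l) else 0) =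
    (if (i) + ((- i - m)) + m = 0 \<and> (n - (- i - m)) + (l) + m = 0 then
      pair_eval (kernel_12_23 F\<^sub>1 F\<^sub>2 F\<^sub>3) (r (i) ((- i - m))) (r (n - (- i - m)) (l)) else 0)"
  proof (cases "i + n + l + 2 * m = 0")
    case True
    show ?thesis unfolding eq[OF True] using True by simp
  qed auto
  show ?thesis
    unfolding bracket_12_23_def val
    by (rule form_bracket_component[where i = "\<lambda>s. i" and j = "\<lambda>s. s" and k = "\<lambda>s. n - s" and l = "\<lambda>s. l" and t = "- i - m",
        OF vspace_tensor lin quadrilinear_kernels(2)]) (rule g, assumption+, simp)
qed

lemma form_bracket_13_23:
  "bracket_13_23 L D r i k n \<in> carrier (homog3 L D i k n) \<and>
   tensor_form3 F\<^sub>1 F\<^sub>2 F\<^sub>3 (bracket_13_23 L D r i k n) =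
     (if i + k + n + 2 * m = 0 then pair_eval (kernel_13_23 F\<^sub>1 F\<^sub>2 F\<^sub>3) (r i (- i - m)) (r k (- k - m)) else 0)"
proof -
  let ?Z = "homog3 L D i k n" and ?F = "tensor_form3 F\<^sub>1 F\<^sub>2 F\<^sub>3"
  let ?g = "\<lambda>(a, b) (a', b'). tens3 (homog L D i) (homog L D k) (homog L D n) a a' (b \<star>\<^bsub>L\<^esub> b')"
  have lin: "linear_form ?Z ?F" by (intro linear_form_tensor_form3 lie_forms_linear F)
  have g: "?g (a, b) (a', b') \<in> carrier ?Z \<and> ?F (?g (a, b) (a', b')) = kernel_13_23 F\<^sub>1 F\<^sub>2 F\<^sub>3 (a, b) (a', b')"
    if "a \<in> D ((\<lambda>s. i) s)" "b \<in> D ((\<lambda>s. s) s)" "a' \<in> D ((\<lambda>s. k) s)" "b' \<in> D ((\<lambda>s. n - s) s)" for s a b a' b'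
    using that bracket_D[of b s b' "n - s"]
    by (auto simp: kernel_13_23_def tensor_form3_tens3 lie_forms_linear F intro!: tens3_closed)
  have eq: "n - (- i - m) = - k - m" if "i + k + n + 2 * m = 0" using that by simp
  have val: "(if i + k + n + 2 * m = 0 then pair_eval (kernel_13_23 F\<^sub>1 F\<^sub>2 F\<^sub>3) (r i (- i - m)) (r k (- k - m)) else 0) =
    (if (i) + ((- i - m)) + m = 0 \<and> (k) + (n - (- i - m)) + m = 0 then
      pair_eval (kernel_13_23 F\<^sub>1 F\<^sub>2 F\<^sub>3) (r (i) ((- i - m))) (r (k) (n - (- i - m))) else 0)"
  proof (cases "i + k + n + 2 * m = 0")
    case True
    show ?thesis unfolding eq[OF True] using True by simp
  qed auto
  show ?thesis
    unfolding bracket_13_23_def val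
    by (rule form_bracket_component[where i = "\<lambda>s. i" and j = "\<lambda>s. s" and k = "\<lambda>s. k" and l = "\<lambda>s. n - s" and t = "- i - m",
        OF vspace_tensor lin quadrilinear_kernels(3)]) (rule g, assumption+, simp)
qed

end
end
end

section \<open>Lifting a tensor\<close>

locale lifted_tensor = dual_families A B G \<omega> m P e f
  for A :: "('k::field, 'a) module" and B :: "('k, 'b) module" and G \<omega> m
    and P :: "'p set" and e f :: "'p \<Rightarrow> 'b" +
  fixes I :: "'i set" and x y :: "'i \<Rightarrow> 'a"
  assumes finite_I: "finite I" and x_closed: "x \<in> I \<rightarrow> carrier A" and y_closed: "y \<in> I \<rightarrow> carrier A"
begin

abbreviation rA where "rA \<equiv> \<Oplus>\<^bsub>A \<boxtimes> A\<^esub>\<alpha>\<in>I. tens A A (x \<alpha>) (y \<alpha>)"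
abbreviation rL where "rL \<equiv> lie_lift A B G I x y P e f"

lemma xy: "\<alpha> \<in> I \<Longrightarrow> x \<alpha> \<in> carrier A" "\<alpha> \<in> I \<Longrightarrow> y \<alpha> \<in> carrier A"
  using x_closed y_closed by auto

text \<open>
  The values of \<open>\<phi> \<otimes> \<psi>\<close> on \<open>r\<close>, and of \<open>\<phi>\<^sub>1 \<otimes> \<phi>\<^sub>2 \<otimes> \<phi>\<^sub>3\<close> on the left-hand side of the Novikov Yang--Baxter
  equation for \<open>r\<close> (\<open>skew_NYBE_solution_iff\<close> below).
\<close>

definition pairing :: "('a \<Rightarrow> 'k) \<Rightarrow> ('a \<Rightarrow> 'k) \<Rightarrow> 'k" where
  "pairing \<phi> \<psi> = (\<Sum>\<alpha>\<in>I. \<phi> (x \<alpha>) * \<psi> (y \<alpha>))"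

definition nybe_form :: "('a \<Rightarrow> 'k) \<Rightarrow> ('a \<Rightarrow> 'k) \<Rightarrow> ('a \<Rightarrow> 'k) \<Rightarrow> 'k" where
  "nybe_form \<phi>\<^sub>1 \<phi>\<^sub>2 \<phi>\<^sub>3 = (\<Sum>\<alpha>\<in>I. \<Sum>\<beta>\<in>I.
     \<phi>\<^sub>1 (x \<alpha>) * \<phi>\<^sub>2 (x \<beta>) * \<phi>\<^sub>3 (y \<alpha> \<star>\<^bsub>A\<^esub> y \<beta>)
     + \<phi>\<^sub>1 (x \<alpha>) * (\<phi>\<^sub>2 (y \<alpha> \<star>\<^bsub>A\<^esub> x \<beta>) + \<phi>\<^sub>2 (x \<beta> \<star>\<^bsub>A\<^esub> y \<alpha>)) * \<phi>\<^sub>3 (y \<beta>)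
     + \<phi>\<^sub>1 (x \<alpha> \<star>\<^bsub>A\<^esub> x \<beta>) * \<phi>\<^sub>2 (y \<beta>) * \<phi>\<^sub>3 (y \<alpha>))"

lemma rA_closed: "rA \<in> carrier (A \<boxtimes> A)"
  using xy by (intro vspace_finsum_closed[OF vspace_tensor]) (auto intro: tens_closed)

lemma linear_form_rA:
  "linear_form (A \<boxtimes> A) F \<Longrightarrow> F rA = (\<Sum>\<alpha>\<in>I. F (tens A A (x \<alpha>) (y \<alpha>)))"
  using xy by (intro linear_form_finsum[OF vspace_tensor]) (auto intro: tens_closed)

lemma pair_eval_rA:
  assumes H: "quadrilinear A A A A H"
  shows "pair_eval H rA rA = (\<Sum>\<alpha>\<in>I. \<Sum>\<beta>\<in>I. H (x \<alpha>, y \<alpha>) (x \<beta>, y \<beta>))"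
proof -
  note q = A.vspace A.vspace A.vspace A.vspace H
  have "pair_eval H rA rA = (\<Sum>\<alpha>\<in>I. pair_eval H (tens A A (x \<alpha>) (y \<alpha>)) rA)"
    by (rule linear_form_rA[OF linear_form_pair_eval_left[OF q rA_closed]])
  also have "\<dots> = (\<Sum>\<alpha>\<in>I. \<Sum>\<beta>\<in>I. pair_eval H (tens A A (x \<alpha>) (y \<alpha>)) (tens A A (x \<beta>) (y \<beta>)))"
    using xy by (intro sum.cong refl linear_form_rA linear_form_pair_eval_right[OF q] tens_closed)
  also have "\<dots> = (\<Sum>\<alpha>\<in>I. \<Sum>\<beta>\<in>I. H (x \<alpha>, y \<alpha>) (x \<beta>, y \<beta>))"
    using xy by (intro sum.cong refl pair_eval_tens[OF q])
  finally show ?thesis .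
qed

lemma NYBE_lhs_form:
  assumes l: "linear_form A \<phi>\<^sub>1" "linear_form A \<phi>\<^sub>2" "linear_form A \<phi>\<^sub>3"
  shows "NYBE_lhs A rA \<in> carrier (A \<boxtimes> A \<boxtimes> A)"
    and "tensor_form3 \<phi>\<^sub>1 \<phi>\<^sub>2 \<phi>\<^sub>3 (NYBE_lhs A rA) = nybe_form \<phi>\<^sub>1 \<phi>\<^sub>2 \<phi>\<^sub>3"
proof -
  define H where "H = (\<lambda>(x, y) (x', y').
     \<phi>\<^sub>1 x * \<phi>\<^sub>2 x' * \<phi>\<^sub>3 (y \<star>\<^bsub>A\<^esub> y') + \<phi>\<^sub>1 x * (\<phi>\<^sub>2 (y \<star>\<^bsub>A\<^esub> x') + \<phi>\<^sub>2 (x' \<star>\<^bsub>A\<^esub> y)) * \<phi>\<^sub>3 y'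
     + \<phi>\<^sub>1 (x \<star>\<^bsub>A\<^esub> x') * \<phi>\<^sub>2 y' * \<phi>\<^sub>3 y)"
  note lin = linear_form_tensor_form3[OF l]
  have H: "quadrilinear A A A A H"
    using l A.linear_form_mult[OF l(1)] A.linear_form_mult[OF l(2)] A.linear_form_mult[OF l(3)]
    by (auto simp: quadrilinear_def bilinear_form_def H_def
        intro!: linear_form_plus linear_form_scale linear_form_scale_right)
  note cl = tens3_closed A.prod_closed vspace_add_closed[OF vspace_tensor] vspace_add_closed[OF A.vspace]
  show "NYBE_lhs A rA \<in> carrier (A \<boxtimes> A \<boxtimes> A)"
    unfolding NYBE_lhs_def
    by (rule bilinear_ext_in[OF A.vspace A.vspace A.vspace A.vspace vspace_tensor rA_closed rA_closed])
      (auto intro!: cl)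
  have "tensor_form3 \<phi>\<^sub>1 \<phi>\<^sub>2 \<phi>\<^sub>3 (NYBE_lhs A rA) = pair_eval H rA rA"
    unfolding NYBE_lhs_def
    by (rule pair_eval_bilinear_ext[OF A.vspace A.vspace A.vspace A.vspace vspace_tensor
        rA_closed rA_closed _ lin])
      (auto simp: H_def linear_form_add[OF lin] tensor_form3_tens3 linear_form_add[OF l(2)] l cl
        intro!: cl)
  then show "tensor_form3 \<phi>\<^sub>1 \<phi>\<^sub>2 \<phi>\<^sub>3 (NYBE_lhs A rA) = nybe_form \<phi>\<^sub>1 \<phi>\<^sub>2 \<phi>\<^sub>3"
    unfolding pair_eval_rA[OF H] nybe_form_def by (simp add: H_def)
qed

lemma skew_NYBE_solution_iff:
  "skew_NYBE_solution A rA \<longleftrightarrow>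
    (\<forall>\<phi> \<psi>. linear_form A \<phi> \<longrightarrow> linear_form A \<psi> \<longrightarrow> pairing \<psi> \<phi> = - pairing \<phi> \<psi>) \<and>
    (\<forall>\<phi>\<^sub>1 \<phi>\<^sub>2 \<phi>\<^sub>3. linear_form A \<phi>\<^sub>1 \<longrightarrow> linear_form A \<phi>\<^sub>2 \<longrightarrow> linear_form A \<phi>\<^sub>3 \<longrightarrow>
      nybe_form \<phi>\<^sub>1 \<phi>\<^sub>2 \<phi>\<^sub>3 = 0)"
proof -
  have pair: "tensor_form \<phi> \<psi> rA = pairing \<phi> \<psi>" if "linear_form A \<phi>" "linear_form A \<psi>" for \<phi> \<psi>
    using linear_form_rA[OF linear_form_tensor_form[OF that]]
    by (simp add: tensor_form_tens that pairing_def)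
  have skew: "flip rA = \<ominus>\<^bsub>A \<boxtimes> A\<^esub> rA \<longleftrightarrow>
    (\<forall>\<phi> \<psi>. linear_form A \<phi> \<longrightarrow> linear_form A \<psi> \<longrightarrow> pairing \<psi> \<phi> = - pairing \<phi> \<psi>)"
    unfolding flip_eq_uminus_iff[OF A.vspace A.vspace A_separating A_separating rA_closed rA_closed]
    by (auto simp: pair)
  have "NYBE_lhs A rA \<in> carrier (A \<boxtimes> A \<boxtimes> A)"
    by (rule NYBE_lhs_form linear_form_zero_fun)+
  then have "NYBE_lhs A rA = \<zero>\<^bsub>A \<boxtimes> A \<boxtimes> A\<^esub> \<longleftrightarrow>
    (\<forall>F\<in>{tensor_form3 \<phi> \<psi> \<theta> | \<phi> \<psi> \<theta>. \<phi> \<in> {\<phi>. linear_form A \<phi>} \<and> \<psi> \<in> {\<phi>. linear_form A \<phi>} \<and>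
      \<theta> \<in> {\<phi>. linear_form A \<phi>}}. F (NYBE_lhs A rA) = 0)"
    by (rule eq_zero_iff_forms[OF vspace_tensor separating_tensor3[OF A.vspace A.vspace A.vspace
          A_separating A_separating A_separating]])
  also have "\<dots> \<longleftrightarrow> (\<forall>\<phi> \<psi> \<theta>. linear_form A \<phi> \<longrightarrow> linear_form A \<psi> \<longrightarrow> linear_form A \<theta> \<longrightarrow>
      tensor_form3 \<phi> \<psi> \<theta> (NYBE_lhs A rA) = 0)"
    by blast
  also have "\<dots> \<longleftrightarrow>
    (\<forall>\<phi>\<^sub>1 \<phi>\<^sub>2 \<phi>\<^sub>3. linear_form A \<phi>\<^sub>1 \<longrightarrow> linear_form A \<phi>\<^sub>2 \<longrightarrow> linear_form A \<phi>\<^sub>3 \<longrightarrow>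
      nybe_form \<phi>\<^sub>1 \<phi>\<^sub>2 \<phi>\<^sub>3 = 0)"
    by (simp add: NYBE_lhs_form(2) cong: imp_cong)
  finally have "NYBE_lhs A rA = \<zero>\<^bsub>A \<boxtimes> A \<boxtimes> A\<^esub> \<longleftrightarrow>
    (\<forall>\<phi>\<^sub>1 \<phi>\<^sub>2 \<phi>\<^sub>3. linear_form A \<phi>\<^sub>1 \<longrightarrow> linear_form A \<phi>\<^sub>2 \<longrightarrow> linear_form A \<phi>\<^sub>3 \<longrightarrow>
      nybe_form \<phi>\<^sub>1 \<phi>\<^sub>2 \<phi>\<^sub>3 = 0)" .
  then show ?thesis using rA_closed skew by (simp add: skew_NYBE_solution_def)
qed

lemma lift_term_closed:
  "\<lbrakk>p \<in> degree_pairs i j; \<alpha> \<in> I\<rbrakk> \<Longrightarrow>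
    tens A B (x \<alpha>) (e p) \<in> D i \<and> tens A B (y \<alpha>) (f p) \<in> D j"
  using xy by (auto simp: degree_pairs_def intro: tens_D)

lemma rL_eq: "rL i j = (\<Oplus>\<^bsub>homog2 L D i j\<^esub>p\<in>degree_pairs i j. \<Oplus>\<^bsub>homog2 L D i j\<^esub>\<alpha>\<in>I.
    tens (homog L D i) (homog L D j) (tens A B (x \<alpha>) (e p)) (tens A B (y \<alpha>) (f p)))"
  by (simp add: lie_lift_def Let_def degree_pairs_def)

lemma lift_inner_closed:
  "p \<in> degree_pairs i j \<Longrightarrow> (\<Oplus>\<^bsub>homog2 L D i j\<^esub>\<alpha>\<in>I.
    tens (homog L D i) (homog L D j) (tens A B (x \<alpha>) (e p)) (tens A B (y \<alpha>) (f p))) \<in> carrier (homog2 L D i j)"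
  using lift_term_closed by (intro vspace_finsum_closed[OF vspace_tensor]) (auto intro!: tens_closed)

lemma rL_closed: "rL i j \<in> carrier (homog2 L D i j)"
  unfolding rL_eq using lift_inner_closed by (intro vspace_finsum_closed[OF vspace_tensor]) auto

lemma linear_form_rL:
  assumes F: "linear_form (homog2 L D i j) F"
  shows "F (rL i j) = (\<Sum>p\<in>degree_pairs i j. \<Sum>\<alpha>\<in>I.
    F (tens (homog L D i) (homog L D j) (tens A B (x \<alpha>) (e p)) (tens A B (y \<alpha>) (f p))))"
proof -
  have "F (rL i j) = (\<Sum>p\<in>degree_pairs i j. F (\<Oplus>\<^bsub>homog2 L D i j\<^esub>\<alpha>\<in>I.
    tens (homog L D i) (homog L D j) (tens A B (x \<alpha>) (e p)) (tens A B (y \<alpha>) (f p))))"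
    unfolding rL_eq using lift_inner_closed by (intro linear_form_finsum[OF vspace_tensor F]) auto
  also have "\<dots> = (\<Sum>p\<in>degree_pairs i j. \<Sum>\<alpha>\<in>I.
    F (tens (homog L D i) (homog L D j) (tens A B (x \<alpha>) (e p)) (tens A B (y \<alpha>) (f p))))"
    using lift_term_closed
    by (intro sum.cong refl linear_form_finsum[OF vspace_tensor F]) (auto intro!: tens_closed)
  finally show ?thesis .
qed

lemma rL_antidiagonal: "i + j + m \<noteq> 0 \<Longrightarrow> rL i j = \<zero>\<^bsub>homog2 L D i j\<^esub>"
proof -
  interpret Z: vectorspace "class_ring :: 'k ring" "homog2 L D i j" by (rule vspace_tensor)
  assume "i + j + m \<noteq> 0"
  then have "degree_pairs i j = {}" using degree_pairs_degree by blast
  then show ?thesis unfolding rL_eq by simp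
qed

lemma pair_eval_rL:
  assumes H: "quadrilinear (homog L D i) (homog L D j) (homog L D k) (homog L D l) H"
  shows "pair_eval H (rL i j) (rL k l) =
    (\<Sum>p\<in>degree_pairs i j. \<Sum>\<alpha>\<in>I. \<Sum>q\<in>degree_pairs k l. \<Sum>\<beta>\<in>I.
      H (tens A B (x \<alpha>) (e p), tens A B (y \<alpha>) (f p)) (tens A B (x \<beta>) (e q), tens A B (y \<beta>) (f q)))"
proof -
  note q = vspace_homog vspace_homog vspace_homog vspace_homog H
  note lin = linear_form_pair_eval_left[OF q rL_closed] linear_form_pair_eval_right[OF q]
  show ?thesis
    unfolding linear_form_rL[OF lin(1)] using lift_term_closed
    by (intro sum.cong refl, subst linear_form_rL[OF lin(2)])
      (auto intro!: tens_closed sum.cong pair_eval_tens[OF q])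
qed

lemma form_rL:
  assumes l: "linear_form A \<phi>" "linear_form A \<psi>" and b: "b \<in> G (- i - m)" "c \<in> G (- j - m)"
  shows "tensor_form (lie_form \<phi> b) (lie_form \<psi> c) (rL i j) =
    (if i + j + m = 0 then pairing \<phi> \<psi> * \<omega> b c else 0)"
proof -
  note bc = G_carrier[OF b(1)] G_carrier[OF b(2)]
  note lin = linear_form_homog[OF linear_form_lie_form[OF l(1) bc(1)]]
    linear_form_homog[OF linear_form_lie_form[OF l(2) bc(2)]]
  have val: "tensor_form (lie_form \<phi> b) (lie_form \<psi> c) (rL i j) =
     pairing \<phi> \<psi> * (\<Sum>p\<in>degree_pairs i j. \<omega> (e p) b * \<omega> (f p) c)"
    unfolding linear_form_rL[OF linear_form_tensor_form[OF lin]] tensor_form_tens[OF lin]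
      lie_form_tens[OF l(1) bc(1)] lie_form_tens[OF l(2) bc(2)] pairing_def sum_product
    by (subst sum.swap) (auto intro!: sum.cong)
  show ?thesis
  proof (cases "i + j + m = 0")
    case True
    then have "- i - m = j" by linarith
    then have "b \<in> G j" using b(1) by simp
    then have "(\<Sum>p\<in>degree_pairs i j. \<omega> (e p) b * \<omega> (f p) c) = \<omega> b c"
      using True by (intro dual_expansion_swapped linear_form_form_left bc) auto
    then show ?thesis using True val by simp
  next
    case False
    then have "degree_pairs i j = {}" using degree_pairs_degree by blast
    then show ?thesis using val False by simp
  qed
qed

end

section \<open>Comparing the two equations\<close>

context quadratic_graded_right_novikov_algebra
begin

lemma form_add_right:
  "\<lbrakk>a \<in> carrier B; b \<in> carrier B; c \<in> carrier B\<rbrakk> \<Longrightarrow> \<omega> a (b \<oplus>\<^bsub>B\<^esub> c) = \<omega> a b + \<omega> a c"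
  using form_add_left[of b c a] form_sym[of a] by simp

text \<open>
  Invariance, read as a relation between the trilinear numbers \<open>(a \<diamondop> b, c)\<close>.  Its right-hand side is
  symmetric in \<open>b\<close> and \<open>c\<close>, which gives the next lemma; the cyclic relation then follows.
\<close>

lemma form_mult:
  assumes "a \<in> carrier B" "b \<in> carrier B" "c \<in> carrier B"
  shows "\<omega> (a \<star>\<^bsub>B\<^esub> b) c = - (\<omega> (b \<star>\<^bsub>B\<^esub> c) a + \<omega> (c \<star>\<^bsub>B\<^esub> b) a)"
  using assms form_invariant[OF assms] form_sym[of a] by (simp add: form_add_right prod_closed)

lemma form_mult_swap:
  assumes "a \<in> carrier B" "b \<in> carrier B" "c \<in> carrier B"
  shows "\<omega> (a \<star>\<^bsub>B\<^esub> b) c = \<omega> (a \<star>\<^bsub>B\<^esub> c) b"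
  using form_mult[of a b c] form_mult[of a c b] assms by simp

lemma form_mult_cyclic:
  assumes "a \<in> carrier B" "b \<in> carrier B" "c \<in> carrier B"
  shows "\<omega> (c \<star>\<^bsub>B\<^esub> a) b = - \<omega> (a \<star>\<^bsub>B\<^esub> b) c - \<omega> (b \<star>\<^bsub>B\<^esub> a) c"
  using form_mult[of a b c] form_mult_swap[of b c a] form_mult_swap[of c b a] assms by simp

end

context lifted_tensor
begin

text \<open>
  Removal of the two sums over dual bases: \<open>g\<close>, \<open>c\<close> stand for one of the pairs \<open>e\<close>, \<open>(f\<^sub>p, b)\<close> and
  \<open>f\<close>, \<open>(e\<^sub>p, b)\<close>, so that \<open>\<Sum>\<^sub>p c\<^sub>p g\<^sub>p = b\<close>.
\<close>

lemma bracket_dual_sum: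
  fixes u v :: "'i \<Rightarrow> 'i \<Rightarrow> 'k"
  assumes b: "\<And>K. linear_form B K \<Longrightarrow> (\<Sum>p\<in>Q. c p * K (g p)) = K b"
    and b': "\<And>K. linear_form B K \<Longrightarrow> (\<Sum>q\<in>Q'. c' q * K (g' q)) = K b'"
    and g: "\<And>p. p \<in> Q \<Longrightarrow> g p \<in> carrier B" and b'_closed: "b' \<in> carrier B" and d: "d \<in> carrier B"
  shows "(\<Sum>p\<in>Q. \<Sum>\<alpha>\<in>I. \<Sum>q\<in>Q'. \<Sum>\<beta>\<in>I.
      (u \<alpha> \<beta> * \<omega> (g p \<star>\<^bsub>B\<^esub> g' q) d - v \<alpha> \<beta> * \<omega> (g' q \<star>\<^bsub>B\<^esub> g p) d) * (c p * c' q)) =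
    (\<Sum>\<alpha>\<in>I. \<Sum>\<beta>\<in>I. u \<alpha> \<beta> * \<omega> (b \<star>\<^bsub>B\<^esub> b') d - v \<alpha> \<beta> * \<omega> (b' \<star>\<^bsub>B\<^esub> b) d)"
proof -
  note lin = B.linear_form_mult[OF linear_form_form_left[OF d]]
  have 1: "(\<Sum>p\<in>Q. \<Sum>q\<in>Q'. \<omega> (g p \<star>\<^bsub>B\<^esub> g' q) d * (c p * c' q)) = \<omega> (b \<star>\<^bsub>B\<^esub> b') d"
  proof -
    have "(\<Sum>p\<in>Q. \<Sum>q\<in>Q'. \<omega> (g p \<star>\<^bsub>B\<^esub> g' q) d * (c p * c' q))
        = (\<Sum>p\<in>Q. c p * (\<Sum>q\<in>Q'. c' q * \<omega> (g p \<star>\<^bsub>B\<^esub> g' q) d))"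
      by (simp add: sum_distrib_left mult_ac)
    also have "\<dots> = (\<Sum>p\<in>Q. c p * \<omega> (g p \<star>\<^bsub>B\<^esub> b') d)"
      using g by (intro sum.cong refl arg_cong2[where f = "(*)"] b' lin(2))
    also have "\<dots> = \<omega> (b \<star>\<^bsub>B\<^esub> b') d" by (intro b lin(1) b'_closed)
    finally show ?thesis .
  qed
  have 2: "(\<Sum>p\<in>Q. \<Sum>q\<in>Q'. \<omega> (g' q \<star>\<^bsub>B\<^esub> g p) d * (c p * c' q)) = \<omega> (b' \<star>\<^bsub>B\<^esub> b) d"
  proof -
    have "(\<Sum>p\<in>Q. \<Sum>q\<in>Q'. \<omega> (g' q \<star>\<^bsub>B\<^esub> g p) d * (c p * c' q))
        = (\<Sum>p\<in>Q. c p * (\<Sum>q\<in>Q'. c' q * \<omega> (g' q \<star>\<^bsub>B\<^esub> g p) d))"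
      by (simp add: sum_distrib_left mult_ac)
    also have "\<dots> = (\<Sum>p\<in>Q. c p * \<omega> (b' \<star>\<^bsub>B\<^esub> g p) d)"
      using g by (intro sum.cong refl arg_cong2[where f = "(*)"] b' lin(1))
    also have "\<dots> = \<omega> (b' \<star>\<^bsub>B\<^esub> b) d" by (intro b lin(2) b'_closed)
    finally show ?thesis .
  qed
  let ?T = "\<lambda>p \<alpha> q \<beta>. (u \<alpha> \<beta> * \<omega> (g p \<star>\<^bsub>B\<^esub> g' q) d - v \<alpha> \<beta> * \<omega> (g' q \<star>\<^bsub>B\<^esub> g p) d) * (c p * c' q)"
  have "(\<Sum>p\<in>Q. \<Sum>\<alpha>\<in>I. \<Sum>q\<in>Q'. \<Sum>\<beta>\<in>I. ?T p \<alpha> q \<beta>) = (\<Sum>p\<in>Q. \<Sum>\<alpha>\<in>I. \<Sum>\<beta>\<in>I. \<Sum>q\<in>Q'. ?T p \<alpha> q \<beta>)"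
    by (intro sum.cong refl sum.swap)
  also have "\<dots> = (\<Sum>\<alpha>\<in>I. \<Sum>p\<in>Q. \<Sum>\<beta>\<in>I. \<Sum>q\<in>Q'. ?T p \<alpha> q \<beta>)" by (rule sum.swap)
  also have "\<dots> = (\<Sum>\<alpha>\<in>I. \<Sum>\<beta>\<in>I. \<Sum>p\<in>Q. \<Sum>q\<in>Q'. ?T p \<alpha> q \<beta>)"
    by (intro sum.cong refl sum.swap)
  also have "\<dots> = (\<Sum>\<alpha>\<in>I. \<Sum>\<beta>\<in>I.
      u \<alpha> \<beta> * (\<Sum>p\<in>Q. \<Sum>q\<in>Q'. \<omega> (g p \<star>\<^bsub>B\<^esub> g' q) d * (c p * c' q))
      - v \<alpha> \<beta> * (\<Sum>p\<in>Q. \<Sum>q\<in>Q'. \<omega> (g' q \<star>\<^bsub>B\<^esub> g p) d * (c p * c' q)))"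
    by (intro sum.cong refl)
      (simp add: left_diff_distrib sum_subtractf mult.assoc flip: sum_distrib_left)
  finally show ?thesis unfolding 1 2 .
qed

context
  fixes \<phi>\<^sub>1 \<phi>\<^sub>2 \<phi>\<^sub>3 :: "'a \<Rightarrow> 'k" and b\<^sub>1 b\<^sub>2 b\<^sub>3 :: 'b and i j k :: int and F\<^sub>1 F\<^sub>2 F\<^sub>3
  assumes l: "linear_form A \<phi>\<^sub>1" "linear_form A \<phi>\<^sub>2" "linear_form A \<phi>\<^sub>3"
    and b: "b\<^sub>1 \<in> G (- i - m)" "b\<^sub>2 \<in> G (- j - m)" "b\<^sub>3 \<in> G (- k - m)"
  defines F\<^sub>1_def: "F\<^sub>1 \<equiv> lie_form \<phi>\<^sub>1 b\<^sub>1" and F\<^sub>2_def: "F\<^sub>2 \<equiv> lie_form \<phi>\<^sub>2 b\<^sub>2"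
    and F\<^sub>3_def: "F\<^sub>3 \<equiv> lie_form \<phi>\<^sub>3 b\<^sub>3"
begin

lemma b_closed: "b\<^sub>1 \<in> carrier B" "b\<^sub>2 \<in> carrier B" "b\<^sub>3 \<in> carrier B"
  using b G_carrier by auto

lemma F_lie_forms: "F\<^sub>1 \<in> lie_forms" "F\<^sub>2 \<in> lie_forms" "F\<^sub>3 \<in> lie_forms"
  using l b_closed by (auto simp: lie_forms_def F\<^sub>1_def F\<^sub>2_def F\<^sub>3_def)

lemma degree_pairs_carrier: "p \<in> degree_pairs i' j' \<Longrightarrow> e p \<in> carrier B \<and> f p \<in> carrier B"
  using G_carrier by (auto simp: degree_pairs_def)

lemma kernel_12_13_rL:
  "pair_eval (kernel_12_13 F\<^sub>1 F\<^sub>2 F\<^sub>3) (rL (- j - m) j) (rL (- k - m) k) =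
    (\<Sum>\<alpha>\<in>I. \<Sum>\<beta>\<in>I. \<phi>\<^sub>1 (x \<alpha> \<star>\<^bsub>A\<^esub> x \<beta>) * \<phi>\<^sub>2 (y \<alpha>) * \<phi>\<^sub>3 (y \<beta>) * \<omega> (b\<^sub>2 \<star>\<^bsub>B\<^esub> b\<^sub>3) b\<^sub>1
      - \<phi>\<^sub>1 (x \<beta> \<star>\<^bsub>A\<^esub> x \<alpha>) * \<phi>\<^sub>2 (y \<alpha>) * \<phi>\<^sub>3 (y \<beta>) * \<omega> (b\<^sub>3 \<star>\<^bsub>B\<^esub> b\<^sub>2) b\<^sub>1)"
  (is "_ = ?R")
proof -
  have "pair_eval (kernel_12_13 F\<^sub>1 F\<^sub>2 F\<^sub>3) (rL (- j - m) j) (rL (- k - m) k) =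
    (\<Sum>p\<in>degree_pairs (- j - m) j. \<Sum>\<alpha>\<in>I. \<Sum>q\<in>degree_pairs (- k - m) k. \<Sum>\<beta>\<in>I.
      (\<phi>\<^sub>1 (x \<alpha> \<star>\<^bsub>A\<^esub> x \<beta>) * \<phi>\<^sub>2 (y \<alpha>) * \<phi>\<^sub>3 (y \<beta>) * \<omega> (e p \<star>\<^bsub>B\<^esub> e q) b\<^sub>1
      - \<phi>\<^sub>1 (x \<beta> \<star>\<^bsub>A\<^esub> x \<alpha>) * \<phi>\<^sub>2 (y \<alpha>) * \<phi>\<^sub>3 (y \<beta>) * \<omega> (e q \<star>\<^bsub>B\<^esub> e p) b\<^sub>1) * (\<omega> (f p) b\<^sub>2 * \<omega> (f q) b\<^sub>3))"
    unfolding pair_eval_rL[OF quadrilinear_kernels(1)[OF F_lie_forms]]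
    by (intro sum.cong refl) (use xy degree_pairs_carrier in
      \<open>simp add: kernel_12_13_def F\<^sub>1_def F\<^sub>2_def F\<^sub>3_def lie_form_bracket_tens lie_form_tens l b_closed algebra_simps\<close>)
  also have "\<dots> = ?R"
    by (rule bracket_dual_sum)
      (use degree_pairs_carrier b b_closed in \<open>auto intro!: dual_expansion\<close>)
  finally show ?thesis .
qed

lemma kernel_12_23_rL:
  "pair_eval (kernel_12_23 F\<^sub>1 F\<^sub>2 F\<^sub>3) (rL i (- i - m)) (rL (- k - m) k) =
    (\<Sum>\<alpha>\<in>I. \<Sum>\<beta>\<in>I. \<phi>\<^sub>1 (x \<alpha>) * \<phi>\<^sub>2 (y \<alpha> \<star>\<^bsub>A\<^esub> x \<beta>) * \<phi>\<^sub>3 (y \<beta>) * \<omega> (b\<^sub>1 \<star>\<^bsub>B\<^esub> b\<^sub>3) b\<^sub>2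
      - \<phi>\<^sub>1 (x \<alpha>) * \<phi>\<^sub>2 (x \<beta> \<star>\<^bsub>A\<^esub> y \<alpha>) * \<phi>\<^sub>3 (y \<beta>) * \<omega> (b\<^sub>3 \<star>\<^bsub>B\<^esub> b\<^sub>1) b\<^sub>2)"
  (is "_ = ?R")
proof -
  have "pair_eval (kernel_12_23 F\<^sub>1 F\<^sub>2 F\<^sub>3) (rL i (- i - m)) (rL (- k - m) k) =
    (\<Sum>p\<in>degree_pairs i (- i - m). \<Sum>\<alpha>\<in>I. \<Sum>q\<in>degree_pairs (- k - m) k. \<Sum>\<beta>\<in>I.
      (\<phi>\<^sub>1 (x \<alpha>) * \<phi>\<^sub>2 (y \<alpha> \<star>\<^bsub>A\<^esub> x \<beta>) * \<phi>\<^sub>3 (y \<beta>) * \<omega> (f p \<star>\<^bsub>B\<^esub> e q) b\<^sub>2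
      - \<phi>\<^sub>1 (x \<alpha>) * \<phi>\<^sub>2 (x \<beta> \<star>\<^bsub>A\<^esub> y \<alpha>) * \<phi>\<^sub>3 (y \<beta>) * \<omega> (e q \<star>\<^bsub>B\<^esub> f p) b\<^sub>2) * (\<omega> (e p) b\<^sub>1 * \<omega> (f q) b\<^sub>3))"
    unfolding pair_eval_rL[OF quadrilinear_kernels(2)[OF F_lie_forms]]
    by (intro sum.cong refl) (use xy degree_pairs_carrier in
      \<open>simp add: kernel_12_23_def F\<^sub>1_def F\<^sub>2_def F\<^sub>3_def lie_form_bracket_tens lie_form_tens l b_closed algebra_simps\<close>)
  also have "\<dots> = ?R"
    by (rule bracket_dual_sum)
      (use degree_pairs_carrier b b_closed in \<open>auto intro!: dual_expansion dual_expansion_swapped\<close>)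
  finally show ?thesis .
qed

lemma kernel_13_23_rL:
  "pair_eval (kernel_13_23 F\<^sub>1 F\<^sub>2 F\<^sub>3) (rL i (- i - m)) (rL j (- j - m)) =
    (\<Sum>\<alpha>\<in>I. \<Sum>\<beta>\<in>I. \<phi>\<^sub>1 (x \<alpha>) * \<phi>\<^sub>2 (x \<beta>) * \<phi>\<^sub>3 (y \<alpha> \<star>\<^bsub>A\<^esub> y \<beta>) * \<omega> (b\<^sub>1 \<star>\<^bsub>B\<^esub> b\<^sub>2) b\<^sub>3
      - \<phi>\<^sub>1 (x \<alpha>) * \<phi>\<^sub>2 (x \<beta>) * \<phi>\<^sub>3 (y \<beta> \<star>\<^bsub>A\<^esub> y \<alpha>) * \<omega> (b\<^sub>2 \<star>\<^bsub>B\<^esub> b\<^sub>1) b\<^sub>3)"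
  (is "_ = ?R")
proof -
  have "pair_eval (kernel_13_23 F\<^sub>1 F\<^sub>2 F\<^sub>3) (rL i (- i - m)) (rL j (- j - m)) =
    (\<Sum>p\<in>degree_pairs i (- i - m). \<Sum>\<alpha>\<in>I. \<Sum>q\<in>degree_pairs j (- j - m). \<Sum>\<beta>\<in>I.
      (\<phi>\<^sub>1 (x \<alpha>) * \<phi>\<^sub>2 (x \<beta>) * \<phi>\<^sub>3 (y \<alpha> \<star>\<^bsub>A\<^esub> y \<beta>) * \<omega> (f p \<star>\<^bsub>B\<^esub> f q) b\<^sub>3
      - \<phi>\<^sub>1 (x \<alpha>) * \<phi>\<^sub>2 (x \<beta>) * \<phi>\<^sub>3 (y \<beta> \<star>\<^bsub>A\<^esub> y \<alpha>) * \<omega> (f q \<star>\<^bsub>B\<^esub> f p) b\<^sub>3) * (\<omega> (e p) b\<^sub>1 * \<omega> (e q) b\<^sub>2))"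
    unfolding pair_eval_rL[OF quadrilinear_kernels(3)[OF F_lie_forms]]
    by (intro sum.cong refl) (use xy degree_pairs_carrier in
      \<open>simp add: kernel_13_23_def F\<^sub>1_def F\<^sub>2_def F\<^sub>3_def lie_form_bracket_tens lie_form_tens l b_closed algebra_simps\<close>)
  also have "\<dots> = ?R"
    by (rule bracket_dual_sum)
      (use degree_pairs_carrier b b_closed in \<open>auto intro!: dual_expansion_swapped\<close>)
  finally show ?thesis .
qed

text \<open>
  The heart of the proof.  \<open>M\<^sub>1, N\<^sub>1, M\<^sub>2, N\<^sub>2, M\<^sub>3, N\<^sub>3\<close> are the six double sums over \<open>r\<close> that occur in the
  three brackets.  Renaming \<open>\<alpha>\<close> and \<open>\<beta>\<close> yields \<open>M\<^sub>3 + M\<^sub>2 + N\<^sub>2 + N\<^sub>1\<close> for the Novikov form with arguments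
  \<open>\<phi>\<^sub>1, \<phi>\<^sub>2, \<phi>\<^sub>3\<close>.  When the first two arguments are exchanged, the last two summands have to be brought to
  this shape by skewsymmetry of \<open>r\<close>, once in \<open>\<alpha>\<close> and once in \<open>\<beta>\<close>.
\<close>

lemma cybe_form:
  assumes skew: "\<And>\<phi> \<psi>. \<lbrakk>linear_form A \<phi>; linear_form A \<psi>\<rbrakk> \<Longrightarrow> pairing \<psi> \<phi> = - pairing \<phi> \<psi>"
  shows "pair_eval (kernel_12_13 F\<^sub>1 F\<^sub>2 F\<^sub>3) (rL (- j - m) j) (rL (- k - m) k)
    + pair_eval (kernel_12_23 F\<^sub>1 F\<^sub>2 F\<^sub>3) (rL i (- i - m)) (rL (- k - m) k)
    + pair_eval (kernel_13_23 F\<^sub>1 F\<^sub>2 F\<^sub>3) (rL i (- i - m)) (rL j (- j - m))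
    = \<omega> (b\<^sub>1 \<star>\<^bsub>B\<^esub> b\<^sub>2) b\<^sub>3 * nybe_form \<phi>\<^sub>1 \<phi>\<^sub>2 \<phi>\<^sub>3 - \<omega> (b\<^sub>2 \<star>\<^bsub>B\<^esub> b\<^sub>1) b\<^sub>3 * nybe_form \<phi>\<^sub>2 \<phi>\<^sub>1 \<phi>\<^sub>3"
proof -
  define u\<^sub>1 u\<^sub>2 where "u\<^sub>1 = \<omega> (b\<^sub>1 \<star>\<^bsub>B\<^esub> b\<^sub>2) b\<^sub>3" and "u\<^sub>2 = \<omega> (b\<^sub>2 \<star>\<^bsub>B\<^esub> b\<^sub>1) b\<^sub>3"
  have \<omega>: "\<omega> (b\<^sub>1 \<star>\<^bsub>B\<^esub> b\<^sub>3) b\<^sub>2 = u\<^sub>1" "\<omega> (b\<^sub>2 \<star>\<^bsub>B\<^esub> b\<^sub>3) b\<^sub>1 = u\<^sub>2"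
    "\<omega> (b\<^sub>3 \<star>\<^bsub>B\<^esub> b\<^sub>1) b\<^sub>2 = - u\<^sub>1 - u\<^sub>2" "\<omega> (b\<^sub>3 \<star>\<^bsub>B\<^esub> b\<^sub>2) b\<^sub>1 = - u\<^sub>1 - u\<^sub>2"
    using b_closed B.form_mult_cyclic[of b\<^sub>1 b\<^sub>2 b\<^sub>3] B.form_mult_swap[of b\<^sub>3 b\<^sub>2 b\<^sub>1]
    by (simp_all add: u\<^sub>1_def u\<^sub>2_def B.form_mult_swap[of b\<^sub>1 b\<^sub>3 b\<^sub>2] B.form_mult_swap[of b\<^sub>2 b\<^sub>3 b\<^sub>1])
  \<comment> \<open>The sums with letter \<open>M\<close> or \<open>N\<close> belong to the first or second term of the respective commutator.\<close>
  define M\<^sub>1 where "M\<^sub>1 = (\<Sum>\<alpha>\<in>I. \<Sum>\<beta>\<in>I. \<phi>\<^sub>1 (x \<alpha> \<star>\<^bsub>A\<^esub> x \<beta>) * \<phi>\<^sub>2 (y \<alpha>) * \<phi>\<^sub>3 (y \<beta>))"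
  define N\<^sub>1 where "N\<^sub>1 = (\<Sum>\<alpha>\<in>I. \<Sum>\<beta>\<in>I. \<phi>\<^sub>1 (x \<beta> \<star>\<^bsub>A\<^esub> x \<alpha>) * \<phi>\<^sub>2 (y \<alpha>) * \<phi>\<^sub>3 (y \<beta>))"
  define M\<^sub>2 where "M\<^sub>2 = (\<Sum>\<alpha>\<in>I. \<Sum>\<beta>\<in>I. \<phi>\<^sub>1 (x \<alpha>) * \<phi>\<^sub>2 (y \<alpha> \<star>\<^bsub>A\<^esub> x \<beta>) * \<phi>\<^sub>3 (y \<beta>))"
  define N\<^sub>2 where "N\<^sub>2 = (\<Sum>\<alpha>\<in>I. \<Sum>\<beta>\<in>I. \<phi>\<^sub>1 (x \<alpha>) * \<phi>\<^sub>2 (x \<beta> \<star>\<^bsub>A\<^esub> y \<alpha>) * \<phi>\<^sub>3 (y \<beta>))"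
  define M\<^sub>3 where "M\<^sub>3 = (\<Sum>\<alpha>\<in>I. \<Sum>\<beta>\<in>I. \<phi>\<^sub>1 (x \<alpha>) * \<phi>\<^sub>2 (x \<beta>) * \<phi>\<^sub>3 (y \<alpha> \<star>\<^bsub>A\<^esub> y \<beta>))"
  define N\<^sub>3 where "N\<^sub>3 = (\<Sum>\<alpha>\<in>I. \<Sum>\<beta>\<in>I. \<phi>\<^sub>1 (x \<alpha>) * \<phi>\<^sub>2 (x \<beta>) * \<phi>\<^sub>3 (y \<beta> \<star>\<^bsub>A\<^esub> y \<alpha>))"
  have combine: "(\<Sum>\<alpha>\<in>I. \<Sum>\<beta>\<in>I. g \<alpha> \<beta> * s - h \<alpha> \<beta> * t)
      = (\<Sum>\<alpha>\<in>I. \<Sum>\<beta>\<in>I. g \<alpha> \<beta>) * s - (\<Sum>\<alpha>\<in>I. \<Sum>\<beta>\<in>I. h \<alpha> \<beta>) * t"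
    for g h :: "'i \<Rightarrow> 'i \<Rightarrow> 'k" and s t
    by (simp add: sum_subtractf sum_distrib_right)
  have sums: "pair_eval (kernel_12_13 F\<^sub>1 F\<^sub>2 F\<^sub>3) (rL (- j - m) j) (rL (- k - m) k) = M\<^sub>1 * u\<^sub>2 + N\<^sub>1 * (u\<^sub>1 + u\<^sub>2)"
    "pair_eval (kernel_12_23 F\<^sub>1 F\<^sub>2 F\<^sub>3) (rL i (- i - m)) (rL (- k - m) k) = M\<^sub>2 * u\<^sub>1 + N\<^sub>2 * (u\<^sub>1 + u\<^sub>2)"
    "pair_eval (kernel_13_23 F\<^sub>1 F\<^sub>2 F\<^sub>3) (rL i (- i - m)) (rL j (- j - m)) = M\<^sub>3 * u\<^sub>1 - N\<^sub>3 * u\<^sub>2"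
    unfolding kernel_12_13_rL kernel_12_23_rL kernel_13_23_rL \<omega> u\<^sub>1_def[symmetric] u\<^sub>2_def[symmetric] combine
      M\<^sub>1_def[symmetric] N\<^sub>1_def[symmetric] M\<^sub>2_def[symmetric] N\<^sub>2_def[symmetric]
      M\<^sub>3_def[symmetric] N\<^sub>3_def[symmetric]
    by (simp_all add: algebra_simps)
  have N123: "nybe_form \<phi>\<^sub>1 \<phi>\<^sub>2 \<phi>\<^sub>3 = M\<^sub>3 + M\<^sub>2 + N\<^sub>2 + N\<^sub>1"
  proof -
    have "N\<^sub>1 = (\<Sum>\<alpha>\<in>I. \<Sum>\<beta>\<in>I. \<phi>\<^sub>1 (x \<alpha> \<star>\<^bsub>A\<^esub> x \<beta>) * \<phi>\<^sub>2 (y \<beta>) * \<phi>\<^sub>3 (y \<alpha>))"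
      unfolding N\<^sub>1_def by (rule sum.swap)
    then show ?thesis
      unfolding nybe_form_def M\<^sub>3_def M\<^sub>2_def N\<^sub>2_def by (simp add: sum.distrib algebra_simps)
  qed
  have N213: "nybe_form \<phi>\<^sub>2 \<phi>\<^sub>1 \<phi>\<^sub>3 = N\<^sub>3 - (M\<^sub>1 + N\<^sub>1) - N\<^sub>2"
  proof -
    have M: "M\<^sub>1 = (\<Sum>\<beta>\<in>I. \<Sum>\<alpha>\<in>I. \<phi>\<^sub>1 (x \<alpha> \<star>\<^bsub>A\<^esub> x \<beta>) * \<phi>\<^sub>2 (y \<alpha>) * \<phi>\<^sub>3 (y \<beta>))"
      unfolding M\<^sub>1_def by (rule sum.swap)
    have N: "N\<^sub>1 = (\<Sum>\<beta>\<in>I. \<Sum>\<alpha>\<in>I. \<phi>\<^sub>1 (x \<beta> \<star>\<^bsub>A\<^esub> x \<alpha>) * \<phi>\<^sub>2 (y \<alpha>) * \<phi>\<^sub>3 (y \<beta>))"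
      unfolding N\<^sub>1_def by (rule sum.swap)
    have N': "N\<^sub>2 = (\<Sum>\<beta>\<in>I. \<Sum>\<alpha>\<in>I. \<phi>\<^sub>1 (x \<alpha>) * \<phi>\<^sub>2 (x \<beta> \<star>\<^bsub>A\<^esub> y \<alpha>) * \<phi>\<^sub>3 (y \<beta>))"
      unfolding N\<^sub>2_def by (rule sum.swap)
    have 1: "(\<Sum>\<alpha>\<in>I. \<Sum>\<beta>\<in>I. \<phi>\<^sub>2 (x \<alpha>) * \<phi>\<^sub>1 (x \<beta>) * \<phi>\<^sub>3 (y \<alpha> \<star>\<^bsub>A\<^esub> y \<beta>)) = N\<^sub>3"
      unfolding N\<^sub>3_def by (subst sum.swap) (simp add: mult_ac)
    have "(\<Sum>\<alpha>\<in>I. \<phi>\<^sub>2 (x \<alpha>) * (\<phi>\<^sub>1 (y \<alpha> \<star>\<^bsub>A\<^esub> x \<beta>) + \<phi>\<^sub>1 (x \<beta> \<star>\<^bsub>A\<^esub> y \<alpha>)))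
        = - (\<Sum>\<alpha>\<in>I. (\<phi>\<^sub>1 (x \<alpha> \<star>\<^bsub>A\<^esub> x \<beta>) + \<phi>\<^sub>1 (x \<beta> \<star>\<^bsub>A\<^esub> x \<alpha>)) * \<phi>\<^sub>2 (y \<alpha>))" if "\<beta> \<in> I" for \<beta>
      using skew[of "\<lambda>a. \<phi>\<^sub>1 (a \<star>\<^bsub>A\<^esub> x \<beta>) + \<phi>\<^sub>1 (x \<beta> \<star>\<^bsub>A\<^esub> a)" \<phi>\<^sub>2] that xy
        A.linear_form_mult[OF l(1)] l(2) by (simp add: pairing_def linear_form_plus)
    then have "(\<Sum>\<beta>\<in>I. (\<Sum>\<alpha>\<in>I. \<phi>\<^sub>2 (x \<alpha>) * (\<phi>\<^sub>1 (y \<alpha> \<star>\<^bsub>A\<^esub> x \<beta>) + \<phi>\<^sub>1 (x \<beta> \<star>\<^bsub>A\<^esub> y \<alpha>))) * \<phi>\<^sub>3 (y \<beta>))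
        = (\<Sum>\<beta>\<in>I. - (\<Sum>\<alpha>\<in>I. (\<phi>\<^sub>1 (x \<alpha> \<star>\<^bsub>A\<^esub> x \<beta>) + \<phi>\<^sub>1 (x \<beta> \<star>\<^bsub>A\<^esub> x \<alpha>)) * \<phi>\<^sub>2 (y \<alpha>)) * \<phi>\<^sub>3 (y \<beta>))"
      by simp
    also have "\<dots> = - (M\<^sub>1 + N\<^sub>1)"
      unfolding M N
      by (simp add: sum_distrib_right sum.distrib sum_negf sum_subtractf distrib_right left_diff_distrib)
    finally have 2: "(\<Sum>\<alpha>\<in>I. \<Sum>\<beta>\<in>I. \<phi>\<^sub>2 (x \<alpha>) * (\<phi>\<^sub>1 (y \<alpha> \<star>\<^bsub>A\<^esub> x \<beta>) + \<phi>\<^sub>1 (x \<beta> \<star>\<^bsub>A\<^esub> y \<alpha>)) * \<phi>\<^sub>3 (y \<beta>))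
        = - (M\<^sub>1 + N\<^sub>1)"
      by (subst sum.swap) (simp add: sum_distrib_right)
    have "(\<Sum>\<beta>\<in>I. \<phi>\<^sub>2 (x \<alpha> \<star>\<^bsub>A\<^esub> x \<beta>) * \<phi>\<^sub>1 (y \<beta>)) = - (\<Sum>\<beta>\<in>I. \<phi>\<^sub>1 (x \<beta>) * \<phi>\<^sub>2 (x \<alpha> \<star>\<^bsub>A\<^esub> y \<beta>))"
      if "\<alpha> \<in> I" for \<alpha>
      using skew[of \<phi>\<^sub>1 "\<lambda>a. \<phi>\<^sub>2 (x \<alpha> \<star>\<^bsub>A\<^esub> a)"] that xy A.linear_form_mult[OF l(2)] l(1)
      by (simp add: pairing_def)
    then have "(\<Sum>\<alpha>\<in>I. (\<Sum>\<beta>\<in>I. \<phi>\<^sub>2 (x \<alpha> \<star>\<^bsub>A\<^esub> x \<beta>) * \<phi>\<^sub>1 (y \<beta>)) * \<phi>\<^sub>3 (y \<alpha>))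
        = (\<Sum>\<alpha>\<in>I. - (\<Sum>\<beta>\<in>I. \<phi>\<^sub>1 (x \<beta>) * \<phi>\<^sub>2 (x \<alpha> \<star>\<^bsub>A\<^esub> y \<beta>)) * \<phi>\<^sub>3 (y \<alpha>))" by simp
    also have "\<dots> = - N\<^sub>2"
      unfolding N' by (simp add: sum_distrib_right sum_negf)
    finally have 3: "(\<Sum>\<alpha>\<in>I. \<Sum>\<beta>\<in>I. \<phi>\<^sub>2 (x \<alpha> \<star>\<^bsub>A\<^esub> x \<beta>) * \<phi>\<^sub>1 (y \<beta>) * \<phi>\<^sub>3 (y \<alpha>)) = - N\<^sub>2"
      by (simp add: sum_distrib_right)
    show ?thesis unfolding nybe_form_def sum.distrib 1 2 3 by simp
  qed
  show ?thesis
    unfolding sums N123 N213 u\<^sub>1_def[symmetric] u\<^sub>2_def[symmetric] by (simp add: algebra_simps)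
qed

lemma form_cybe_lhs:
  assumes skew: "\<And>\<phi> \<psi>. \<lbrakk>linear_form A \<phi>; linear_form A \<psi>\<rbrakk> \<Longrightarrow> pairing \<psi> \<phi> = - pairing \<phi> \<psi>"
  shows "bracket_12_13 L D rL i j k \<oplus>\<^bsub>homog3 L D i j k\<^esub> bracket_12_23 L D rL i j k
      \<oplus>\<^bsub>homog3 L D i j k\<^esub> bracket_13_23 L D rL i j k \<in> carrier (homog3 L D i j k)"
    and "tensor_form3 F\<^sub>1 F\<^sub>2 F\<^sub>3
      (bracket_12_13 L D rL i j k \<oplus>\<^bsub>homog3 L D i j k\<^esub> bracket_12_23 L D rL i j k
        \<oplus>\<^bsub>homog3 L D i j k\<^esub> bracket_13_23 L D rL i j k) =
      (if i + j + k + 2 * m = 0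
       then \<omega> (b\<^sub>1 \<star>\<^bsub>B\<^esub> b\<^sub>2) b\<^sub>3 * nybe_form \<phi>\<^sub>1 \<phi>\<^sub>2 \<phi>\<^sub>3 - \<omega> (b\<^sub>2 \<star>\<^bsub>B\<^esub> b\<^sub>1) b\<^sub>3 * nybe_form \<phi>\<^sub>2 \<phi>\<^sub>1 \<phi>\<^sub>3
       else 0)"
proof -
  note F = F_lie_forms
  note br = form_bracket_12_13[OF F rL_closed rL_antidiagonal, of i j k]
    form_bracket_12_23[OF F rL_closed rL_antidiagonal, of i j k]
    form_bracket_13_23[OF F rL_closed rL_antidiagonal, of i j k]
  note cl = br[THEN conjunct1] and val = br[THEN conjunct2]
  note cl' = vspace_add_closed[OF vspace_tensor cl(1,2)]
  have lin: "linear_form (homog3 L D i j k) (tensor_form3 F\<^sub>1 F\<^sub>2 F\<^sub>3)"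
    by (intro linear_form_tensor_form3 lie_forms_linear F)
  show "bracket_12_13 L D rL i j k \<oplus>\<^bsub>homog3 L D i j k\<^esub> bracket_12_23 L D rL i j k
      \<oplus>\<^bsub>homog3 L D i j k\<^esub> bracket_13_23 L D rL i j k \<in> carrier (homog3 L D i j k)"
    by (rule vspace_add_closed[OF vspace_tensor cl' cl(3)])
  show "tensor_form3 F\<^sub>1 F\<^sub>2 F\<^sub>3
      (bracket_12_13 L D rL i j k \<oplus>\<^bsub>homog3 L D i j k\<^esub> bracket_12_23 L D rL i j k
        \<oplus>\<^bsub>homog3 L D i j k\<^esub> bracket_13_23 L D rL i j k) =
      (if i + j + k + 2 * m = 0
       then \<omega> (b\<^sub>1 \<star>\<^bsub>B\<^esub> b\<^sub>2) b\<^sub>3 * nybe_form \<phi>\<^sub>1 \<phi>\<^sub>2 \<phi>\<^sub>3 - \<omega> (b\<^sub>2 \<star>\<^bsub>B\<^esub> b\<^sub>1) b\<^sub>3 * nybe_form \<phi>\<^sub>2 \<phi>\<^sub>1 \<phi>\<^sub>3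
       else 0)"
    using cybe_form[OF skew] by (simp add: linear_form_add[OF lin] cl cl' val)
qed

end

theorem lie_lift_solves_CYBE:
  assumes "skew_NYBE_solution A rA"
  shows "skew_completed_CYBE_solution L D rL"
proof -
  have skew: "pairing \<psi> \<phi> = - pairing \<phi> \<psi>" if "linear_form A \<phi>" "linear_form A \<psi>" for \<phi> \<psi>
    using assms that unfolding skew_NYBE_solution_iff by blast
  have nybe: "nybe_form \<phi>\<^sub>1 \<phi>\<^sub>2 \<phi>\<^sub>3 = 0" if "linear_form A \<phi>\<^sub>1" "linear_form A \<phi>\<^sub>2" "linear_form A \<phi>\<^sub>3"
    for \<phi>\<^sub>1 \<phi>\<^sub>2 \<phi>\<^sub>3
    using assms that unfolding skew_NYBE_solution_iff by blast
  have "flip (rL j i) = \<ominus>\<^bsub>homog2 L D i j\<^esub> rL i j" for i j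
    unfolding flip_eq_uminus_iff[OF vspace_homog vspace_homog homog_separating homog_separating
        rL_closed rL_closed]
  proof (intro ballI)
    fix F F' assume "F \<in> {lie_form \<phi> b | \<phi> b. linear_form A \<phi> \<and> b \<in> G (- i - m)}"
      and "F' \<in> {lie_form \<phi> b | \<phi> b. linear_form A \<phi> \<and> b \<in> G (- j - m)}"
    then obtain \<phi> b \<psi> c where F: "F = lie_form \<phi> b" "linear_form A \<phi>" "b \<in> G (- i - m)"
      "F' = lie_form \<psi> c" "linear_form A \<psi>" "c \<in> G (- j - m)"
      by blast
    show "tensor_form F' F (rL j i) = - tensor_form F F' (rL i j)"
      using F skew[of \<phi> \<psi>] B.form_sym[of b c] G_carrier by (simp add: form_rL add.commute)
  qed
  moreover have "bracket_12_13 L D rL i j k \<oplus>\<^bsub>homog3 L D i j k\<^esub> bracket_12_23 L D rL i j k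
      \<oplus>\<^bsub>homog3 L D i j k\<^esub> bracket_13_23 L D rL i j k = \<zero>\<^bsub>homog3 L D i j k\<^esub>" for i j k
  proof -
    \<comment> \<open>For membership in the carrier any forms will do, so zero forms are used.\<close>
    have zero_G: "\<zero>\<^bsub>B\<^esub> \<in> G n" for n
      using B.G_subspace[of n] by (auto simp: subspace_def submodule_def)
    have cl: "bracket_12_13 L D rL i j k \<oplus>\<^bsub>homog3 L D i j k\<^esub> bracket_12_23 L D rL i j k
      \<oplus>\<^bsub>homog3 L D i j k\<^esub> bracket_13_23 L D rL i j k \<in> carrier (homog3 L D i j k)"
      by (rule form_cybe_lhs(1)[OF linear_form_zero_fun linear_form_zero_fun linear_form_zero_fun
        zero_G zero_G zero_G]) (rule skew)
    show ?thesis
      unfolding eq_zero_iff_forms[OF vspace_tensor separating_tensor3[OF vspace_homog vspace_homog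
          vspace_homog homog_separating homog_separating homog_separating] cl]
    proof
      fix F assume "F \<in> {tensor_form3 F\<^sub>1 F\<^sub>2 F\<^sub>3 | F\<^sub>1 F\<^sub>2 F\<^sub>3.
        F\<^sub>1 \<in> {lie_form \<phi> b | \<phi> b. linear_form A \<phi> \<and> b \<in> G (- i - m)} \<and>
        F\<^sub>2 \<in> {lie_form \<phi> b | \<phi> b. linear_form A \<phi> \<and> b \<in> G (- j - m)} \<and>
        F\<^sub>3 \<in> {lie_form \<phi> b | \<phi> b. linear_form A \<phi> \<and> b \<in> G (- k - m)}}"
      then obtain \<phi>\<^sub>1 b\<^sub>1 \<phi>\<^sub>2 b\<^sub>2 \<phi>\<^sub>3 b\<^sub>3
        where F: "F = tensor_form3 (lie_form \<phi>\<^sub>1 b\<^sub>1) (lie_form \<phi>\<^sub>2 b\<^sub>2) (lie_form \<phi>\<^sub>3 b\<^sub>3)"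
          and l: "linear_form A \<phi>\<^sub>1" "linear_form A \<phi>\<^sub>2" "linear_form A \<phi>\<^sub>3"
          and b: "b\<^sub>1 \<in> G (- i - m)" "b\<^sub>2 \<in> G (- j - m)" "b\<^sub>3 \<in> G (- k - m)"
        by blast
      show "F (bracket_12_13 L D rL i j k \<oplus>\<^bsub>homog3 L D i j k\<^esub> bracket_12_23 L D rL i j k
        \<oplus>\<^bsub>homog3 L D i j k\<^esub> bracket_13_23 L D rL i j k) = 0"
        unfolding F by (subst form_cybe_lhs(2)[OF l b skew]) (simp_all add: nybe[OF l] nybe[OF l(2,1,3)])
    qed
  qed
  ultimately show ?thesis
    unfolding skew_completed_CYBE_solution_def completed_tensor_def completed_skew_def antidiagonal_def
    using rL_closed rL_antidiagonal by blast
qed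

text \<open>
  Homogeneous elements with \<open>u\<^sub>1 \<noteq> 0\<close> and \<open>u\<^sub>2 = 0\<close> isolate a single Novikov form in \<open>cybe_form\<close>, whose
  other hypothesis, skewsymmetry of \<open>r\<close>, follows from skewsymmetry of the lift and \<open>(c, c') \<noteq> 0\<close>.
\<close>

theorem skew_NYBE_if_lie_lift_solves_CYBE:
  assumes sol: "skew_completed_CYBE_solution L D rL"
    and c: "c \<in> G i" "c' \<in> G j" "\<omega> c c' \<noteq> 0"
    and b: "b\<^sub>1 \<in> G k\<^sub>1" "b\<^sub>2 \<in> G k\<^sub>2" "b\<^sub>3 \<in> G k\<^sub>3"
    and b_val: "\<omega> (b\<^sub>1 \<star>\<^bsub>B\<^esub> b\<^sub>2) b\<^sub>3 \<noteq> 0" "\<omega> (b\<^sub>2 \<star>\<^bsub>B\<^esub> b\<^sub>1) b\<^sub>3 = 0"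
  shows "skew_NYBE_solution A rA"
proof -
  have skew: "pairing \<psi> \<phi> = - pairing \<phi> \<psi>" if l: "linear_form A \<phi>" "linear_form A \<psi>" for \<phi> \<psi>
  proof -
    have ij: "i + j + m = 0" using form_degree c by blast
    have "- i - m = j" "- j - m = i" using ij by auto
    then have G': "c \<in> G (- j - m)" "c' \<in> G (- i - m)" using c by auto
    have "flip (rL i j) = \<ominus>\<^bsub>homog2 L D j i\<^esub> rL j i"
      using sol by (simp add: skew_completed_CYBE_solution_def completed_skew_def)
    moreover have "lie_form \<phi> c \<in> {lie_form \<phi> b | \<phi> b. linear_form A \<phi> \<and> b \<in> G (- j - m)}"
      "lie_form \<psi> c' \<in> {lie_form \<phi> b | \<phi> b. linear_form A \<phi> \<and> b \<in> G (- i - m)}"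
      using l G' by blast+
    ultimately have "tensor_form (lie_form \<psi> c') (lie_form \<phi> c) (rL i j)
        = - tensor_form (lie_form \<phi> c) (lie_form \<psi> c') (rL j i)"
      unfolding flip_eq_uminus_iff[OF vspace_homog vspace_homog homog_separating homog_separating
        rL_closed rL_closed] by blast
    then have "pairing \<psi> \<phi> * \<omega> c' c = - (pairing \<phi> \<psi> * \<omega> c c')"
      using ij by (simp add: form_rL l G' add.commute)
    then show ?thesis
      using c(3) B.form_sym[of c c'] G_carrier[OF c(1)] G_carrier[OF c(2)]
      by (metis minus_mult_left mult_cancel_right)
  qed
  moreover have "nybe_form \<phi>\<^sub>1 \<phi>\<^sub>2 \<phi>\<^sub>3 = 0"
    if l: "linear_form A \<phi>\<^sub>1" "linear_form A \<phi>\<^sub>2" "linear_form A \<phi>\<^sub>3" for \<phi>\<^sub>1 \<phi>\<^sub>2 \<phi>\<^sub>3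
  proof -
    have deg: "k\<^sub>1 + k\<^sub>2 + k\<^sub>3 + m = 0"
      using form_degree[OF _ B.G_prod[OF b(1,2)] b(3)] b_val(1) by blast
    define j\<^sub>1 j\<^sub>2 j\<^sub>3 where "j\<^sub>1 = - k\<^sub>1 - m" and "j\<^sub>2 = - k\<^sub>2 - m" and "j\<^sub>3 = - k\<^sub>3 - m"
    have b': "b\<^sub>1 \<in> G (- j\<^sub>1 - m)" "b\<^sub>2 \<in> G (- j\<^sub>2 - m)" "b\<^sub>3 \<in> G (- j\<^sub>3 - m)"
      using b by (simp_all add: j\<^sub>1_def j\<^sub>2_def j\<^sub>3_def)
    have lin: "linear_form (homog3 L D j\<^sub>1 j\<^sub>2 j\<^sub>3)
        (tensor_form3 (lie_form \<phi>\<^sub>1 b\<^sub>1) (lie_form \<phi>\<^sub>2 b\<^sub>2) (lie_form \<phi>\<^sub>3 b\<^sub>3))"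
      by (intro linear_form_tensor_form3 lie_forms_linear F_lie_forms[OF l b'])
    have "0 = tensor_form3 (lie_form \<phi>\<^sub>1 b\<^sub>1) (lie_form \<phi>\<^sub>2 b\<^sub>2) (lie_form \<phi>\<^sub>3 b\<^sub>3)
      (bracket_12_13 L D rL j\<^sub>1 j\<^sub>2 j\<^sub>3 \<oplus>\<^bsub>homog3 L D j\<^sub>1 j\<^sub>2 j\<^sub>3\<^esub> bracket_12_23 L D rL j\<^sub>1 j\<^sub>2 j\<^sub>3
        \<oplus>\<^bsub>homog3 L D j\<^sub>1 j\<^sub>2 j\<^sub>3\<^esub> bracket_13_23 L D rL j\<^sub>1 j\<^sub>2 j\<^sub>3)"
      using sol linear_form_zero[OF vspace_tensor lin] by (simp add: skew_completed_CYBE_solution_def)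
    also have "\<dots> = \<omega> (b\<^sub>1 \<star>\<^bsub>B\<^esub> b\<^sub>2) b\<^sub>3 * nybe_form \<phi>\<^sub>1 \<phi>\<^sub>2 \<phi>\<^sub>3"
      using deg by (subst form_cybe_lhs(2)[OF l b' skew]) (auto simp: b_val(2) j\<^sub>1_def j\<^sub>2_def j\<^sub>3_def)
    finally show ?thesis using b_val(1) by simp
  qed
  ultimately show ?thesis unfolding skew_NYBE_solution_iff by blast
qed

end

section \<open>Laurent polynomials\<close>

lemma euler_op_one: "euler_op (1 :: int \<Rightarrow>\<^sub>0 'k::field) = 0"
  using euler_op_single[of 0 "1 :: 'k"] by simp

lemma laurent_span:
  "LinearCombinations.module.span class_ring (laurent :: ('k::field, int \<Rightarrow>\<^sub>0 'k) module) (range laurent_t)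
    = carrier laurent"
proof -
  let ?S = "laurent.span (range laurent_t) :: (int \<Rightarrow>\<^sub>0 'k) set"
  interpret S: submodule "class_ring :: 'k ring" ?S laurent
    by (rule laurent.span_is_submodule) (simp add: laurent_sel)
  have t: "laurent_t i \<in> ?S" for i
    using laurent.in_own_span[of "range laurent_t"] by (auto simp: laurent_sel)
  have "Poly_Mapping.single i s \<in> ?S" for i s
    using S.smult_closed[of s "laurent_t i"] t by (simp add: laurent_sel scal_eq_mult mult_single)
  then have "(\<Sum>i\<in>J. Poly_Mapping.single i (c i)) \<in> ?S" for J and c :: "int \<Rightarrow> 'k"
    using S.m_closed S.zero_closed by (induction J rule: infinite_finite_induct) (auto simp: laurent_sel)
  from this[of "Poly_Mapping.lookup u" "Poly_Mapping.keys u" for u] show ?thesis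
    by (auto simp: monom_sum laurent_sel)
qed

lemma laurent_t_homogeneous: "laurent_t n \<in> laurent_grading (n - 1)"
  by (auto simp: laurent_grading_iff)

lemma laurent_lifted_tensor:
  fixes A :: "('k::field, 'a) module"
  assumes A: "nonassoc_algebra A" "separating A {\<phi>. linear_form A \<phi>}"
    and xy: "finite I" "x \<in> I \<rightarrow> carrier A" "y \<in> I \<rightarrow> carrier A"
  shows "lifted_tensor A laurent laurent_grading laurent_form 3 UNIV laurent_t (\<lambda>i. laurent_t (- i - 1)) I x y"
proof -
  have "range (\<lambda>i. laurent_t (- i - 1) :: int \<Rightarrow>\<^sub>0 'k) = range laurent_t"
    by (auto intro: rev_image_eqI[of "- i - 1" for i :: int])
  moreover have "\<exists>i. (laurent_t n :: int \<Rightarrow>\<^sub>0 'k) \<in> laurent_grading i" for n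
    using laurent_t_homogeneous by blast
  moreover have "laurent_form a b = 0"
    if "i + j + 3 \<noteq> 0" "a \<in> laurent_grading i" "b \<in> laurent_grading j" for i j and a b :: "int \<Rightarrow>\<^sub>0 'k"
    using that by (auto simp: laurent_grading_iff laurent_form_eq mult_single lookup_single when_def)
  ultimately show ?thesis
    by (intro lifted_tensor.intro dual_families.intro induced_lie_algebra.intro laurent_quadratic
        lifted_tensor_axioms.intro dual_families_axioms.intro induced_lie_algebra_axioms.intro)
      (simp_all add: A xy laurent_span laurent_dual)
qed

theorem proposition4p2:
  fixes A :: "('k::field_char_0, 'a) module"
    and B :: "('k, 'b) module" and G :: "int \<Rightarrow> 'b set" and \<omega> :: "'b \<Rightarrow> 'b \<Rightarrow> 'k"
    and I :: "'i set" and x y :: "'i \<Rightarrow> 'a" and r :: "('a \<times> 'a \<Rightarrow>\<^sub>0 'k) set"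
    and P :: "'p set" and e f :: "'p \<Rightarrow> 'b"
  assumes "novikov_algebra A" and "vectorspace.fin_dim class_ring A"
    and "finite I" and "x \<in> I \<rightarrow> carrier A" and "y \<in> I \<rightarrow> carrier A"
    and "r = (\<Oplus>\<^bsub>A \<boxtimes> A\<^esub>\<alpha>\<in>I. tens A A (x \<alpha>) (y \<alpha>))"
  shows
    "(quadratic_graded_right_novikov_algebra B G \<omega> \<and> skew_NYBE_solution A r \<and>
      homogeneous_basis B G P e \<and> homogeneous_basis B G P f \<and>
      (\<forall>p\<in>P. \<forall>q\<in>P. \<omega> (e p) (f q) = (if p = q then 1 else 0))
      \<longrightarrow> skew_completed_CYBE_solution (induced_lie A B) (induced_grading A B G)
            (lie_lift A B G I x y P e f))
     \<and>
     (skew_completed_CYBE_solution (induced_lie A laurent) (induced_grading A laurent laurent_grading)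
        (lie_lift A laurent laurent_grading I x y UNIV laurent_t (\<lambda>i. laurent_t (- i - 1)))
      \<longleftrightarrow> skew_NYBE_solution A r)"
proof -
  have A: "nonassoc_algebra A" using assms(1) by (simp add: novikov_algebra_def)
  have sep: "separating A {\<phi>. linear_form A \<phi>}"
    using fin_dim_separating[OF nonassoc_algebra.vspace[OF A] assms(2)] .
  show ?thesis
  proof (intro conjI impI iffI)
    assume hyp: "quadratic_graded_right_novikov_algebra B G \<omega> \<and> skew_NYBE_solution A r \<and>
      homogeneous_basis B G P e \<and> homogeneous_basis B G P f \<and>
      (\<forall>p\<in>P. \<forall>q\<in>P. \<omega> (e p) (f q) = (if p = q then 1 else 0))"
    then interpret B: quadratic_graded_right_novikov_algebra B G \<omega> by blast
    obtain m where m: "\<And>i j a b. \<lbrakk>i + j + m \<noteq> 0; a \<in> G i; b \<in> G j\<rbrakk> \<Longrightarrow> \<omega> a b = 0"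
      using B.form_graded by blast
    have "lifted_tensor A B G \<omega> m P e f I x y"
      using hyp A sep m assms(3-5)
      by (intro lifted_tensor.intro dual_families.intro induced_lie_algebra.intro
          lifted_tensor_axioms.intro dual_families_axioms.intro induced_lie_algebra_axioms.intro)
        (auto simp: homogeneous_basis_def B.basis_def)
    then show "skew_completed_CYBE_solution (induced_lie A B) (induced_grading A B G)
        (lie_lift A B G I x y P e f)"
      using lifted_tensor.lie_lift_solves_CYBE hyp assms(6) by blast
  next
    interpret lifted_tensor A laurent laurent_grading laurent_form 3 UNIV laurent_t
      "\<lambda>i. laurent_t (- i - 1)" I x y
      by (rule laurent_lifted_tensor[OF A sep assms(3-5)])
    show "skew_completed_CYBE_solution (induced_lie A laurent) (induced_grading A laurent laurent_grading)
        (lie_lift A laurent laurent_grading I x y UNIV laurent_t (\<lambda>i. laurent_t (- i - 1)))"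
      if "skew_NYBE_solution A r"
      using lie_lift_solves_CYBE that assms(6) by simp
    show "skew_NYBE_solution A r"
      if "skew_completed_CYBE_solution (induced_lie A laurent) (induced_grading A laurent laurent_grading)
        (lie_lift A laurent laurent_grading I x y UNIV laurent_t (\<lambda>i. laurent_t (- i - 1)))"
      unfolding assms(6)
      \<comment> \<open>\<open>t \<diamondop> 1 = 1\<close> and \<open>(1, t\<^sup>-\<^sup>1) = 1\<close>, but \<open>1 \<diamondop> t = 0\<close>; the monomial \<open>t\<^sup>n\<close> has degree \<open>n - 1\<close>.\<close>
      by (rule skew_NYBE_if_lie_lift_solves_CYBE[where c = "laurent_t 0" and c' = "laurent_t (- 1)"
            and b\<^sub>1 = "laurent_t 1" and b\<^sub>2 = "laurent_t 0" and b\<^sub>3 = "laurent_t (- 1)"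
            and i = "0 - 1" and j = "- 1 - 1" and k\<^sub>1 = "1 - 1" and k\<^sub>2 = "0 - 1" and k\<^sub>3 = "- 1 - 1",
            OF _ laurent_t_homogeneous laurent_t_homogeneous _ laurent_t_homogeneous
            laurent_t_homogeneous laurent_t_homogeneous])
        (auto simp: that laurent_form_eq laurent_mult euler_op_single euler_op_one mult_single)
  qed
qed

end
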